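(* Every irreducible character of $U$ is a constituent of a (unique) supercharacter of $U$.
   Context: Let $p$ be an odd prime, $q=p^{e}$ ($e\ge 1$), $\mathbb{F}_q$ the field with $q$ elements, $\mathbb{F}_q^{\times}=\mathbb{F}_q\setminus\{0\}$, and $n\ge 1$. Let $G$ be one of $Sp_{2n}(q)$, $O_{2n}(q)$, $O_{2n+1}(q)$; put $m=2n$ in the first two cases and $m=2n+1$ in the third. $U_m(q)$ is the group of unipotent upper-triangular $m\times m$ matrices over $\mathbb{F}_q$, and $U=G\cap U_m(q)$. Explicitly, with $J$ the $n\times n$ matrix with $1$'s on the anti-diagonal and $0$'s elsewhere, $U$ consists of all block matrices $\begin{pmatrix} x & xv & xw\\ 0 & I_r & -v^{T}J\\ 0&0&Jx^{-T}J\end{pmatrix}$ with $x\in U_n(q)$, $v$ an $n\times r$ matrix, $w$ an $n\times n$ matrix over $\mathbb{F}_q$, where: $r=0$ and $Jw^T-wJ=0$ if $G=Sp_{2n}(q)$; $r=0$ and $Jw^T+wJ=0$ if $G=O_{2n}(q)$; $r=1$ and $Jw^T+wJ=-vv^T$ if $G=O_{2n+1}(q)$. Characters are complex characters. Indexing. Rows and columns of $m\times m$ matrices are indexed by $1\prec 2\prec\cdots\prec n\prec 0\prec -n\prec\cdots\prec -2\prec -1$ (index $0$ present only if $G=O_{2n+1}(q)$). Roots. $\varepsilon_1,\dots,\varepsilon_n$ are formal independent symbols; $\Phi=\{\varepsilon_i\pm\varepsilon_j:1\le i<j\le n\}\cup\Phi'$ with $\Phi'=\{2\varepsilon_i:1\le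 i\le n\}$ if $G=Sp_{2n}(q)$, $\Phi'=\emptyset$ if $G=O_{2n}(q)$, $\Phi'=\{\varepsilon_i:1\le i\le n\}$ if $G=O_{2n+1}(q)$. For $\alpha\in\Phi$ let $\mathcal{E}(\alpha)$ be: $\{(i,j),(-j,-i)\}$ if $\alpha=\varepsilon_i-\varepsilon_j$; $\{(i,-j),(j,-i)\}$ if $\alpha=\varepsilon_i+\varepsilon_j$ ($i<j$); $\{(i,-i)\}$ if $\alpha=2\varepsilon_i$; $\{(i,0),(0,-i)\}$ if $\alpha=\varepsilon_i$. For $\Psi\subseteq\Phi$, $\mathcal{E}(\Psi)=\bigcup_{\alpha\in\Psi}\mathcal{E}(\alpha)$. Each $\mathcal{E}(\alpha)$ contains exactly one entry $(i,j)$ with $1\le i\le n$ and $i\prec j\preceq -i$; it is called the positive entry of $\alpha$. Basic pairs. $D\subseteq\Phi$ is basic if $\mathcal{E}(D)$ contains at most one entry from each row and at most one from each column. A basic pair for $U$ is $(D,\phi)$ with $D\subseteq\Phi$ basic (possibly empty) and $\phi:D\to\mathbb{F}_q^\times$ a map. Supercharacters. Fix a nontrivial linear character $\vartheta:\mathbb{F}_q\to\mathbb{C}^\times$ of the additive group of $\mathbb{F}_q$. Define subgroups $U_\alpha\le U$: if $\alpha=\varepsilon_i-\varepsilon_j$, $U_\alpha=\{x\in U:x_{i,k}=0,\ i<k<j\}$; if $\alpha=\varepsilon_i+\varepsilon_j$ ($i<j$), $U_\alpha=\{x\in U:x_{i,k}=x_{j,l}=0,\ i<k\le n,\ j\prec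 l\preceq 0\}$ (when the index $0$ is absent, $l$ runs over $j<l\le n$); if $\alpha=2\varepsilon_i$ or $\alpha=\varepsilon_i$, $U_\alpha=\{x\in U:x_{i,k}=0,\ i<k\le n\}$. For $r\in\mathbb{F}_q^\times$, $\lambda_{\alpha,r}(x)=\vartheta(r x_{i,j})$, with $(i,j)$ the positive entry of $\alpha$, is a linear character of $U_\alpha$; the elementary character is the induced character $\xi_{\alpha,r}=(\lambda_{\alpha,r})^U$. The supercharacter of a basic pair is $\xi_{D,\phi}=\prod_{\alpha\in D}\xi_{\alpha,\phi(\alpha)}$ (the trivial character $1_U$ if $D=\emptyset$). *)

theory Defs
  imports
    "Jordan_Normal_Form.VS_Connect"
    "HOL-Computational_Algebra.Primes"
begin

section \<open>Complex characters of a finite group\<close>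

definition mat_trace :: "'a::comm_monoid_add mat \<Rightarrow> 'a" where
  "mat_trace A = (\<Sum>i<dim_row A. A $$ (i, i))"

definition representation ::
    "('g, 'b) monoid_scheme \<Rightarrow> nat \<Rightarrow> ('g \<Rightarrow> complex mat) \<Rightarrow> bool" where
  "representation G d \<rho> \<longleftrightarrow> \<rho> \<in> hom G (units_of (ring_mat TYPE(complex) d ()))"

definition irreducible_representation ::
    "('g, 'b) monoid_scheme \<Rightarrow> nat \<Rightarrow> ('g \<Rightarrow> complex mat) \<Rightarrow> bool" where
  "irreducible_representation G d \<rho> \<longleftrightarrow>
     representation G d \<rho> \<and> d \<ge> 1 \<and>
     (\<forall>W. VectorSpace.subspace class_ring W (module_vec TYPE(complex) d) \<and>
          (\<forall>x\<in>carrier G. \<forall>v\<in>W. \<rho> x *\<^sub>v v \<in> W)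
        \<longrightarrow> W = {0\<^sub>v d} \<or> W = carrier_vec d)"

text \<open>
  All characters are extensional functions: they take the value \<open>undefined\<close> outside the carrier
  of the group, so that equality of characters is equality of functions.
\<close>

definition characters :: "('g, 'b) monoid_scheme \<Rightarrow> ('g \<Rightarrow> complex) set" where
  "characters G =
     {\<lambda>x\<in>carrier G. mat_trace (\<rho> x) | d \<rho>. representation G d \<rho> \<and> d \<ge> 1}"

definition irreducible_characters :: "('g, 'b) monoid_scheme \<Rightarrow> ('g \<Rightarrow> complex) set" where
  "irreducible_characters G =
     {\<lambda>x\<in>carrier G. mat_trace (\<rho> x) | d \<rho>. irreducible_representation G d \<rho>}"

text \<open>
  A character \<open>\<chi>\<close> is a constituent of \<open>\<psi>\<close> if \<open>\<psi> - \<chi>\<close> is zero or a character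
  (Isaacs, Character Theory of Finite Groups, Chapter 2).
\<close>

definition constituent ::
    "('g, 'b) monoid_scheme \<Rightarrow> ('g \<Rightarrow> complex) \<Rightarrow> ('g \<Rightarrow> complex) \<Rightarrow> bool" where
  "constituent G \<chi> \<psi> \<longleftrightarrow>
     \<chi> \<in> characters G \<and> \<psi> \<in> characters G \<and>
     (\<psi> = \<chi> \<or> (\<lambda>x\<in>carrier G. \<psi> x - \<chi> x) \<in> characters G)"

definition induced_character ::
    "('g, 'b) monoid_scheme \<Rightarrow> 'g set \<Rightarrow> ('g \<Rightarrow> complex) \<Rightarrow> 'g \<Rightarrow> complex" where
  "induced_character G H f =
     (\<lambda>x\<in>carrier G.
        (\<Sum>g\<in>{g\<in>carrier G. inv\<^bsub>G\<^esub> g \<otimes>\<^bsub>G\<^esub> x \<otimes>\<^bsub>G\<^esub> g \<in> H}. f (inv\<^bsub>G\<^esub> g \<otimes>\<^bsub>G\<^esub> x \<otimes>\<^bsub>G\<^esub> g))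
        / of_nat (card H))"

definition nontrivial_additive_character :: "('a::field \<Rightarrow> complex) \<Rightarrow> bool" where
  "nontrivial_additive_character \<theta> \<longleftrightarrow>
     (\<forall>a b. \<theta> (a + b) = \<theta> a * \<theta> b) \<and> (\<forall>a. \<theta> a \<noteq> 0) \<and> (\<exists>a. \<theta> a \<noteq> 1)"


section \<open>The unipotent groups\<close>

text \<open>The groups \<open>Sp\<^sub>2\<^sub>n(q)\<close>, \<open>O\<^sub>2\<^sub>n(q)\<close> and \<open>O\<^sub>2\<^sub>n\<^sub>+\<^sub>1(q)\<close>.\<close>

datatype classical_type = Sp_even | O_even | O_odd

fun mid :: "classical_type \<Rightarrow> nat" where
  "mid Sp_even = 0"
| "mid O_even = 0"
| "mid O_odd = 1"

definition size_of :: "classical_type \<Rightarrow> nat \<Rightarrow> nat" where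
  "size_of t n = 2 * n + mid t"

definition antidiag :: "nat \<Rightarrow> 'a::{zero,one} mat" where
  "antidiag n = mat n n (\<lambda>(i, j). if i + j + 1 = n then 1 else 0)"

definition unitriangular :: "nat \<Rightarrow> 'a::{zero,one} mat set" where
  "unitriangular n = {x \<in> carrier_mat n n. upper_triangular x \<and> (\<forall>i<n. x $$ (i, i) = 1)}"

fun w_condition :: "classical_type \<Rightarrow> nat \<Rightarrow> 'a::comm_ring_1 mat \<Rightarrow> 'a mat \<Rightarrow> bool" where
  "w_condition Sp_even n v w \<longleftrightarrow> antidiag n * w\<^sup>T - w * antidiag n = 0\<^sub>m n n"
| "w_condition O_even n v w \<longleftrightarrow> antidiag n * w\<^sup>T + w * antidiag n = 0\<^sub>m n n"
| "w_condition O_odd n v w \<longleftrightarrow> antidiag n * w\<^sup>T + w * antidiag n = - (v * v\<^sup>T)"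

text \<open>
  The block matrix with rows \<open>(x, x v, x w)\<close>, \<open>(0, I, - v\<^sup>T J)\<close>, \<open>(0, 0, J y\<^sup>T J)\<close>, in which
  \<open>y\<close> is to be the inverse of \<open>x\<close>. If \<open>r = 0\<close> the middle row and column are empty.
\<close>

definition block_element ::
    "nat \<Rightarrow> nat \<Rightarrow> 'a::comm_ring_1 mat \<Rightarrow> 'a mat \<Rightarrow> 'a mat \<Rightarrow> 'a mat \<Rightarrow> 'a mat" where
  "block_element n r x y v w =
     four_block_mat
       (four_block_mat x (x * v) (0\<^sub>m r n) (1\<^sub>m r))
       ((x * w) @\<^sub>r (- (v\<^sup>T) * antidiag n))
       (0\<^sub>m n (n + r))
       (antidiag n * y\<^sup>T * antidiag n)"

definition unipotent_carrier :: "classical_type \<Rightarrow> nat \<Rightarrow> 'a::field mat set" where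
  "unipotent_carrier t n =
     {block_element n (mid t) x y v w | x y v w.
        x \<in> unitriangular n \<and> y \<in> carrier_mat n n \<and> inverts_mat x y \<and> inverts_mat y x \<and>
        v \<in> carrier_mat n (mid t) \<and> w \<in> carrier_mat n n \<and> w_condition t n v w}"

definition unipotent_group :: "classical_type \<Rightarrow> nat \<Rightarrow> 'a::field mat monoid" where
  "unipotent_group t n =
     \<lparr>carrier = unipotent_carrier t n, mult = (*), one = 1\<^sub>m (size_of t n)\<rparr>"


section \<open>Indices, roots and basic pairs\<close>

text \<open>
  Rows and columns are labelled \<open>1, \<dots>, n, 0, -n, \<dots>, -1\<close> in this order, with \<open>0\<close> present only
  for \<open>O_odd\<close>; \<open>pos\<close> is the (zero-based) position of a label.
\<close>

definition index_set :: "classical_type \<Rightarrow> nat \<Rightarrow> int set" where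
  "index_set t n = {i. - int n \<le> i \<and> i \<le> int n \<and> (i = 0 \<longrightarrow> t = O_odd)}"

definition pos :: "classical_type \<Rightarrow> nat \<Rightarrow> int \<Rightarrow> nat" where
  "pos t n i =
     (if i > 0 then nat i - 1 else if i = 0 then n else size_of t n - nat (- i))"

definition prec :: "classical_type \<Rightarrow> nat \<Rightarrow> int \<Rightarrow> int \<Rightarrow> bool" where
  "prec t n i j \<longleftrightarrow> pos t n i < pos t n j"

definition entry :: "classical_type \<Rightarrow> nat \<Rightarrow> 'a mat \<Rightarrow> int \<Rightarrow> int \<Rightarrow> 'a" where
  "entry t n x i j = x $$ (pos t n i, pos t n j)"

text \<open>The roots \<open>\<epsilon>\<^sub>i - \<epsilon>\<^sub>j\<close>, \<open>\<epsilon>\<^sub>i + \<epsilon>\<^sub>j\<close>, \<open>2 \<epsilon>\<^sub>i\<close> and \<open>\<epsilon>\<^sub>i\<close>, in this order.\<close>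

datatype root = Minus int int | Plus int int | Twice int | Single int

definition roots :: "classical_type \<Rightarrow> nat \<Rightarrow> root set" where
  "roots t n =
     {Minus i j | i j. 1 \<le> i \<and> i < j \<and> j \<le> int n} \<union>
     {Plus i j | i j. 1 \<le> i \<and> i < j \<and> j \<le> int n} \<union>
     (case t of
        Sp_even \<Rightarrow> {Twice i | i. 1 \<le> i \<and> i \<le> int n}
      | O_even \<Rightarrow> {}
      | O_odd \<Rightarrow> {Single i | i. 1 \<le> i \<and> i \<le> int n})"

fun entries :: "root \<Rightarrow> (int \<times> int) set" where
  "entries (Minus i j) = {(i, j), (- j, - i)}"
| "entries (Plus i j) = {(i, - j), (j, - i)}"
| "entries (Twice i) = {(i, - i)}"
| "entries (Single i) = {(i, 0), (0, - i)}"

fun positive_entry :: "root \<Rightarrow> int \<times> int" where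
  "positive_entry (Minus i j) = (i, j)"
| "positive_entry (Plus i j) = (i, - j)"
| "positive_entry (Twice i) = (i, - i)"
| "positive_entry (Single i) = (i, 0)"

text \<open>
  The explicit values above are the unique \<open>(i, j)\<close> among the entries of the root with
  \<open>1 \<le> i \<le> n\<close> and \<open>i \<prec> j \<preceq> -i\<close>.
\<close>

lemma positive_entry_unique:
  assumes "\<alpha> \<in> roots t n"
  shows "{(i, j) \<in> entries \<alpha>. 1 \<le> i \<and> i \<le> int n \<and> prec t n i j \<and> (prec t n j (- i) \<or> j = - i)}
         = {positive_entry \<alpha>}"
  using assms
  by (cases t; cases \<alpha>) (auto simp: roots_def prec_def pos_def size_of_def)

definition basic :: "classical_type \<Rightarrow> nat \<Rightarrow> root set \<Rightarrow> bool" where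
  "basic t n D \<longleftrightarrow>
     D \<subseteq> roots t n \<and> inj_on fst (\<Union>\<alpha>\<in>D. entries \<alpha>) \<and> inj_on snd (\<Union>\<alpha>\<in>D. entries \<alpha>)"

text \<open>Only the values of \<open>\<phi>\<close> on \<open>D\<close> matter.\<close>

definition basic_pair ::
    "classical_type \<Rightarrow> nat \<Rightarrow> root set \<Rightarrow> (root \<Rightarrow> 'a::field) \<Rightarrow> bool" where
  "basic_pair t n D \<phi> \<longleftrightarrow> basic t n D \<and> (\<forall>\<alpha>\<in>D. \<phi> \<alpha> \<noteq> 0)"


section \<open>Supercharacters\<close>

fun root_subgroup :: "classical_type \<Rightarrow> nat \<Rightarrow> root \<Rightarrow> 'a::field mat set" where
  "root_subgroup t n (Minus i j) =
     {x \<in> unipotent_carrier t n. \<forall>k. i < k \<and> k < j \<longrightarrow> entry t n x i k = 0}"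
| "root_subgroup t n (Plus i j) =
     {x \<in> unipotent_carrier t n.
        (\<forall>k. i < k \<and> k \<le> int n \<longrightarrow> entry t n x i k = 0) \<and>
        (\<forall>l\<in>index_set t n. prec t n j l \<and> 0 \<le> l \<longrightarrow> entry t n x j l = 0)}"
| "root_subgroup t n (Twice i) =
     {x \<in> unipotent_carrier t n. \<forall>k. i < k \<and> k \<le> int n \<longrightarrow> entry t n x i k = 0}"
| "root_subgroup t n (Single i) =
     {x \<in> unipotent_carrier t n. \<forall>k. i < k \<and> k \<le> int n \<longrightarrow> entry t n x i k = 0}"

definition root_character ::
    "('a::field \<Rightarrow> complex) \<Rightarrow> classical_type \<Rightarrow> nat \<Rightarrow> root \<Rightarrow> 'a \<Rightarrow> 'a mat \<Rightarrow> complex" where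
  "root_character \<theta> t n \<alpha> r x =
     \<theta> (r * entry t n x (fst (positive_entry \<alpha>)) (snd (positive_entry \<alpha>)))"

definition elementary_character ::
    "('a::field \<Rightarrow> complex) \<Rightarrow> classical_type \<Rightarrow> nat \<Rightarrow> root \<Rightarrow> 'a \<Rightarrow> 'a mat \<Rightarrow> complex" where
  "elementary_character \<theta> t n \<alpha> r =
     induced_character (unipotent_group t n) (root_subgroup t n \<alpha>) (root_character \<theta> t n \<alpha> r)"

definition supercharacter ::
    "('a::field \<Rightarrow> complex) \<Rightarrow> classical_type \<Rightarrow> nat \<Rightarrow> root set \<Rightarrow> (root \<Rightarrow> 'a)
      \<Rightarrow> 'a mat \<Rightarrow> complex" where
  "supercharacter \<theta> t n D \<phi> =
     (\<lambda>x\<in>unipotent_carrier t n. \<Prod>\<alpha>\<in>D. elementary_character \<theta> t n \<alpha> (\<phi> \<alpha>) x)"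

definition supercharacters ::
    "('a::field \<Rightarrow> complex) \<Rightarrow> classical_type \<Rightarrow> nat \<Rightarrow> ('a mat \<Rightarrow> complex) set" where
  "supercharacters \<theta> t n = {supercharacter \<theta> t n D \<phi> | D \<phi>. basic_pair t n D \<phi>}"

end

(*
  Write m for the size of the matrices and T for the group of all unitriangular m x m matrices. The
  map u |-> (u - u^-1) / 2, followed by multiplication by the Gram matrix of the form, is a bijection
  bil from U onto the space of (skew-)symmetric matrices supported above the antidiagonal, it is
  linear in the entries of u, and conjugation in U becomes congruence, bil (k u k^-1) = k (bil u) k^T.
  Congruence makes sense for all of T. For every A in this space consider the orbit sum
    X_A(u) = sum over g in T of theta <A, g (bil u) g^T>.

  An elementary character is a multiple of an orbit sum for a matrix A with one nonzero entry up to
  symmetry, and since different rows of an element of T are independent, the supercharacter of a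
  basic pair is a multiple of X_A, where A is monomial with support given by D and entries given by
  phi. The functions theta <A, bil u> are orthogonal and sum up to a multiple of the regular
  character, so the theorem amounts to the fact that every T-orbit contains exactly one monomial
  matrix. Existence is symmetric Gaussian elimination, uniqueness a comparison of entries.
*)

theory Submission
  imports Defs
begin

section \<open>Characters of finite groups\<close>

text \<open>The rows of an element of \<open>U\<close> are tied to each other by the form. So inside
  \<open>U\<close> the factors of a supercharacter cannot be averaged independently, and elementary
  row operations lead out of \<open>U\<close>. Both obstacles disappear in \<open>T\<close>. For a
  single root the passage from \<open>U\<close> to \<open>T\<close> is possible because
  \<open>T\<close> is the product of a set \<open>stab a b\<close> with \<open>U\<close>, and
  because averaging over \<open>stab a b\<close> produces the indicator function of the root
  subgroup times its linear character. The map \<open>bil\<close> is preferred to a logarithm or a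
  Cayley transform because the inverse of an isometry is its adjoint: the difference of
  \<open>u\<close> and its inverse is linear in the entries of \<open>u\<close>, and the root
  subgroups, which are given by vanishing entries, become linear conditions on \<open>bil u\<close>.
  Odd characteristic enters through division by \<open>2\<close>: in the injectivity of
  \<open>bil\<close>, in solving the equation for \<open>w\<close>, in the weights of the pairing,
  and in clearing diagonal entries during the elimination. That \<open>bil\<close> is onto, and that
  \<open>U\<close> consists of all unitriangular isometries, both come out of one count.\<close>

lemma rank_factorization:
  fixes E :: "'a::field mat"
  assumes E: "E \<in> carrier_mat nr nc"
  obtains k A B A' B' where "A \<in> carrier_mat nr k" "B \<in> carrier_mat k nc"
    "A' \<in> carrier_mat k nr" "B' \<in> carrier_mat nc k"
    "E = A * B" "A' * A = 1\<^sub>m k" "B * B' = 1\<^sub>m k"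
proof -
  define C where "C = gauss_jordan_single E"
  from gauss_jordan_single(2-4)[OF E C_def[symmetric]]
  obtain P Q where C: "C \<in> carrier_mat nr nc" and re: "row_echelon_form C"
    and CP: "C = P * E" and P: "P \<in> carrier_mat nr nr" and Q: "Q \<in> carrier_mat nr nr"
    and PQ: "P * Q = 1\<^sub>m nr" "Q * P = 1\<^sub>m nr" by blast
  from re C obtain f where pf: "pivot_fun C f nc" unfolding row_echelon_form_def by auto
  have d: "dim_row C = nr" using C by simp
  note pv = pivot_funD[OF d pf]
  \<comment> \<open>The rank. The value \<open>f i = nc\<close> marks a zero row, and once it occurs
    it persists, so the nonzero rows are exactly the first \<open>k\<close>.\<close>
  define k where "k = (LEAST i. i \<ge> nr \<or> f i = nc)"
  have k0: "k \<ge> nr \<or> f k = nc" unfolding k_def by (rule LeastI[of _ nr]) simp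
  have klt: "i < nr \<and> f i \<noteq> nc" if "i < k" for i
    using not_less_Least[of i "\<lambda>i. i \<ge> nr \<or> f i = nc"] that unfolding k_def by auto
  have knr: "k \<le> nr" unfolding k_def by (rule Least_le) simp
  have piv: "f i < nc" if "i < k" for i using klt[OF that] pv(1)[of i] by auto
  have kge: "i \<ge> k \<Longrightarrow> i < nr \<Longrightarrow> f i = nc" for i
  proof (induction i rule: dec_induct)
    case base then show ?case using k0 by auto
  next
    case (step i)
    then have a: "i < nr" "Suc i < nr" "f i = nc" by auto
    show ?case using pv(3)[OF a(1,2)] pv(1)[OF a(2)] a(3) by linarith
  qed
  have zero: "C $$ (i, j) = 0" if "i \<ge> k" "i < nr" "j < nc" for i j
    using kge[OF that(1,2)] pv(2)[of i j] that by auto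
  \<comment> \<open>\<open>E = Q * C\<close> with \<open>Q\<close> inverse to \<open>P\<close>, and
    only the first \<open>k\<close> rows of \<open>C\<close> count. So \<open>A\<close> consists of
    columns of \<open>Q\<close>, with a left inverse made of rows of \<open>P\<close>;
    \<open>B'\<close> selects the pivot columns of \<open>B\<close>, which form an identity
    matrix.\<close>
  define A where "A = mat nr k (\<lambda>(i, j). Q $$ (i, j))"
  define A' where "A' = mat k nr (\<lambda>(i, j). P $$ (i, j))"
  define B where "B = mat k nc (\<lambda>(i, j). C $$ (i, j))"
  define B' where "B' = mat nc k (\<lambda>(i, j). if i = f j then 1 else 0 :: 'a)"
  have EQ: "E = Q * C" unfolding CP
    using assoc_mult_mat[OF Q P E] E by (simp add: PQ)
  have "E = A * B"
  proof (rule eq_matI)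
    fix i j assume ij: "i < dim_row (A * B)" "j < dim_col (A * B)"
    then have i: "i < nr" and j: "j < nc" by (auto simp: A_def B_def)
    have "E $$ (i, j) = (\<Sum>l = 0..<nr. Q $$ (i, l) * C $$ (l, j))"
      unfolding EQ using i j Q C by (simp add: scalar_prod_def)
    also have "\<dots> = (\<Sum>l = 0..<k. Q $$ (i, l) * C $$ (l, j))"
      using knr zero j by (intro sum.mono_neutral_right) auto
    also have "\<dots> = (A * B) $$ (i, j)" using i j by (simp add: A_def B_def scalar_prod_def)
    finally show "E $$ (i, j) = (A * B) $$ (i, j)" .
  qed (use E in \<open>auto simp: A_def B_def\<close>)
  moreover have "A' * A = 1\<^sub>m k"
  proof (rule eq_matI)
    fix i j assume ij: "i < dim_row (1\<^sub>m k :: 'a mat)" "j < dim_col (1\<^sub>m k :: 'a mat)"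
    have "(A' * A) $$ (i, j) = (P * Q) $$ (i, j)"
      using ij knr P Q by (simp add: A_def A'_def scalar_prod_def)
    then show "(A' * A) $$ (i, j) = 1\<^sub>m k $$ (i, j)" using PQ ij knr by simp
  qed (auto simp: A_def A'_def)
  moreover have "B * B' = 1\<^sub>m k"
  proof (rule eq_matI)
    fix i j assume ij: "i < dim_row (1\<^sub>m k :: 'a mat)" "j < dim_col (1\<^sub>m k :: 'a mat)"
    have "(B * B') $$ (i, j) = (\<Sum>l = 0..<nc. C $$ (i, l) * (if l = f j then 1 else 0))"
      using ij by (simp add: B_def B'_def scalar_prod_def)
    also have "\<dots> = C $$ (i, f j)" using piv[of j] ij
      by (simp add: if_distrib cong: if_cong)
    also have "\<dots> = 1\<^sub>m k $$ (i, j)"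
    proof (cases "i = j")
      case True then show ?thesis using ij knr piv[of j] pv(4)[of j] by simp
    next
      case False then show ?thesis using ij knr piv[of j] pv(5)[of j i] by simp
    qed
    finally show "(B * B') $$ (i, j) = 1\<^sub>m k $$ (i, j)" .
  qed (auto simp: B_def B'_def)
  ultimately show ?thesis
    using that[of A k B A' B'] by (simp add: A_def A'_def B_def B'_def)
qed


section \<open>Traces, idempotents and matrix representations\<close>

lemma mat_trace_comm:
  fixes A :: "'a::comm_semiring_0 mat"
  assumes "A \<in> carrier_mat n k" "B \<in> carrier_mat k n"
  shows "mat_trace (A * B) = mat_trace (B * A)"
proof -
  have "mat_trace (A * B) = (\<Sum>i<n. \<Sum>j<k. A $$ (i, j) * B $$ (j, i))"
    using assms by (simp add: mat_trace_def scalar_prod_def atLeast0LessThan)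
  also have "\<dots> = (\<Sum>j<k. \<Sum>i<n. B $$ (j, i) * A $$ (i, j))"
    by (subst sum.swap) (simp add: mult.commute)
  also have "\<dots> = mat_trace (B * A)"
    using assms by (simp add: mat_trace_def scalar_prod_def atLeast0LessThan)
  finally show ?thesis .
qed

lemma mat_trace_one: "mat_trace (1\<^sub>m k :: complex mat) = of_nat k"
  by (simp add: mat_trace_def)

text \<open>An idempotent acts as the identity on its image. In terms of a rank factorization,
  \<open>A' * E = B\<close> gives \<open>B * E = B\<close>, and the right inverse \<open>B'\<close>
  cancels the last factor of \<open>B * A * B = B\<close>.\<close>

lemma idempotent_factorization:
  fixes E :: "'a::field mat"
  assumes E: "E \<in> carrier_mat n n" and EE: "E * E = E"
  obtains k A B where "A \<in> carrier_mat n k" "B \<in> carrier_mat k n" "E = A * B" "B * A = 1\<^sub>m k"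
proof -
  obtain k A B A' B' where c: "A \<in> carrier_mat n k" "B \<in> carrier_mat k n"
    "A' \<in> carrier_mat k n" "B' \<in> carrier_mat n k"
    and f: "E = A * B" "A' * A = 1\<^sub>m k" "B * B' = 1\<^sub>m k"
    using rank_factorization[OF E] by metis
  have AE: "A' * E = B"
    using c f by (simp add: assoc_mult_mat[OF c(3,1,2), symmetric])
  have "B * E = A' * (E * E)" using assoc_mult_mat[OF c(3) E E] AE by simp
  then have "B * E = B" unfolding EE AE .
  then have "B * A * B = B" unfolding f(1) using assoc_mult_mat[OF c(2,1,2)] by simp
  then have "B * A * (B * B') = B * B'"
    using assoc_mult_mat[OF mult_carrier_mat[OF c(2,1)] c(2,4)] by simp
  then have "B * A = 1\<^sub>m k" using c f by simp
  with c f(1) that show ?thesis by blast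
qed

text \<open>A unit that is idempotent equals one, which gives the value at the identity; conversely
  the image of \<open>inv x\<close> inverts the image of \<open>x\<close>.\<close>

lemma representation_iff:
  fixes G (structure)
  assumes "group G"
  shows "representation G d \<rho> \<longleftrightarrow>
    (\<forall>x\<in>carrier G. \<rho> x \<in> carrier_mat d d) \<and>
    (\<forall>x\<in>carrier G. \<forall>y\<in>carrier G. \<rho> (x \<otimes> y) = \<rho> x * \<rho> y) \<and> \<rho> \<one> = 1\<^sub>m d"
    (is "?L \<longleftrightarrow> ?R")
proof -
  interpret group G by fact
  interpret R: ring "ring_mat TYPE(complex) d ()" by (rule ring_mat)
  note S = ring_mat_simps
  show ?thesis
  proof
    assume L: ?L
    then have cl: "\<rho> x \<in> Units (ring_mat TYPE(complex) d ())" if "x \<in> carrier G" for x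
      using that by (auto simp: representation_def hom_def units_of_def)
    then have car: "\<rho> x \<in> carrier_mat d d" if "x \<in> carrier G" for x
      using that by (auto simp: Units_def ring_mat_simps)
    have mul: "\<rho> (x \<otimes> y) = \<rho> x * \<rho> y" if "x \<in> carrier G" "y \<in> carrier G" for x y
      using L that by (auto simp: representation_def hom_def units_of_def ring_mat_simps)
    obtain z where z: "z \<in> carrier_mat d d" "z * \<rho> \<one> = 1\<^sub>m d"
      using cl[of \<one>] by (auto simp: Units_def ring_mat_simps)
    have e: "\<rho> \<one> * \<rho> \<one> = \<rho> \<one>" using mul[of \<one> \<one>] by simp
    have "\<rho> \<one> = z * (\<rho> \<one> * \<rho> \<one>)"
      using assoc_mult_mat[OF z(1) car[of \<one>] car[of \<one>]] z car[of \<one>] by simp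
    then have "\<rho> \<one> = 1\<^sub>m d" unfolding e z .
    with car mul show ?R by auto
  next
    assume R: ?R
    have "\<rho> x \<in> Units (ring_mat TYPE(complex) d ())" if x: "x \<in> carrier G" for x
    proof -
      have "\<rho> (inv x) * \<rho> x = 1\<^sub>m d" "\<rho> x * \<rho> (inv x) = 1\<^sub>m d"
        using R x l_inv[OF x] r_inv[OF x] by (metis inv_closed)+
      then show ?thesis using R x by (auto simp: Units_def ring_mat_simps)
    qed
    then show ?L using R by (auto simp: representation_def hom_def units_of_def ring_mat_simps)
  qed
qed

lemma charactersI:
  "representation G d \<rho> \<Longrightarrow> 1 \<le> d \<Longrightarrow> (\<lambda>x\<in>carrier G. mat_trace (\<rho> x)) \<in> characters G"
  unfolding characters_def by blast

lemma carrier_sum_translate: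
  fixes G (structure)
  assumes "group G" "h \<in> carrier G"
  shows "(\<Sum>g\<in>carrier G. f (h \<otimes> g)) = (\<Sum>g\<in>carrier G. f g)"
proof -
  interpret group G by fact
  show ?thesis
    by (rule sum.reindex_bij_witness[of _ "\<lambda>g. inv h \<otimes> g" "\<lambda>g. h \<otimes> g"])
      (use assms in \<open>auto simp: m_assoc[symmetric]\<close>)
qed

text \<open>Compressing to the image of the idempotent \<open>L \<one>\<close> turns \<open>L\<close> into a representation.\<close>

lemma nonunital_trace:
  fixes G (structure)
  assumes G: "group G"
    and car: "\<And>x. x \<in> carrier G \<Longrightarrow> L x \<in> carrier_mat n n"
    and mul: "\<And>x y. x \<in> carrier G \<Longrightarrow> y \<in> carrier G \<Longrightarrow> L (x \<otimes> y) = L x * L y"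
  shows "(\<lambda>x\<in>carrier G. mat_trace (L x)) \<in> characters G \<or>
    (\<forall>x\<in>carrier G. mat_trace (L x) = 0)"
proof -
  interpret group G by fact
  have E: "L \<one> \<in> carrier_mat n n" using car by simp
  have EE: "L \<one> * L \<one> = L \<one>" using mul[of \<one> \<one>] by simp
  obtain k A B where A: "A \<in> carrier_mat n k" and B: "B \<in> carrier_mat k n"
    and f: "L \<one> = A * B" "B * A = 1\<^sub>m k"
    using idempotent_factorization[OF E EE] by metis
  have tr: "mat_trace (B * L x * A) = mat_trace (L x)" if x: "x \<in> carrier G" for x
  proof -
    have "mat_trace (B * L x * A) = mat_trace (A * (B * L x))"
      by (rule mat_trace_comm) (use A B car[OF x] in auto)
    also have "A * (B * L x) = L \<one> * L x"
      using A B car[OF x] by (simp add: f(1))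
    finally show ?thesis using mul[of \<one> x] x by simp
  qed
  have rep: "representation G k (\<lambda>x. B * L x * A)"
  proof (unfold representation_iff[OF G], intro conjI ballI)
    fix x y assume x: "x \<in> carrier G" and y: "y \<in> carrier G"
    note c = car[OF x] car[OF y] A B
    have BLy: "B * L y \<in> carrier_mat k n" and BLx: "B * L x \<in> carrier_mat k n" using c by auto
    have "A * (B * L y) = L y"
      using assoc_mult_mat[OF A B c(2)] mul[of \<one> y] y f by simp
    then have "A * (B * L y * A) = L y * A"
      using assoc_mult_mat[OF A BLy A] by simp
    then have "B * L x * A * (B * L y * A) = B * L x * (L y * A)"
      using assoc_mult_mat[OF BLx A, of "B * L y * A" k] BLy A by simp
    also have "\<dots> = B * L x * L y * A" using assoc_mult_mat[OF BLx c(2) A] by simp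
    also have "B * L x * L y = B * L (x \<otimes> y)"
      using assoc_mult_mat[OF B c(1,2)] mul[OF x y] by simp
    finally show "B * L (x \<otimes> y) * A = B * L x * A * (B * L y * A)" by simp
  next
    have "B * L \<one> = B" using assoc_mult_mat[OF B A B] f B by simp
    then show "B * L \<one> * A = 1\<^sub>m k" using f by simp
  qed (use A B car in auto)
  show ?thesis
  \<comment> \<open>Characters have positive degree, so a zero image is treated apart: there all
    traces vanish.\<close>
  proof (cases "k \<ge> 1")
    case True
    have "(\<lambda>x\<in>carrier G. mat_trace (L x)) = (\<lambda>x\<in>carrier G. mat_trace (B * L x * A))"
      using tr by (auto simp: restrict_def)
    then show ?thesis using charactersI[OF rep True] by simp
  next
    case False
    then have "k = 0" by simp
    then have "mat_trace (B * L x * A) = 0" if "x \<in> carrier G" for x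
      using B by (simp add: mat_trace_def)
    then show ?thesis using tr by simp
  qed
qed

lemma trivial_character:
  assumes "group G"
  shows "(\<lambda>x\<in>carrier G. 1) \<in> characters G"
proof -
  have "representation G 1 (\<lambda>x. 1\<^sub>m 1)" using assms by (auto simp: representation_iff)
  then show ?thesis unfolding characters_def
    by (intro CollectI exI[of _ 1] exI[of _ "\<lambda>x. 1\<^sub>m 1"]) (auto simp: mat_trace_def)
qed

lemma character_one:
  fixes G (structure)
  assumes "group G" "\<psi> \<in> characters G"
  obtains d where "d \<ge> 1" "\<psi> \<one> = of_nat d"
proof -
  interpret group G by fact
  obtain d \<rho> where "representation G d \<rho>" "d \<ge> 1" "\<psi> = (\<lambda>x\<in>carrier G. mat_trace (\<rho> x))"
    using assms by (auto simp: characters_def)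
  then show ?thesis using that[of d] by (auto simp: representation_iff[OF assms(1)] mat_trace_one)
qed

text \<open>Its trace at \<open>x\<close> is the character value at \<open>inv x\<close>. Tensoring
  with it turns \<open>char_form\<close> of two characters into the plain sum of one character over
  the group.\<close>

lemma dual_representation:
  fixes G (structure)
  assumes G: "group G" and r: "representation G d \<rho>"
  shows "representation G d (\<lambda>x. (\<rho> (inv x))\<^sup>T)"
proof -
  interpret group G by fact
  have c: "\<rho> x \<in> carrier_mat d d" if "x \<in> carrier G" for x
    using r that by (simp add: representation_iff[OF G])
  show ?thesis using r unfolding representation_iff[OF G]
    by (auto simp: inv_mult_group transpose_mult[OF c c])
qed

section \<open>Tensor products of representations\<close>

lemma sum_lessThan_mult:
  fixes f :: "nat \<Rightarrow> nat \<Rightarrow> 'a::comm_monoid_add"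
  shows "(\<Sum>i<a * b. f (i div b) (i mod b)) = (\<Sum>i<a. \<Sum>j<b. f i j)"
proof -
  have "(\<Sum>i<a. \<Sum>j<b. f i j) = (\<Sum>(i, j)\<in>{..<a} \<times> {..<b}. f i j)"
    by (rule sum.cartesian_product)
  also have "\<dots> = (\<Sum>i<a * b. f (i div b) (i mod b))"
  proof (rule sum.reindex_bij_witness[of _ "\<lambda>i. (i div b, i mod b)" "\<lambda>(x, y). x * b + y"])
    fix x assume "x \<in> {..<a} \<times> {..<b}"
    then obtain i j where x: "x = (i, j)" "i < a" "j < b" by auto
    have "i * b + j < Suc i * b" using x by simp
    also have "\<dots> \<le> a * b" using x by (intro mult_right_mono) auto
    finally show "(case x of (x, y) \<Rightarrow> x * b + y) \<in> {..<a * b}" using x by simp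
  next
    fix k assume k: "k \<in> {..<a * b}"
    then have "0 < b" by (cases b) auto
    then show "(k div b, k mod b) \<in> {..<a} \<times> {..<b}" using k by (auto simp: less_mult_imp_div_less)
  qed auto
  finally show ?thesis by simp
qed

definition kronecker :: "'a::semiring_0 mat \<Rightarrow> 'a mat \<Rightarrow> 'a mat" where
  "kronecker A B = mat (dim_row A * dim_row B) (dim_col A * dim_col B)
     (\<lambda>(i, j). A $$ (i div dim_row B, j div dim_col B) * B $$ (i mod dim_row B, j mod dim_col B))"

lemma kronecker_carrier:
  "A \<in> carrier_mat a a \<Longrightarrow> B \<in> carrier_mat b b \<Longrightarrow> kronecker A B \<in> carrier_mat (a * b) (a * b)"
  by (simp add: kronecker_def)

lemma kronecker_index:
  assumes "A \<in> carrier_mat a a" "B \<in> carrier_mat b b" "i < a" "j < b" "k < a" "l < b"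
  shows "kronecker A B $$ (i * b + j, k * b + l) = A $$ (i, k) * B $$ (j, l)"
proof -
  have "i * b + j < a * b" if "i < a" "j < b" for i j
  proof -
    have "i * b + j < Suc i * b" using that by simp
    also have "\<dots> \<le> a * b" using that by (intro mult_right_mono) auto
    finally show ?thesis .
  qed
  then show ?thesis using assms by (simp add: kronecker_def)
qed

lemma kronecker_mult:
  fixes A :: "'a::comm_semiring_0 mat"
  assumes "A \<in> carrier_mat a a" "A' \<in> carrier_mat a a" "B \<in> carrier_mat b b" "B' \<in> carrier_mat b b"
  shows "kronecker A B * kronecker A' B' = kronecker (A * A') (B * B')"
proof (rule eq_matI)
  fix i j assume "i < dim_row (kronecker (A * A') (B * B'))" "j < dim_col (kronecker (A * A') (B * B'))"
  then have i: "i < a * b" and j: "j < a * b" using assms by (auto simp: kronecker_def)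
  then have b0: "0 < b" by (cases b) auto
  have b: "i div b < a" "j div b < a" "i mod b < b" "j mod b < b"
    using i j b0 by (auto simp: less_mult_imp_div_less)
  have "(kronecker A B * kronecker A' B') $$ (i, j) =
     (\<Sum>k<a * b. (A $$ (i div b, k div b) * B $$ (i mod b, k mod b)) * (A' $$ (k div b, j div b) * B' $$ (k mod b, j mod b)))"
    using i j assms by (simp add: kronecker_def scalar_prod_def atLeast0LessThan)
  also have "\<dots> = (\<Sum>k<a. \<Sum>l<b. (A $$ (i div b, k) * B $$ (i mod b, l)) * (A' $$ (k, j div b) * B' $$ (l, j mod b)))"
    by (rule sum_lessThan_mult[of "\<lambda>k l. (A $$ (i div b, k) * B $$ (i mod b, l)) * (A' $$ (k, j div b) * B' $$ (l, j mod b))"])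
  also have "\<dots> = (\<Sum>k<a. A $$ (i div b, k) * A' $$ (k, j div b)) * (\<Sum>l<b. B $$ (i mod b, l) * B' $$ (l, j mod b))"
    by (simp add: sum_product mult_ac)
  also have "\<dots> = kronecker (A * A') (B * B') $$ (i, j)"
    using i j b assms by (simp add: kronecker_def scalar_prod_def atLeast0LessThan)
  finally show "(kronecker A B * kronecker A' B') $$ (i, j) = kronecker (A * A') (B * B') $$ (i, j)" .
qed (use assms in \<open>auto simp: kronecker_def\<close>)

lemma kronecker_one: "kronecker (1\<^sub>m a) (1\<^sub>m b) = (1\<^sub>m (a * b) :: 'a::semiring_1 mat)"
proof (rule eq_matI)
  fix i j assume "i < dim_row (1\<^sub>m (a * b) :: 'a mat)" "j < dim_col (1\<^sub>m (a * b) :: 'a mat)"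
  then have i: "i < a * b" and j: "j < a * b" by auto
  then have b0: "0 < b" by (cases b) auto
  have b: "i div b < a" "j div b < a" "i mod b < b" "j mod b < b"
    using i j b0 by (auto simp: less_mult_imp_div_less)
  have "i div b = j div b \<and> i mod b = j mod b \<longleftrightarrow> i = j" by (metis div_mult_mod_eq)
  then show "kronecker (1\<^sub>m a) (1\<^sub>m b) $$ (i, j) = (1\<^sub>m (a * b) :: 'a mat) $$ (i, j)"
    using i j b by (auto simp: kronecker_def)
qed (auto simp: kronecker_def)

lemma kronecker_trace:
  fixes A :: "'a::comm_semiring_0 mat"
  assumes "A \<in> carrier_mat a a" "B \<in> carrier_mat b b"
  shows "mat_trace (kronecker A B) = mat_trace A * mat_trace B"
proof -
  have "mat_trace (kronecker A B) = (\<Sum>k<a * b. A $$ (k div b, k div b) * B $$ (k mod b, k mod b))"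
    using assms by (simp add: mat_trace_def kronecker_def)
  also have "\<dots> = (\<Sum>k<a. \<Sum>l<b. A $$ (k, k) * B $$ (l, l))"
    by (rule sum_lessThan_mult[of "\<lambda>k l. A $$ (k, k) * B $$ (l, l)"])
  finally show ?thesis using assms by (simp add: mat_trace_def sum_product)
qed

lemma kronecker_representation:
  assumes G: "group G" and "representation G d \<rho>" "representation G e \<sigma>"
  shows "representation G (d * e) (\<lambda>x. kronecker (\<rho> x) (\<sigma> x))"
  using assms(2,3) unfolding representation_iff[OF G]
  by (auto simp: kronecker_carrier kronecker_one kronecker_mult[of _ d _ _ e])

lemma character_mult:
  assumes G: "group G" and "\<phi> \<in> characters G" "\<psi> \<in> characters G"
  shows "(\<lambda>x\<in>carrier G. \<phi> x * \<psi> x) \<in> characters G"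
proof -
  obtain d \<rho> e \<sigma> where r: "representation G d \<rho>" "d \<ge> 1" "\<phi> = (\<lambda>x\<in>carrier G. mat_trace (\<rho> x))"
    "representation G e \<sigma>" "e \<ge> 1" "\<psi> = (\<lambda>x\<in>carrier G. mat_trace (\<sigma> x))"
    using assms by (auto simp: characters_def)
  have "(\<lambda>x\<in>carrier G. \<phi> x * \<psi> x) = (\<lambda>x\<in>carrier G. mat_trace (kronecker (\<rho> x) (\<sigma> x)))"
    using r unfolding representation_iff[OF G]
    by (intro restrict_ext) (simp add: kronecker_trace[of _ d _ e])
  then show ?thesis
    using charactersI[OF kronecker_representation[OF G r(1,4)]] r(2,5) by simp
qed

text \<open>The matrices are indexed by the whole group instead of coset representatives, with
  entries taken from \<open>f\<close> extended by zero and divided by the order of \<open>H\<close>.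
  The result is multiplicative but not unital, and \<open>nonunital_trace\<close> cuts it down to
  the induced representation.\<close>

lemma induced_character_character:
  fixes G (structure)
  assumes G: "group G" and fin: "finite (carrier G)" and H: "subgroup H G"
    and f1: "f \<one> = 1" and fm: "\<And>x y. x \<in> H \<Longrightarrow> y \<in> H \<Longrightarrow> f (x \<otimes> y) = f x * f y"
  shows "induced_character G H f \<in> characters G"
proof -
  interpret group G by fact
  interpret H: subgroup H G by fact
  have finH: "finite H" using fin H.subset finite_subset by blast
  have cardH: "card H \<noteq> 0" using finH H.one_closed card_gt_0_iff by blast
  obtain xs where xs: "set xs = carrier G" "distinct xs" using finite_distinct_list[OF fin] by blast
  define N where "N = length xs"
  define F where "F x = (if x \<in> H then f x else 0)" for x
  define L where "L g = mat N N (\<lambda>(i, j). F (inv (xs ! i) \<otimes> g \<otimes> xs ! j) / of_nat (card H))" for g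
  have bij: "bij_betw ((!) xs) {..<N} (carrier G)"
    using bij_betw_nth[OF xs(2) refl refl] unfolding N_def xs(1) .
  have xc: "xs ! i \<in> carrier G" if "i < N" for i using nth_mem[of i xs] that unfolding N_def xs(1) .
  \<comment> \<open>\<open>F\<close> convolved with itself is \<open>F\<close> times the order of
    \<open>H\<close>. After translation by \<open>inv a\<close> only \<open>y\<close> in
    \<open>H\<close> contribute; as \<open>y\<close> and
    \<open>inv y \<otimes> (a \<otimes> b)\<close> multiply to \<open>a \<otimes> b\<close>, each
    term equals \<open>F (a \<otimes> b)\<close>, also when this is zero.\<close>
  have key: "(\<Sum>y\<in>carrier G. F (a \<otimes> y) * F (inv y \<otimes> b)) = of_nat (card H) * F (a \<otimes> b)"
    if a: "a \<in> carrier G" and b: "b \<in> carrier G" for a b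
  proof -
    have "(\<Sum>y\<in>carrier G. F (a \<otimes> y) * F (inv y \<otimes> b)) = (\<Sum>y\<in>carrier G. F (a \<otimes> (inv a \<otimes> y)) * F (inv (inv a \<otimes> y) \<otimes> b))"
      by (rule carrier_sum_translate[OF G inv_closed[OF a], symmetric])
    also have "\<dots> = (\<Sum>y\<in>carrier G. F y * F (inv y \<otimes> (a \<otimes> b)))"
    proof (intro sum.cong refl)
      fix y assume y: "y \<in> carrier G"
      have "a \<otimes> (inv a \<otimes> y) = y" using a y by (simp add: m_assoc[symmetric])
      moreover have "inv (inv a \<otimes> y) \<otimes> b = inv y \<otimes> (a \<otimes> b)"
        using a b y by (simp add: inv_mult_group m_assoc)
      ultimately show "F (a \<otimes> (inv a \<otimes> y)) * F (inv (inv a \<otimes> y) \<otimes> b) = F y * F (inv y \<otimes> (a \<otimes> b))"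
        by simp
    qed
    also have "\<dots> = (\<Sum>y\<in>H. F y * F (inv y \<otimes> (a \<otimes> b)))"
      using H.subset by (intro sum.mono_neutral_right fin) (auto simp: F_def)
    also have "\<dots> = (\<Sum>y\<in>H. F (a \<otimes> b))"
    proof (intro sum.cong refl)
      fix y assume y: "y \<in> H"
      then have yc: "y \<in> carrier G" using H.subset by auto
      have e: "y \<otimes> (inv y \<otimes> (a \<otimes> b)) = a \<otimes> b"
        using yc a b by (simp add: m_assoc[symmetric])
      show "F y * F (inv y \<otimes> (a \<otimes> b)) = F (a \<otimes> b)"
      proof (cases "a \<otimes> b \<in> H")
        case True
        then have "inv y \<otimes> (a \<otimes> b) \<in> H" using y by simp
        then have "f (a \<otimes> b) = f y * f (inv y \<otimes> (a \<otimes> b))"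
          using fm[OF y, of "inv y \<otimes> (a \<otimes> b)"] unfolding e by blast
        then show ?thesis using \<open>inv y \<otimes> (a \<otimes> b) \<in> H\<close> y True unfolding F_def by presburger
      next
        case False
        then have "inv y \<otimes> (a \<otimes> b) \<notin> H" using H.m_closed[OF y, of "inv y \<otimes> (a \<otimes> b)"] e by auto
        then show ?thesis using False by (simp add: F_def)
      qed
    qed
    finally show ?thesis by simp
  qed
  have Lc: "L g \<in> carrier_mat N N" for g by (simp add: L_def)
  have Lm: "L (g \<otimes> h) = L g * L h" if g: "g \<in> carrier G" and h: "h \<in> carrier G" for g h
  proof (rule eq_matI)
    fix i j assume "i < dim_row (L g * L h)" "j < dim_col (L g * L h)"
    then have i: "i < N" and j: "j < N" by (auto simp: L_def)
    let ?a = "inv (xs ! i) \<otimes> g" and ?b = "h \<otimes> xs ! j"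
    have ab: "?a \<in> carrier G" "?b \<in> carrier G" using xc i j g h by auto
    have "(L g * L h) $$ (i, j) = (\<Sum>k<N. F (?a \<otimes> xs ! k) / of_nat (card H) * (F (inv (xs ! k) \<otimes> h \<otimes> xs ! j) / of_nat (card H)))"
      using i j by (simp add: L_def scalar_prod_def atLeast0LessThan)
    also have "\<dots> = (\<Sum>k<N. F (?a \<otimes> xs ! k) * F (inv (xs ! k) \<otimes> ?b)) / of_nat (card H) / of_nat (card H)"
      unfolding sum_divide_distrib using m_assoc[OF inv_closed[OF xc] h xc[OF j]]
      by (intro sum.cong refl) simp
    also have "(\<Sum>k<N. F (?a \<otimes> xs ! k) * F (inv (xs ! k) \<otimes> ?b)) = (\<Sum>y\<in>carrier G. F (?a \<otimes> y) * F (inv y \<otimes> ?b))"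
      by (rule sum.reindex_bij_betw[OF bij])
    also have "\<dots> = of_nat (card H) * F (?a \<otimes> ?b)" by (rule key[OF ab])
    also have "?a \<otimes> ?b = inv (xs ! i) \<otimes> (g \<otimes> h) \<otimes> xs ! j" using xc i j g h by (simp add: m_assoc)
    finally have "(L g * L h) $$ (i, j) = F (inv (xs ! i) \<otimes> (g \<otimes> h) \<otimes> xs ! j) / of_nat (card H)"
      using cardH by simp
    then show "L (g \<otimes> h) $$ (i, j) = (L g * L h) $$ (i, j)" using i j by (simp only: L_def index_mat) simp
  qed (auto simp: L_def)
  have tr: "mat_trace (L x) = induced_character G H f x" if x: "x \<in> carrier G" for x
  proof -
    have "mat_trace (L x) = (\<Sum>i<N. F (inv (xs ! i) \<otimes> x \<otimes> xs ! i)) / of_nat (card H)"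
      by (simp add: mat_trace_def L_def sum_divide_distrib)
    also have "(\<Sum>i<N. F (inv (xs ! i) \<otimes> x \<otimes> xs ! i)) = (\<Sum>g\<in>carrier G. F (inv g \<otimes> x \<otimes> g))"
      by (rule sum.reindex_bij_betw[OF bij])
    also have "\<dots> = (\<Sum>g\<in>{g\<in>carrier G. inv g \<otimes> x \<otimes> g \<in> H}. f (inv g \<otimes> x \<otimes> g))"
      by (simp add: F_def sum.inter_filter[OF fin])
    finally show ?thesis using x unfolding induced_character_def by auto
  qed
  have "(\<lambda>x\<in>carrier G. mat_trace (L x)) \<in> characters G \<or> (\<forall>x\<in>carrier G. mat_trace (L x) = 0)"
    by (rule nonunital_trace[OF G Lc Lm])
  \<comment> \<open>The value at the identity is the index of \<open>H\<close>, which rules out that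
    all traces vanish.\<close>
  moreover have "mat_trace (L \<one>) \<noteq> 0"
  proof -
    have "inv g \<otimes> \<one> \<otimes> g = \<one>" if "g \<in> carrier G" for g using that by simp
    then have "induced_character G H f \<one> = (\<Sum>g\<in>{g \<in> carrier G. True}. 1) / of_nat (card H)"
      unfolding induced_character_def using H.one_closed f1
      by (simp only: restrict_apply one_closed if_True cong: conj_cong) simp
    then have "induced_character G H f \<one> = of_nat (card (carrier G)) / of_nat (card H)" by simp
    moreover have "card (carrier G) \<noteq> 0" using fin one_closed by auto
    ultimately show ?thesis using tr[of \<one>] cardH by simp
  qed
  ultimately have "(\<lambda>x\<in>carrier G. mat_trace (L x)) \<in> characters G" by auto
  also have "(\<lambda>x\<in>carrier G. mat_trace (L x)) = induced_character G H f"
  proof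
    fix x show "(\<lambda>x\<in>carrier G. mat_trace (L x)) x = induced_character G H f x"
      by (cases "x \<in> carrier G") (simp_all add: tr, simp add: induced_character_def)
  qed
  finally show ?thesis .
qed



section \<open>Group averages and the inner product of characters\<close>

definition msum :: "nat \<Rightarrow> nat \<Rightarrow> 'g set \<Rightarrow> ('g \<Rightarrow> 'a::comm_monoid_add mat) \<Rightarrow> 'a mat" where
  "msum n k S f = mat n k (\<lambda>ij. \<Sum>g\<in>S. f g $$ ij)"

lemma msum_carrier [simp]: "msum n k S f \<in> carrier_mat n k"
  by (simp add: msum_def)

lemma msum_index [simp]: "i < n \<Longrightarrow> j < k \<Longrightarrow> msum n k S f $$ (i, j) = (\<Sum>g\<in>S. f g $$ (i, j))"
  by (simp add: msum_def)

lemma msum_cong: "(\<And>g. g \<in> S \<Longrightarrow> f g = f' g) \<Longrightarrow> msum n k S f = msum n k S f'"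
  by (simp add: msum_def)

lemma mult_msum:
  fixes A :: "'a::comm_semiring_0 mat"
  assumes A: "A \<in> carrier_mat l n" and f: "\<And>g. g \<in> S \<Longrightarrow> f g \<in> carrier_mat n k"
  shows "A * msum n k S f = msum l k S (\<lambda>g. A * f g)"
proof (rule eq_matI)
  fix i j assume "i < dim_row (msum l k S (\<lambda>g. A * f g))" "j < dim_col (msum l k S (\<lambda>g. A * f g))"
  then have i: "i < l" and j: "j < k" by (auto simp: msum_def)
  have "(A * msum n k S f) $$ (i, j) = (\<Sum>x<n. A $$ (i, x) * (\<Sum>g\<in>S. f g $$ (x, j)))"
    using i j A by (simp add: scalar_prod_def atLeast0LessThan msum_def)
  also have "\<dots> = (\<Sum>g\<in>S. \<Sum>x<n. A $$ (i, x) * f g $$ (x, j))"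
    unfolding sum_distrib_left by (rule sum.swap)
  also have "\<dots> = (\<Sum>g\<in>S. (A * f g) $$ (i, j))"
    using i j A f by (intro sum.cong refl) (auto simp: scalar_prod_def atLeast0LessThan dest!: f)
  finally show "(A * msum n k S f) $$ (i, j) = msum l k S (\<lambda>g. A * f g) $$ (i, j)"
    using i j by simp
qed (use A in \<open>auto simp: msum_def\<close>)

lemma msum_mult:
  fixes A :: "'a::comm_semiring_0 mat"
  assumes A: "A \<in> carrier_mat k l" and f: "\<And>g. g \<in> S \<Longrightarrow> f g \<in> carrier_mat n k"
  shows "msum n k S f * A = msum n l S (\<lambda>g. f g * A)"
proof (rule eq_matI)
  fix i j assume "i < dim_row (msum n l S (\<lambda>g. f g * A))" "j < dim_col (msum n l S (\<lambda>g. f g * A))"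
  then have i: "i < n" and j: "j < l" by (auto simp: msum_def)
  have "(msum n k S f * A) $$ (i, j) = (\<Sum>x<k. (\<Sum>g\<in>S. f g $$ (i, x)) * A $$ (x, j))"
    using i j A by (simp add: scalar_prod_def atLeast0LessThan msum_def)
  also have "\<dots> = (\<Sum>g\<in>S. \<Sum>x<k. f g $$ (i, x) * A $$ (x, j))"
    unfolding sum_distrib_right by (rule sum.swap)
  also have "\<dots> = (\<Sum>g\<in>S. (f g * A) $$ (i, j))"
    using i j A f by (intro sum.cong refl) (auto simp: scalar_prod_def atLeast0LessThan dest!: f)
  finally show "(msum n k S f * A) $$ (i, j) = msum n l S (\<lambda>g. f g * A) $$ (i, j)"
    using i j by simp
qed (use A in \<open>auto simp: msum_def\<close>)

lemma msum_trace:
  "mat_trace (msum n n S f) = (\<Sum>g\<in>S. \<Sum>i<n. f g $$ (i, i))"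
  by (simp add: mat_trace_def msum_def sum.swap[of _ S])

text \<open>The mean of a representation is idempotent, so its trace is its rank.\<close>

lemma representation_sum:
  fixes G (structure)
  assumes G: "group G" and fin: "finite (carrier G)" and r: "representation G d \<rho>"
  obtains k :: nat where "(\<Sum>g\<in>carrier G. mat_trace (\<rho> g)) = of_nat (card (carrier G)) * of_nat k"
    and "k = 0 \<longrightarrow> (\<forall>i<d. \<forall>j<d. (\<Sum>g\<in>carrier G. \<rho> g $$ (i, j)) = 0)"
proof -
  interpret group G by fact
  have c: "\<rho> g \<in> carrier_mat d d" if "g \<in> carrier G" for g
    using r that by (simp add: representation_iff[OF G])
  have m: "\<rho> g * \<rho> h = \<rho> (g \<otimes> h)" if "g \<in> carrier G" "h \<in> carrier G" for g h
    using r that by (simp add: representation_iff[OF G])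
  define n where "n = (of_nat (card (carrier G)) :: complex)"
  have n: "n \<noteq> 0" using fin one_closed unfolding n_def by auto
  define M where "M = msum d d (carrier G) \<rho>"
  have Mc: "M \<in> carrier_mat d d" by (simp add: M_def)
  have "\<rho> g * M = M" if g: "g \<in> carrier G" for g
  proof -
    have "\<rho> g * M = msum d d (carrier G) (\<lambda>h. \<rho> (g \<otimes> h))"
      unfolding M_def using g by (simp add: mult_msum[OF c c] m cong: msum_cong)
    also have "\<dots> = M" unfolding M_def msum_def
      by (intro cong_mat refl) (auto intro: carrier_sum_translate[OF G g])
    finally show ?thesis .
  qed
  then have "M * M = msum d d (carrier G) (\<lambda>g. M)"
    using msum_mult[OF Mc c, of "carrier G" "\<lambda>g. g"] by (simp add: M_def[symmetric] cong: msum_cong)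
  also have "\<dots> = n \<cdot>\<^sub>m M"
    using Mc by (intro eq_matI) (auto simp: msum_def n_def)
  finally have MM: "M * M = n \<cdot>\<^sub>m M" .
  define E where "E = inverse n \<cdot>\<^sub>m M"
  have E: "E \<in> carrier_mat d d" using Mc by (simp add: E_def)
  have "E * E = inverse n \<cdot>\<^sub>m (inverse n \<cdot>\<^sub>m (n \<cdot>\<^sub>m M))"
    unfolding E_def MM[symmetric]
    using mult_smult_assoc_mat[OF Mc smult_carrier_mat[OF Mc], of "inverse n" "inverse n"]
      mult_smult_distrib[OF Mc Mc, of "inverse n"] by simp
  also have "\<dots> = E" unfolding E_def using n Mc by (intro eq_matI) auto
  finally have EE: "E * E = E" .
  obtain k A B where AB: "A \<in> carrier_mat d k" "B \<in> carrier_mat k d" "E = A * B" "B * A = 1\<^sub>m k"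
    using idempotent_factorization[OF E EE] by metis
  have ME: "M = n \<cdot>\<^sub>m E" using n Mc by (auto simp: E_def)
  have "(\<Sum>g\<in>carrier G. mat_trace (\<rho> g)) = mat_trace M"
    unfolding M_def msum_trace using c by (intro sum.cong refl) (auto simp: mat_trace_def dest!: c)
  also have "\<dots> = n * mat_trace E"
    using E by (simp add: ME mat_trace_def sum_distrib_left)
  also have "mat_trace E = of_nat k"
    unfolding AB(3) mat_trace_comm[OF AB(1,2)] AB(4) by (rule mat_trace_one)
  finally have "(\<Sum>g\<in>carrier G. mat_trace (\<rho> g)) = of_nat (card (carrier G)) * of_nat k"
    unfolding n_def .
  \<comment> \<open>For \<open>k = 0\<close> the product \<open>A * B\<close> has inner dimension
    zero, so the averaged matrix itself is zero and not only its trace. Positivity of the norm of a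
    character rests on this.\<close>
  moreover have "(\<Sum>g\<in>carrier G. \<rho> g $$ (i, j)) = 0" if "k = 0" "i < d" "j < d" for i j
  proof -
    have "M $$ (i, j) = 0" using that AB unfolding ME by (simp add: scalar_prod_def)
    then show ?thesis using that by (simp add: M_def)
  qed
  ultimately show ?thesis using that by blast
qed

text \<open>The usual inner product without division by the group order; for characters of a finite
  group \<open>\<psi> (inv g)\<close> is the complex conjugate of \<open>\<psi> g\<close>.\<close>

definition char_form :: "('g, 'b) monoid_scheme \<Rightarrow> ('g \<Rightarrow> complex) \<Rightarrow> ('g \<Rightarrow> complex) \<Rightarrow> complex" where
  "char_form G \<phi> \<psi> = (\<Sum>g\<in>carrier G. \<phi> g * \<psi> (inv\<^bsub>G\<^esub> g))"

text \<open>\<open>k\<close> is the dimension of the space of vectors fixed by \<open>\<rho>\<close>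
  tensored with the dual of \<open>\<sigma>\<close>. For equal characters the identity map is such a
  vector, so \<open>k\<close> is not zero.\<close>

lemma char_form_characters:
  fixes G (structure)
  assumes G: "group G" and fin: "finite (carrier G)" and "\<phi> \<in> characters G" "\<psi> \<in> characters G"
  obtains k :: nat where "char_form G \<phi> \<psi> = of_nat (card (carrier G)) * of_nat k"
    and "\<phi> = \<psi> \<longrightarrow> k \<noteq> 0"
proof -
  interpret group G by fact
  \<comment> \<open>Equal characters could be afforded by different representations; one and the
    same is chosen for both, so that the case \<open>\<phi> = \<psi>\<close> can be computed with
    \<open>\<rho>\<close> alone.\<close>
  obtain d \<rho> e \<sigma> where r: "representation G d \<rho>" "d \<ge> 1" "\<phi> = (\<lambda>x\<in>carrier G. mat_trace (\<rho> x))"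
    and s: "representation G e \<sigma>" "e \<ge> 1" "\<psi> = (\<lambda>x\<in>carrier G. mat_trace (\<sigma> x))"
    and eq: "\<phi> = \<psi> \<Longrightarrow> d = e \<and> \<rho> = \<sigma>"
  proof (cases "\<phi> = \<psi>")
    case True
    then show ?thesis using assms(3) that unfolding characters_def by blast
  next
    case False
    then show ?thesis using assms(3,4) that unfolding characters_def by blast
  qed
  have c: "\<rho> x \<in> carrier_mat d d" "\<sigma> x \<in> carrier_mat e e" if "x \<in> carrier G" for x
    using r s that by (auto simp: representation_iff[OF G])
  note K = kronecker_representation[OF G r(1) dual_representation[OF G s(1)]]
  obtain k :: nat where k: "(\<Sum>g\<in>carrier G. mat_trace (kronecker (\<rho> g) ((\<sigma> (inv g))\<^sup>T))) = of_nat (card (carrier G)) * of_nat k"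
    and z: "k = 0 \<longrightarrow> (\<forall>i<d*e. \<forall>j<d*e. (\<Sum>g\<in>carrier G. kronecker (\<rho> g) ((\<sigma> (inv g))\<^sup>T) $$ (i, j)) = 0)"
    by (rule representation_sum[OF G fin K])
  have tr: "mat_trace (A\<^sup>T) = mat_trace A" if "A \<in> carrier_mat e e" for A :: "complex mat"
    using that by (simp add: mat_trace_def)
  have "char_form G \<phi> \<psi> = (\<Sum>g\<in>carrier G. mat_trace (kronecker (\<rho> g) ((\<sigma> (inv g))\<^sup>T)))"
    unfolding char_form_def
  proof (intro sum.cong refl)
    fix g assume g: "g \<in> carrier G"
    show "\<phi> g * \<psi> (inv g) = mat_trace (kronecker (\<rho> g) ((\<sigma> (inv g))\<^sup>T))"
      using g tr[OF c(2)[OF inv_closed[OF g]]] r(3) s(3) c(2)[OF inv_closed[OF g]]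
      by (simp add: kronecker_trace[OF c(1)[OF g], of _ e])
  qed
  then have "char_form G \<phi> \<psi> = of_nat (card (carrier G)) * of_nat k" using k by simp
  moreover have "k \<noteq> 0" if "\<phi> = \<psi>"
  proof
    assume "k = 0"
    from eq[OF that] have de: "d = e" "\<rho> = \<sigma>" by auto
    \<comment> \<open>These are the entries of the averaged tensor product in row
      \<open>(0, 0)\<close> and column \<open>(i, i)\<close>. Summed over \<open>i\<close> they give
      the \<open>(0, 0)\<close> entry of \<open>\<rho> g * \<rho> (inv g)\<close>, which is
      \<open>1\<close>, so their total is the group order.\<close>
    have "(\<Sum>g\<in>carrier G. \<rho> g $$ (0, i) * \<rho> (inv g) $$ (i, 0)) = 0" if i: "i < d" for i
    proof -
      have "0 * e + 0 < d * e" "i * e + i < d * e"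
      proof -
        have "i * e + i < Suc i * e" using i de by simp
        also have "\<dots> \<le> d * e" using i by (intro mult_right_mono) auto
        finally show "i * e + i < d * e" .
      qed (use r(2) s(2) in simp)
      then have "(\<Sum>g\<in>carrier G. kronecker (\<rho> g) ((\<sigma> (inv g))\<^sup>T) $$ (0 * e + 0, i * e + i)) = 0"
        using z \<open>k = 0\<close> by blast
      also have "(\<Sum>g\<in>carrier G. kronecker (\<rho> g) ((\<sigma> (inv g))\<^sup>T) $$ (0 * e + 0, i * e + i)) =
          (\<Sum>g\<in>carrier G. \<rho> g $$ (0, i) * \<rho> (inv g) $$ (i, 0))"
      proof (intro sum.cong refl)
        fix g assume g: "g \<in> carrier G"
        have i': "i < e" "0 < d" "0 < e" using i de r(2) by auto
        have "kronecker (\<rho> g) ((\<sigma> (inv g))\<^sup>T) $$ (0 * e + 0, i * e + i) = \<rho> g $$ (0, i) * (\<sigma> (inv g))\<^sup>T $$ (0, i)"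
          by (rule kronecker_index[OF c(1)[OF g]]) (use i i' c(2)[OF inv_closed[OF g]] in auto)
        then show "kronecker (\<rho> g) ((\<sigma> (inv g))\<^sup>T) $$ (0 * e + 0, i * e + i) = \<rho> g $$ (0, i) * \<rho> (inv g) $$ (i, 0)"
          using c(2)[OF inv_closed[OF g]] i' de by simp
      qed
      finally show ?thesis .
    qed
    then have "0 = (\<Sum>i<d. \<Sum>g\<in>carrier G. \<rho> g $$ (0, i) * \<rho> (inv g) $$ (i, 0))" by simp
    also have "\<dots> = (\<Sum>g\<in>carrier G. \<Sum>i<d. \<rho> g $$ (0, i) * \<rho> (inv g) $$ (i, 0))" by (rule sum.swap)
    also have "\<dots> = (\<Sum>g\<in>carrier G. 1)"
    proof (intro sum.cong refl)
      fix g assume g: "g \<in> carrier G"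
      have cc: "\<rho> g \<in> carrier_mat d d" "\<rho> (inv g) \<in> carrier_mat d d" using c(1) g by auto
      have "\<rho> g * \<rho> (inv g) = 1\<^sub>m d" using r(1) g unfolding representation_iff[OF G] by (metis inv_closed r_inv)
      then have "(\<rho> g * \<rho> (inv g)) $$ (0, 0) = 1" using r(2) by simp
      then show "(\<Sum>i<d. \<rho> g $$ (0, i) * \<rho> (inv g) $$ (i, 0)) = 1"
        using cc r(2) by (simp add: scalar_prod_def atLeast0LessThan)
    qed
    finally have "card (carrier G) = 0" by simp
    then show False using fin one_closed by auto
  qed
  ultimately show ?thesis using that by blast
qed

text \<open>Both characters contain \<open>\<chi>\<close>, so their inner product is at least that of \<open>\<chi>\<close> with itself.\<close>

lemma char_form_common_constituent:
  fixes G (structure)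
  assumes G: "group G" and fin: "finite (carrier G)"
    and "constituent G \<chi> \<phi>" "constituent G \<chi> \<psi>"
  shows "char_form G \<phi> \<psi> \<noteq> 0"
proof -
  interpret group G by fact
  have \<chi>: "\<chi> \<in> characters G" using assms(3) by (simp add: constituent_def)
  have ex: "\<exists>\<eta>. (\<eta> \<in> characters G \<or> (\<forall>x. \<eta> x = 0)) \<and> (\<forall>x\<in>carrier G. \<phi> x = \<chi> x + \<eta> x)"
    if "constituent G \<chi> \<phi>" for \<phi>
  proof (cases "\<phi> = \<chi>")
    case True
    then show ?thesis by (intro exI[of _ "\<lambda>x. 0"]) auto
  next
    case False
    then show ?thesis using that
      by (intro exI[of _ "\<lambda>x\<in>carrier G. \<phi> x - \<chi> x"]) (auto simp: constituent_def)
  qed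
  obtain \<eta> where e: "\<eta> \<in> characters G \<or> (\<forall>x. \<eta> x = 0)" "\<forall>x\<in>carrier G. \<phi> x = \<chi> x + \<eta> x"
    using ex[OF assms(3)] by blast
  obtain \<zeta> where z: "\<zeta> \<in> characters G \<or> (\<forall>x. \<zeta> x = 0)" "\<forall>x\<in>carrier G. \<psi> x = \<chi> x + \<zeta> x"
    using ex[OF assms(4)] by blast
  have nat: "\<exists>k :: nat. char_form G a b = of_nat (card (carrier G)) * of_nat k"
    if "a \<in> characters G \<or> (\<forall>x. a x = 0)" "b \<in> characters G \<or> (\<forall>x. b x = 0)" for a b
  proof (cases "a \<in> characters G \<and> b \<in> characters G")
    case True
    then obtain k :: nat where "char_form G a b = of_nat (card (carrier G)) * of_nat k"
      using char_form_characters[OF G fin, of a b] by blast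
    then show ?thesis by blast
  next
    case False
    then have "char_form G a b = 0" using that by (auto simp: char_form_def)
    then show ?thesis by (intro exI[of _ 0]) simp
  qed
  obtain k :: nat where k: "char_form G \<chi> \<chi> = of_nat (card (carrier G)) * of_nat k" "k \<noteq> 0"
    using char_form_characters[OF G fin \<chi> \<chi>] by blast
  obtain k1 :: nat where k1: "char_form G \<chi> \<zeta> = of_nat (card (carrier G)) * of_nat k1"
    using nat[OF disjI1[OF \<chi>] z(1)] by blast
  obtain k2 :: nat where k2: "char_form G \<eta> \<chi> = of_nat (card (carrier G)) * of_nat k2"
    using nat[OF e(1) disjI1[OF \<chi>]] by blast
  obtain k3 :: nat where k3: "char_form G \<eta> \<zeta> = of_nat (card (carrier G)) * of_nat k3"
    using nat[OF e(1) z(1)] by blast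
  have "char_form G \<phi> \<psi> = char_form G \<chi> \<chi> + char_form G \<chi> \<zeta> + char_form G \<eta> \<chi> + char_form G \<eta> \<zeta>"
    unfolding char_form_def sum.distrib[symmetric]
    using e(2) z(2) by (intro sum.cong refl) (simp add: algebra_simps)
  also have "\<dots> = of_nat (card (carrier G) * (k + k1 + k2 + k3))"
    unfolding k(1) k1 k2 k3 by (simp add: algebra_simps)
  also have "\<dots> \<noteq> 0" unfolding of_nat_eq_0_iff using k(2) fin one_closed by auto
  finally show ?thesis .
qed

section \<open>Intertwiners and constituents\<close>

lemma average_intertwines:
  fixes G (structure)
  assumes G: "group G" and r: "representation G d \<rho>" and s: "representation G e \<sigma>"
    and E: "E \<in> carrier_mat e d" and h: "h \<in> carrier G"
  shows "\<sigma> h * msum e d (carrier G) (\<lambda>g. \<sigma> g * E * \<rho> (inv g)) =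
    msum e d (carrier G) (\<lambda>g. \<sigma> g * E * \<rho> (inv g)) * \<rho> h"
proof -
  interpret group G by fact
  have cr: "\<rho> x \<in> carrier_mat d d" and cs: "\<sigma> x \<in> carrier_mat e e" if "x \<in> carrier G" for x
    using r s that by (auto simp: representation_iff[OF G])
  define F where "F g = \<sigma> g * E * \<rho> (inv g)" for g
  have F: "F g \<in> carrier_mat e d" if "g \<in> carrier G" for g
    unfolding F_def using cr[OF inv_closed[OF that]] cs[OF that] E by (meson mult_carrier_mat)
  \<comment> \<open>Applying \<open>\<sigma> h\<close> only moves the summation index from
    \<open>g\<close> to \<open>h \<otimes> g\<close>, at the price of a factor
    \<open>\<rho> h\<close> that is the same for all \<open>g\<close>.\<close>
  have shift: "\<sigma> h * F g = F (h \<otimes> g) * \<rho> h" if g: "g \<in> carrier G" for g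
  proof -
    note c = cs[OF h] cs[OF g] cr[OF h] cr[OF inv_closed[OF g]] cr[OF inv_closed[OF m_closed[OF h g]]]
    have "\<sigma> h * F g = \<sigma> h * (\<sigma> g * E) * \<rho> (inv g)"
      unfolding F_def using assoc_mult_mat[OF c(1) mult_carrier_mat[OF c(2) E] c(4)] by simp
    also have "\<sigma> h * (\<sigma> g * E) = \<sigma> (h \<otimes> g) * E"
      using assoc_mult_mat[OF c(1,2) E] s h g by (simp add: representation_iff[OF G])
    also have "\<rho> (inv g) = \<rho> (inv (h \<otimes> g)) * \<rho> h"
    proof -
      have "inv (h \<otimes> g) \<otimes> h = inv g" using g h by (simp add: inv_mult_group m_assoc)
      then show ?thesis using r g h unfolding representation_iff[OF G] by (metis inv_closed m_closed)
    qed
    also have "\<sigma> (h \<otimes> g) * E * (\<rho> (inv (h \<otimes> g)) * \<rho> h) = F (h \<otimes> g) * \<rho> h"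
      unfolding F_def using assoc_mult_mat[OF mult_carrier_mat[OF cs[OF m_closed[OF h g]] E] c(5,3)] by simp
    finally show ?thesis .
  qed
  have "\<sigma> h * msum e d (carrier G) F = msum e d (carrier G) (\<lambda>g. F (h \<otimes> g) * \<rho> h)"
    using shift by (simp add: mult_msum[OF cs[OF h] F] cong: msum_cong)
  also have "\<dots> = msum e d (carrier G) (\<lambda>g. F (h \<otimes> g)) * \<rho> h"
    using msum_mult[OF cr[OF h], of "carrier G" "\<lambda>g. F (h \<otimes> g)" e] F h by simp
  also have "msum e d (carrier G) (\<lambda>g. F (h \<otimes> g)) = msum e d (carrier G) F"
    unfolding msum_def by (intro cong_mat refl) (auto intro: carrier_sum_translate[OF G h])
  finally show ?thesis unfolding F_def .
qed

text \<open>One half of Schur's lemma: the kernel of an intertwiner is invariant, and it is not the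
  whole space since \<open>T\<close> is nonzero.\<close>

lemma kernel_trivial:
  fixes G (structure)
  assumes G: "group G" and irr: "irreducible_representation G d \<rho>" and s: "representation G e \<sigma>"
    and T: "T \<in> carrier_mat e d" and T0: "T \<noteq> 0\<^sub>m e d"
    and comm: "\<And>h. h \<in> carrier G \<Longrightarrow> \<sigma> h * T = T * \<rho> h"
    and v: "v \<in> carrier_vec d" "T *\<^sub>v v = 0\<^sub>v e"
  shows "v = 0\<^sub>v d"
proof -
  interpret group G by fact
  interpret V: vec_space "TYPE(complex)" d .
  have r: "representation G d \<rho>" using irr by (simp add: irreducible_representation_def)
  have cr: "\<rho> x \<in> carrier_mat d d" and cs: "\<sigma> x \<in> carrier_mat e e" if "x \<in> carrier G" for x
    using r s that by (auto simp: representation_iff[OF G])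
  define W where "W = {v \<in> carrier_vec d. T *\<^sub>v v = 0\<^sub>v e}"
  have "submodule class_ring W (module_vec TYPE(complex) d)"
    by (unfold_locales)
      (use T in \<open>auto simp: W_def module_vec_simps mult_add_distrib_mat_vec[OF T] mult_mat_vec[OF T] class_ring_simps\<close>)
  then have "VectorSpace.subspace class_ring W (module_vec TYPE(complex) d)"
    using V.vectorspace_axioms by (simp add: VectorSpace.subspace_def)
  moreover have inv: "\<rho> x *\<^sub>v w \<in> W" if x: "x \<in> carrier G" and w: "w \<in> W" for x w
  proof -
    have wc: "w \<in> carrier_vec d" using w by (simp add: W_def)
    have "T *\<^sub>v (\<rho> x *\<^sub>v w) = (\<sigma> x * T) *\<^sub>v w"
      using assoc_mult_mat_vec[OF T cr[OF x] wc] comm[OF x] by simp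
    also have "\<dots> = \<sigma> x *\<^sub>v (T *\<^sub>v w)" by (rule assoc_mult_mat_vec[OF cs[OF x] T wc])
    also have "T *\<^sub>v w = 0\<^sub>v e" using w unfolding W_def by simp
    also have "\<sigma> x *\<^sub>v 0\<^sub>v e = 0\<^sub>v e"
      using cs[OF x] by (intro eq_vecI) (simp_all add: scalar_prod_def)
    finally show ?thesis using mult_mat_vec_carrier[OF cr[OF x] wc] unfolding W_def by simp
  qed
  ultimately have "W = {0\<^sub>v d} \<or> W = carrier_vec d"
    using irr unfolding irreducible_representation_def by blast
  moreover have "W \<noteq> carrier_vec d"
  proof
    assume W: "W = carrier_vec d"
    have "T = 0\<^sub>m e d"
    proof (rule eq_matI)
      fix i j assume "i < dim_row (0\<^sub>m e d :: complex mat)" "j < dim_col (0\<^sub>m e d :: complex mat)"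
      then have i: "i < e" and j: "j < d" by auto
      have "unit_vec d j \<in> W" unfolding W by simp
      then have "T *\<^sub>v unit_vec d j = 0\<^sub>v e" unfolding W_def by simp
      then have "(T *\<^sub>v unit_vec d j) $ i = 0" using i by simp
      then show "T $$ (i, j) = 0\<^sub>m e d $$ (i, j)" using T i j by simp
    qed (use T in auto)
    then show False using T0 by contradiction
  qed
  ultimately show ?thesis using v unfolding W_def by blast
qed

text \<open>A rank factorization \<open>T = A * B\<close> gives \<open>T * (B' * B) = T\<close>, so
  injectivity forces \<open>B' * B\<close> to be the identity, and \<open>B' * A'\<close> is a left
  inverse.\<close>

lemma left_inverse:
  fixes T :: "'a::field mat"
  assumes T: "T \<in> carrier_mat e d" and inj: "\<And>v. v \<in> carrier_vec d \<Longrightarrow> T *\<^sub>v v = 0\<^sub>v e \<Longrightarrow> v = 0\<^sub>v d"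
  obtains L where "L \<in> carrier_mat d e" "L * T = 1\<^sub>m d"
proof -
  obtain k A B A' B' where c: "A \<in> carrier_mat e k" "B \<in> carrier_mat k d"
    "A' \<in> carrier_mat k e" "B' \<in> carrier_mat d k"
    and f: "T = A * B" "A' * A = 1\<^sub>m k" "B * B' = 1\<^sub>m k"
    using rank_factorization[OF T] by metis
  have "B * (B' * B) = B" using assoc_mult_mat[OF c(2,4,2)] f(3) c(2) by simp
  then have e: "T * (B' * B) = T"
    unfolding f(1) using assoc_mult_mat[OF c(1,2) mult_carrier_mat[OF c(4,2)]] by simp
  have BB: "B' * B = 1\<^sub>m d"
  proof (rule eq_matI)
    fix i j assume "i < dim_row (1\<^sub>m d :: 'a mat)" "j < dim_col (1\<^sub>m d :: 'a mat)"
    then have i: "i < d" and j: "j < d" by auto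
    have m: "B' * B \<in> carrier_mat d d" using c by auto
    have cc: "col (B' * B) j \<in> carrier_vec d" "unit_vec d j \<in> carrier_vec d" using col_carrier_vec[OF j m] by auto
    have "T *\<^sub>v (col (B' * B) j - unit_vec d j) = T *\<^sub>v col (B' * B) j - T *\<^sub>v unit_vec d j"
      by (rule mult_minus_distrib_mat_vec[OF T cc])
    also have "T *\<^sub>v col (B' * B) j = col T j"
      using col_mult2[OF T m j] e by simp
    also have "T *\<^sub>v unit_vec d j = col T j" using T j by (intro eq_vecI) auto
    also have "col T j - col T j = 0\<^sub>v e" using T by (intro eq_vecI) auto
    finally have "T *\<^sub>v (col (B' * B) j - unit_vec d j) = 0\<^sub>v e" .
    moreover have "col (B' * B) j - unit_vec d j \<in> carrier_vec d" using cc(2) by (rule minus_carrier_vec[OF cc(1)])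
    ultimately have v: "col (B' * B) j - unit_vec d j = 0\<^sub>v d" by (intro inj)
    have "(col (B' * B) j - unit_vec d j) $ i = 0" unfolding v using i by simp
    moreover have "col (B' * B) j $ i = (B' * B) $$ (i, j)" using m i j by (simp only: index_col carrier_matD)
    ultimately show "(B' * B) $$ (i, j) = 1\<^sub>m d $$ (i, j)" using i j by simp
  qed (use c in auto)
  have "B' * A' * T = B' * (A' * A * B)"
    unfolding f(1) using assoc_mult_mat[OF c(4,3) mult_carrier_mat[OF c(1,2)]] assoc_mult_mat[OF c(3,1,2)] by simp
  then have "B' * A' * T = 1\<^sub>m d" using f c BB by simp
  then show ?thesis using that[of "B' * A'"] c by auto
qed

lemma mat_trace_minus:
  fixes A :: "'a::ab_group_add mat"
  assumes "A \<in> carrier_mat n n" "B \<in> carrier_mat n n"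
  shows "mat_trace (A - B) = mat_trace A - mat_trace B"
  using assms by (auto simp: mat_trace_def sum_subtractf[symmetric] intro!: sum.cong)

text \<open>
  A nonzero intertwiner embeds the irreducible representation in \<open>\<sigma>\<close>; averaging a left inverse
  gives an invariant complement, on which \<open>\<sigma>\<close> affords the difference.
\<close>

lemma constituentI:
  fixes G (structure)
  assumes G: "group G" and fin: "finite (carrier G)"
    and "\<chi> \<in> irreducible_characters G" "\<psi> \<in> characters G" and nz: "char_form G \<psi> \<chi> \<noteq> 0"
  shows "constituent G \<chi> \<psi>"
proof -
  interpret group G by fact
  obtain d \<rho> where irr: "irreducible_representation G d \<rho>" and \<chi>: "\<chi> = (\<lambda>x\<in>carrier G. mat_trace (\<rho> x))"
    using assms(3) by (auto simp: irreducible_characters_def)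
  then have r: "representation G d \<rho>" and d: "1 \<le> d" by (auto simp: irreducible_representation_def)
  obtain e \<sigma> where s: "representation G e \<sigma>" and \<psi>: "\<psi> = (\<lambda>x\<in>carrier G. mat_trace (\<sigma> x))"
    using assms(4) by (auto simp: characters_def)
  have cr: "\<rho> x \<in> carrier_mat d d" and cs: "\<sigma> x \<in> carrier_mat e e" if "x \<in> carrier G" for x
    using r s that by (auto simp: representation_iff[OF G])
  have mr: "\<rho> (x \<otimes> y) = \<rho> x * \<rho> y" and ms: "\<sigma> (x \<otimes> y) = \<sigma> x * \<sigma> y"
    if "x \<in> carrier G" "y \<in> carrier G" for x y
    using r s that by (auto simp: representation_iff[OF G])
  have r1: "\<rho> \<one> = 1\<^sub>m d" and s1: "\<sigma> \<one> = 1\<^sub>m e" using r s by (auto simp: representation_iff[OF G])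
  \<comment> \<open>Averages of elementary matrices. The \<open>(a, b)\<close> entry of
    \<open>T0 a b\<close> is the sum of
    \<open>\<sigma> g $$ (a, a) * \<rho> (inv g) $$ (b, b)\<close>, and these entries add up to
    \<open>char_form G \<psi> \<chi>\<close>; hence one of the averages is a nonzero
    intertwiner.\<close>
  define U where "U a b = mat e d (\<lambda>(i, j). if i = a \<and> j = b then 1 else 0 :: complex)" for a b
  define T0 where "T0 a b = msum e d (carrier G) (\<lambda>g. \<sigma> g * U a b * \<rho> (inv g))" for a b
  have Uc: "U a b \<in> carrier_mat e d" for a b by (simp add: U_def)
  have T0: "T0 a b $$ (a, b) = (\<Sum>g\<in>carrier G. \<sigma> g $$ (a, a) * \<rho> (inv g) $$ (b, b))" if a: "a < e" and b: "b < d" for a b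
  proof -
    have "(\<sigma> g * U a b * \<rho> (inv g)) $$ (a, b) = \<sigma> g $$ (a, a) * \<rho> (inv g) $$ (b, b)" if g: "g \<in> carrier G" for g
    proof -
      note c = cs[OF g] cr[OF inv_closed[OF g]]
      have "(\<sigma> g * U a b) $$ (a, j) = (if j = b then \<sigma> g $$ (a, a) else 0)" if j: "j < d" for j
      proof -
        have "(\<sigma> g * U a b) $$ (a, j) = (\<Sum>i<e. \<sigma> g $$ (a, i) * (if i = a \<and> j = b then 1 else 0))"
          using c a j by (simp add: U_def scalar_prod_def atLeast0LessThan)
        also have "\<dots> = (\<Sum>i<e. if i = a then (if j = b then \<sigma> g $$ (a, a) else 0) else 0)"
          by (intro sum.cong refl) auto
        finally show ?thesis using a by simp
      qed
      moreover have idx: "(M * N) $$ (a, b) = (\<Sum>j<d. M $$ (a, j) * N $$ (j, b))"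
        if "M \<in> carrier_mat e d" "N \<in> carrier_mat d d" for M N :: "complex mat"
        using that a b by (simp add: scalar_prod_def atLeast0LessThan)
      ultimately have "(\<sigma> g * U a b * \<rho> (inv g)) $$ (a, b) = (\<Sum>j<d. (if j = b then \<sigma> g $$ (a, a) else 0) * \<rho> (inv g) $$ (j, b))"
        using idx[OF mult_carrier_mat[OF c(1) Uc] c(2)] by simp
      also have "\<dots> = (\<Sum>j<d. if j = b then \<sigma> g $$ (a, a) * \<rho> (inv g) $$ (b, b) else 0)"
        by (intro sum.cong refl) auto
      finally show ?thesis using b by simp
    qed
    then show ?thesis using a b by (simp add: T0_def)
  qed
  have "\<exists>a<e. \<exists>b<d. T0 a b $$ (a, b) \<noteq> 0"
  proof (rule ccontr)
    assume "\<not> ?thesis"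
    then have z: "(\<Sum>a<e. \<Sum>b<d. \<Sum>g\<in>carrier G. \<sigma> g $$ (a, a) * \<rho> (inv g) $$ (b, b)) = 0"
      using T0 by simp
    have "char_form G \<psi> \<chi> = (\<Sum>g\<in>carrier G. \<Sum>a<e. \<Sum>b<d. \<sigma> g $$ (a, a) * \<rho> (inv g) $$ (b, b))"
      unfolding char_form_def
    proof (intro sum.cong refl)
      fix g assume g: "g \<in> carrier G"
      show "\<psi> g * \<chi> (inv g) = (\<Sum>a<e. \<Sum>b<d. \<sigma> g $$ (a, a) * \<rho> (inv g) $$ (b, b))"
        using g cs[OF g] cr[OF inv_closed[OF g]] unfolding \<psi> \<chi> by (simp add: mat_trace_def sum_product)
    qed
    also have "\<dots> = (\<Sum>a<e. \<Sum>g\<in>carrier G. \<Sum>b<d. \<sigma> g $$ (a, a) * \<rho> (inv g) $$ (b, b))" by (rule sum.swap)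
    also have "\<dots> = (\<Sum>a<e. \<Sum>b<d. \<Sum>g\<in>carrier G. \<sigma> g $$ (a, a) * \<rho> (inv g) $$ (b, b))"
      by (intro sum.cong refl sum.swap)
    also note z
    finally show False using nz by contradiction
  qed
  then obtain a b where ab: "a < e" "b < d" "T0 a b $$ (a, b) \<noteq> 0" by blast
  define T where "T = T0 a b"
  have T: "T \<in> carrier_mat e d" by (simp add: T_def T0_def)
  have Tn: "T \<noteq> 0\<^sub>m e d" using ab by (auto simp: T_def)
  have comm: "\<sigma> h * T = T * \<rho> h" if "h \<in> carrier G" for h
    unfolding T_def T0_def by (rule average_intertwines[OF G r s Uc that])
  obtain K where K: "K \<in> carrier_mat d e" "K * T = 1\<^sub>m d"
    using left_inverse[OF T kernel_trivial[OF G irr s T Tn comm]] by blast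
  define n where "n = (of_nat (card (carrier G)) :: complex)"
  have n: "n \<noteq> 0" using fin one_closed unfolding n_def by auto
  define R where "R = msum d e (carrier G) (\<lambda>g. \<rho> g * K * \<sigma> (inv g))"
  have R: "R \<in> carrier_mat d e" by (simp add: R_def)
  have Rcomm: "\<rho> h * R = R * \<sigma> h" if "h \<in> carrier G" for h
    unfolding R_def by (rule average_intertwines[OF G s r K(1) that])
  have RT: "R * T = n \<cdot>\<^sub>m 1\<^sub>m d"
  proof -
    have c: "\<rho> g * K * \<sigma> (inv g) \<in> carrier_mat d e" if "g \<in> carrier G" for g
      using cr[OF that] cs[OF inv_closed[OF that]] K(1) by (meson mult_carrier_mat)
    have "\<rho> g * K * \<sigma> (inv g) * T = 1\<^sub>m d" if g: "g \<in> carrier G" for g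
    proof -
      note cc = cr[OF g] cs[OF inv_closed[OF g]] cr[OF inv_closed[OF g]]
      have "\<rho> g * K * \<sigma> (inv g) * T = \<rho> g * K * (T * \<rho> (inv g))"
        using assoc_mult_mat[OF mult_carrier_mat[OF cc(1) K(1)] cc(2) T] comm[OF inv_closed[OF g]] by simp
      also have "\<dots> = \<rho> g * K * T * \<rho> (inv g)"
        using assoc_mult_mat[OF mult_carrier_mat[OF cc(1) K(1)] T cc(3)] by simp
      also have "\<rho> g * K * T = \<rho> g" using assoc_mult_mat[OF cc(1) K(1) T] K(2) cc by simp
      also have "\<rho> g * \<rho> (inv g) = 1\<^sub>m d" using mr[OF g inv_closed[OF g]] g r1 by simp
      finally show ?thesis .
    qed
    note e = this
    have "R * T = msum d d (carrier G) (\<lambda>g. \<rho> g * K * \<sigma> (inv g) * T)"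
      unfolding R_def by (rule msum_mult[OF T]) (rule c)
    also have "\<dots> = msum d d (carrier G) (\<lambda>g. 1\<^sub>m d)" by (rule msum_cong) (rule e)
    also have "\<dots> = n \<cdot>\<^sub>m 1\<^sub>m d" by (intro eq_matI) (auto simp: msum_def n_def)
    finally show ?thesis .
  qed
  define S where "S = inverse n \<cdot>\<^sub>m R"
  have S: "S \<in> carrier_mat d e" using R by (simp add: S_def)
  have ST: "S * T = 1\<^sub>m d"
    unfolding S_def mult_smult_assoc_mat[OF R T] RT using n by (intro eq_matI) auto
  have Scomm: "\<rho> h * S = S * \<sigma> h" if "h \<in> carrier G" for h
    unfolding S_def using mult_smult_assoc_mat[OF R cs[OF that]] mult_smult_distrib[OF cr[OF that] R] Rcomm[OF that]
    by simp
  \<comment> \<open>The projection onto the kernel of \<open>S\<close> along the image of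
    \<open>T\<close>. It commutes with \<open>\<sigma>\<close>, so \<open>\<sigma> h * Q\<close> is
    multiplicative, and its trace is the difference of the two characters.\<close>
  define Q where "Q = 1\<^sub>m e - T * S"
  have TS: "T * S \<in> carrier_mat e e" using T S by auto
  have Q: "Q \<in> carrier_mat e e" using T S by (auto simp: Q_def)
  have "T * S * (T * S) = T * (S * T * S)"
    using assoc_mult_mat[OF T S TS] assoc_mult_mat[OF S T S] by simp
  then have TSTS: "T * S * (T * S) = T * S" using ST S by simp
  have QQ: "Q * Q = Q"
  proof -
    have "T * S * Q = 0\<^sub>m e e"
      unfolding Q_def using mult_minus_distrib_mat[OF TS one_carrier_mat TS] TSTS
        right_mult_one_mat[OF TS] minus_r_inv_mat[OF TS] by simp
    then have "(1\<^sub>m e - T * S) * Q = Q"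
      using minus_mult_distrib_mat[OF one_carrier_mat TS Q] Q by (intro eq_matI) auto
    then show ?thesis unfolding Q_def[symmetric] .
  qed
  have Qcomm: "Q * \<sigma> h = \<sigma> h * Q" if h: "h \<in> carrier G" for h
  proof -
    have "T * S * \<sigma> h = T * (\<rho> h * S)" using assoc_mult_mat[OF T S cs[OF h]] Scomm[OF h] by simp
    also have "\<dots> = \<sigma> h * T * S" using assoc_mult_mat[OF T cr[OF h] S] comm[OF h] by simp
    also have "\<dots> = \<sigma> h * (T * S)" by (rule assoc_mult_mat[OF cs[OF h] T S])
    finally show ?thesis unfolding Q_def
      using minus_mult_distrib_mat[OF one_carrier_mat TS cs[OF h]] mult_minus_distrib_mat[OF cs[OF h] one_carrier_mat TS]
        left_mult_one_mat[OF cs[OF h]] right_mult_one_mat[OF cs[OF h]] by simp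
  qed
  define L where "L h = \<sigma> h * Q" for h
  have Lc: "L h \<in> carrier_mat e e" if "h \<in> carrier G" for h using cs[OF that] Q by (simp add: L_def)
  have Lm: "L (g \<otimes> h) = L g * L h" if g: "g \<in> carrier G" and h: "h \<in> carrier G" for g h
  proof -
    have "L g * L h = \<sigma> g * (Q * (\<sigma> h * Q))"
      unfolding L_def by (rule assoc_mult_mat[OF cs[OF g] Q mult_carrier_mat[OF cs[OF h] Q]])
    also have "Q * (\<sigma> h * Q) = \<sigma> h * Q * Q" using assoc_mult_mat[OF Q cs[OF h] Q] Qcomm[OF h] by simp
    also have "\<dots> = \<sigma> h * Q" using assoc_mult_mat[OF cs[OF h] Q Q] QQ by simp
    also have "\<sigma> g * (\<sigma> h * Q) = L (g \<otimes> h)"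
      unfolding L_def ms[OF g h] by (rule assoc_mult_mat[OF cs[OF g] cs[OF h] Q, symmetric])
    finally show ?thesis by simp
  qed
  have tr: "mat_trace (L h) = \<psi> h - \<chi> h" if h: "h \<in> carrier G" for h
  proof -
    have "L h = \<sigma> h - \<sigma> h * (T * S)"
      unfolding L_def Q_def using mult_minus_distrib_mat[OF cs[OF h] one_carrier_mat TS] right_mult_one_mat[OF cs[OF h]] by simp
    then have "mat_trace (L h) = mat_trace (\<sigma> h) - mat_trace (\<sigma> h * (T * S))"
      using mat_trace_minus[OF cs[OF h] mult_carrier_mat[OF cs[OF h] TS]] by simp
    also have "\<sigma> h * (T * S) = T * (\<rho> h * S)"
      using assoc_mult_mat[OF cs[OF h] T S] comm[OF h] assoc_mult_mat[OF T cr[OF h] S] by simp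
    also have "mat_trace (T * (\<rho> h * S)) = mat_trace (\<rho> h * S * T)"
      by (rule mat_trace_comm[OF T mult_carrier_mat[OF cr[OF h] S]])
    also have "\<rho> h * S * T = \<rho> h" using assoc_mult_mat[OF cr[OF h] S T] ST cr[OF h] by simp
    finally show ?thesis using h by (simp add: \<psi> \<chi>)
  qed
  have "(\<lambda>x\<in>carrier G. mat_trace (L x)) \<in> characters G \<or> (\<forall>x\<in>carrier G. mat_trace (L x) = 0)"
    by (rule nonunital_trace[OF G Lc Lm])
  moreover have "(\<lambda>x\<in>carrier G. mat_trace (L x)) = (\<lambda>x\<in>carrier G. \<psi> x - \<chi> x)"
    using tr by (intro restrict_ext) simp
  moreover have "\<psi> = \<chi>" if "\<forall>x\<in>carrier G. mat_trace (L x) = 0"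
  proof
    fix x show "\<psi> x = \<chi> x" using tr[of x] that by (cases "x \<in> carrier G") (auto simp: \<psi> \<chi>)
  qed
  moreover have "\<chi> \<in> characters G" unfolding \<chi> by (rule charactersI[OF r d])
  ultimately show ?thesis using assms(4) unfolding constituent_def by auto
qed

section \<open>Unitriangular matrices and block matrices\<close>

lemma mult_mat_index:
  assumes "A \<in> carrier_mat a k" "B \<in> carrier_mat k b" "i < a" "j < b"
  shows "(A * B) $$ (i, j) = (\<Sum>l<k. A $$ (i, l) * B $$ (l, j))"
  using assms by (simp add: scalar_prod_def atLeast0LessThan)

lemma sandwich_index:
  fixes A :: "'a::comm_semiring_0 mat"
  assumes "A \<in> carrier_mat k k" "X \<in> carrier_mat k k" "B \<in> carrier_mat k k" "i < k" "j < k"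
  shows "(A * X * B) $$ (i, j) = (\<Sum>c<k. \<Sum>d<k. A $$ (i, c) * X $$ (c, d) * B $$ (d, j))"
proof -
  have "(A * X * B) $$ (i, j) = (\<Sum>d<k. (\<Sum>c<k. A $$ (i, c) * X $$ (c, d)) * B $$ (d, j))"
    using mult_mat_index[OF mult_carrier_mat[OF assms(1,2)] assms(3-5)]
      mult_mat_index[OF assms(1,2,4)] by simp
  also have "\<dots> = (\<Sum>d<k. \<Sum>c<k. A $$ (i, c) * X $$ (c, d) * B $$ (d, j))"
    by (simp add: sum_distrib_right)
  finally show ?thesis by (subst sum.swap)
qed

lemma congruence_index:
  fixes A :: "'a::comm_semiring_0 mat"
  assumes "A \<in> carrier_mat k k" "X \<in> carrier_mat k k" "i < k" "j < k"
  shows "(A * X * A\<^sup>T) $$ (i, j) = (\<Sum>c<k. \<Sum>d<k. A $$ (i, c) * X $$ (c, d) * A $$ (j, d))"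
proof -
  have "A\<^sup>T \<in> carrier_mat k k" using assms(1) by simp
  from sandwich_index[OF assms(1,2) this assms(3,4)] show ?thesis
    using assms by (auto intro!: sum.cong)
qed

lemma unitriangularD:
  assumes "x \<in> unitriangular k"
  shows "x \<in> carrier_mat k k" "\<And>i j. j < i \<Longrightarrow> i < k \<Longrightarrow> x $$ (i, j) = 0" "\<And>i. i < k \<Longrightarrow> x $$ (i, i) = 1"
  using assms by (auto simp: unitriangular_def upper_triangular_def)

lemma unitriangularI:
  assumes "x \<in> carrier_mat k k" "\<And>i j. j < i \<Longrightarrow> i < k \<Longrightarrow> x $$ (i, j) = 0" "\<And>i. i < k \<Longrightarrow> x $$ (i, i) = 1"
  shows "x \<in> unitriangular k"
  using assms by (auto simp: unitriangular_def upper_triangular_def)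

lemma unitriangular_one: "1\<^sub>m k \<in> unitriangular k"
  by (auto intro: unitriangularI)

lemma unitriangular_mult:
  fixes x :: "'a::comm_ring_1 mat"
  assumes "x \<in> unitriangular k" "y \<in> unitriangular k"
  shows "x * y \<in> unitriangular k"
proof (rule unitriangularI)
  note x = unitriangularD[OF assms(1)] and y = unitriangularD[OF assms(2)]
  show "x * y \<in> carrier_mat k k" using x(1) y(1) by auto
  fix i assume i: "i < k"
  show "(x * y) $$ (i, j) = 0" if "j < i" for j
  proof -
    have "x $$ (i, l) * y $$ (l, j) = 0" if "l < k" for l
      using x(2)[of l i] y(2)[of j l] that \<open>j < i\<close> i by (cases "l < i") auto
    then show ?thesis using mult_mat_index[OF x(1) y(1) i] that i by simp
  qed
  have "(x * y) $$ (i, i) = (\<Sum>l<k. if l = i then 1 else 0)"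
    unfolding mult_mat_index[OF x(1) y(1) i i]
  proof (intro sum.cong refl)
    fix l assume "l \<in> {..<k}"
    then show "x $$ (i, l) * y $$ (l, i) = (if l = i then 1 else 0)"
      using x(2)[of l i] y(2)[of i l] x(3) y(3) i by (cases l i rule: linorder_cases) auto
  qed
  then show "(x * y) $$ (i, i) = 1" using i by simp
qed

lemma unitriangular_inverse:
  fixes x :: "'a::field mat"
  assumes x: "x \<in> unitriangular k"
  obtains y where "y \<in> unitriangular k" "x * y = 1\<^sub>m k" "y * x = 1\<^sub>m k"
proof -
  note xd = unitriangularD[OF x]
  have "det x = prod_list (diag_mat x)"
    by (rule det_upper_triangular[OF _ xd(1)]) (use x in \<open>simp add: unitriangular_def\<close>)
  also have "diag_mat x = replicate k 1"
    using xd by (intro nth_equalityI) (auto simp: diag_mat_def)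
  finally have "det x \<noteq> 0" by simp
  from det_non_zero_imp_unit[OF xd(1) this, of "()"]
  obtain y where y: "y \<in> carrier_mat k k" "y * x = 1\<^sub>m k" "x * y = 1\<^sub>m k"
    by (auto simp: Units_def ring_mat_simps)
  \<comment> \<open>The entries of \<open>y * x\<close> on and below the diagonal, column by column
    from the left: terms with \<open>l < j\<close> vanish by induction, those with
    \<open>l > j\<close> because \<open>x\<close> is upper triangular.\<close>
  have step: "y $$ (i, j) = (if i = j then 1 else 0)" if "j \<le> i" "i < k" for i j
    using that
  proof (induction j rule: less_induct)
    case (less j)
    have "(if i = j then 1 else 0) = (y * x) $$ (i, j)" using less y by simp
    also have "\<dots> = (\<Sum>l<k. y $$ (i, l) * x $$ (l, j))"
      using mult_mat_index[OF y(1) xd(1)] less by simp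
    also have "\<dots> = (\<Sum>l<k. if l = j then y $$ (i, j) else 0)"
    proof (intro sum.cong refl)
      fix l assume "l \<in> {..<k}"
      then show "y $$ (i, l) * x $$ (l, j) = (if l = j then y $$ (i, j) else 0)"
        using xd less by (cases l j rule: linorder_cases) auto
    qed
    also have "\<dots> = y $$ (i, j)" using less by simp
    finally show ?case by simp
  qed
  have "y \<in> unitriangular k" by (rule unitriangularI[OF y(1)]) (auto simp: step)
  then show ?thesis using that y by blast
qed

lemma finite_carrier_mat: "finite (carrier_mat k l :: 'a::finite mat set)"
proof (rule finite_subset)
  show "carrier_mat k l \<subseteq> (\<lambda>f. mat k l f) ` (({..<k} \<times> {..<l}) \<rightarrow>\<^sub>E (UNIV :: 'a set))"
  proof
    fix A :: "'a mat" assume "A \<in> carrier_mat k l"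
    then have "A = mat k l (restrict (($$) A) ({..<k} \<times> {..<l}))" by (intro eq_matI) auto
    then show "A \<in> (\<lambda>f. mat k l f) ` (({..<k} \<times> {..<l}) \<rightarrow>\<^sub>E UNIV)" by auto
  qed
  show "finite ((\<lambda>f. mat k l f) ` (({..<k} \<times> {..<l}) \<rightarrow>\<^sub>E (UNIV :: 'a set)))"
    by (intro finite_imageI finite_PiE) auto
qed

text \<open>The map \<open>d \<mapsto> u * d * v\<close> is unipotent, so \<open>-1\<close> is no
  eigenvalue unless \<open>2 = 0\<close>. Concretely, an entry of \<open>u * d * v\<close> is that
  of \<open>d\<close> plus contributions from entries further down or to the left, whence the
  induction from the lower left corner.\<close>

lemma sandwich_negate:
  fixes u :: "'a::field mat"
  assumes two: "(2 :: 'a) \<noteq> 0" and u: "u \<in> unitriangular k" and v: "v \<in> unitriangular k"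
    and d: "d \<in> carrier_mat k k" and e: "u * d * v = - d"
  shows "d = 0\<^sub>m k k"
proof -
  note ud = unitriangularD[OF u] and vd = unitriangularD[OF v]
  have "d $$ (i, j) = 0" if "i < k" "j < k" for i j
    using that
  proof (induction "(k - i) + j" arbitrary: i j rule: less_induct)
    case less
    have "- d $$ (i, j) = (u * d * v) $$ (i, j)" using e d less by simp
    also have "\<dots> = (\<Sum>c<k. \<Sum>l<k. u $$ (i, c) * d $$ (c, l) * v $$ (l, j))"
      by (rule sandwich_index) (use ud vd d less in auto)
    also have "\<dots> = (\<Sum>c<k. \<Sum>l<k. if c = i \<and> l = j then d $$ (i, j) else 0)"
    proof (intro sum.cong refl)
      fix c l assume cl: "c \<in> {..<k}" "l \<in> {..<k}"
      show "u $$ (i, c) * d $$ (c, l) * v $$ (l, j) = (if c = i \<and> l = j then d $$ (i, j) else 0)"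
      proof (cases "c < i \<or> j < l")
        case True
        then show ?thesis using ud(2)[of c i] vd(2)[of j l] cl less by auto
      next
        case False
        show ?thesis
        proof (cases "c = i \<and> l = j")
          case True then show ?thesis using ud(3) vd(3) less by simp
        next
          case ne: False
          with \<open>\<not> (c < i \<or> j < l)\<close> cl less(2,3) have "k - c + l < k - i + j" by auto
          then have "d $$ (c, l) = 0" using less(1)[of c l] cl by auto
          then show ?thesis using ne by auto
        qed
      qed
    qed
    also have "\<dots> = (\<Sum>c<k. if c = i then d $$ (i, j) else 0)"
      using less by (intro sum.cong refl) auto
    also have "\<dots> = d $$ (i, j)" using less by simp
    finally have "2 * d $$ (i, j) = 0" by (metis add.inverse_inverse add_eq_0_iff mult_2)
    then show ?case using two by simp
  qed
  then show ?thesis using d by (intro eq_matI) auto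
qed

section \<open>The antidiagonal matrix and block matrices\<close>

lemma antidiag_carrier [simp]: "antidiag n \<in> carrier_mat n n"
  by (simp add: antidiag_def)

lemma mult_antidiag:
  fixes A :: "'a::semiring_1 mat"
  assumes "A \<in> carrier_mat k n" "i < k" "j < n"
  shows "(A * antidiag n) $$ (i, j) = A $$ (i, n - 1 - j)"
proof -
  have "(A * antidiag n) $$ (i, j) = (\<Sum>l<n. if l = n - 1 - j then A $$ (i, n - 1 - j) else 0)"
    unfolding mult_mat_index[OF assms(1) antidiag_carrier assms(2,3)]
    using assms by (intro sum.cong refl) (auto simp: antidiag_def)
  then show ?thesis using assms by simp
qed

lemma antidiag_mult:
  fixes A :: "'a::semiring_1 mat"
  assumes "A \<in> carrier_mat n k" "i < n" "j < k"
  shows "(antidiag n * A) $$ (i, j) = A $$ (n - 1 - i, j)"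
proof -
  have "(antidiag n * A) $$ (i, j) = (\<Sum>l<n. if l = n - 1 - i then A $$ (n - 1 - i, j) else 0)"
    unfolding mult_mat_index[OF antidiag_carrier assms]
    using assms by (intro sum.cong refl) (auto simp: antidiag_def)
  then show ?thesis using assms by simp
qed

lemma block_element_carrier:
  assumes "x \<in> carrier_mat n n" "y \<in> carrier_mat n n" "v \<in> carrier_mat n r" "w \<in> carrier_mat n n"
  shows "block_element n r x y v w \<in> carrier_mat (2 * n + r) (2 * n + r)"
  using assms by (intro carrier_matI) (auto simp: block_element_def append_rows_def antidiag_def)

text \<open>Conjugating a transpose by \<open>antidiag n\<close> reflects it in the antidiagonal.
  This is why the lower right block shows \<open>y\<close> with both indices reversed and
  exchanged.\<close>

lemma block_element_index:
  fixes x :: "'a::comm_ring_1 mat"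
  assumes x: "x \<in> carrier_mat n n" and y: "y \<in> carrier_mat n n" and v: "v \<in> carrier_mat n r"
    and w: "w \<in> carrier_mat n n" and i: "i < 2 * n + r" and j: "j < 2 * n + r"
  shows "block_element n r x y v w $$ (i, j) =
    (if i < n then if j < n then x $$ (i, j) else if j < n + r then (x * v) $$ (i, j - n)
        else (x * w) $$ (i, j - (n + r))
     else if i < n + r then if j < n + r then (if i = j then 1 else 0)
        else - v $$ (2 * n + r - 1 - j, i - n)
     else if j < n + r then 0 else y $$ (2 * n + r - 1 - j, 2 * n + r - 1 - i))"
proof -
  have ar: "((x * w) @\<^sub>r (- (v\<^sup>T) * antidiag n)) \<in> carrier_mat (n + r) n"
    using x v w by (intro carrier_append_rows) auto
  have 1: "((x * w) @\<^sub>r (- (v\<^sup>T) * antidiag n)) $$ (i, j) =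
    (if i < n then (x * w) $$ (i, j) else - v $$ (n - 1 - j, i - n))" if "i < n + r" "j < n" for i j
  proof -
    have "(- (v\<^sup>T) * antidiag n) $$ (i - n, j) = - v $$ (n - 1 - j, i - n)" if "\<not> i < n"
      using mult_antidiag[of "- (v\<^sup>T)" r n "i - n" j] v that \<open>i < n + r\<close> \<open>j < n\<close> by auto
    then show ?thesis using that x v w by (auto simp: append_rows_def)
  qed
  have 2: "(antidiag n * y\<^sup>T * antidiag n) $$ (i, j) = y $$ (n - 1 - j, n - 1 - i)" if "i < n" "j < n" for i j
  proof -
    have "(antidiag n * y\<^sup>T * antidiag n) $$ (i, j) = (antidiag n * y\<^sup>T) $$ (i, n - 1 - j)"
      using that y by (intro mult_antidiag[of _ n] mult_carrier_mat[of _ n n]) auto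
    also have "\<dots> = y\<^sup>T $$ (n - 1 - i, n - 1 - j)" using that y by (intro antidiag_mult[of _ _ n]) auto
    finally show ?thesis using that y by auto
  qed
  have e: "n - 1 - (k - (n + r)) = 2 * n + r - 1 - k" if "k < 2 * n + r" "\<not> k < n + r" for k
    using that by auto
  have fb: "four_block_mat A B C D $$ (i, j) = (if i < n + r
      then if j < n + r then A $$ (i, j) else B $$ (i, j - (n + r))
      else if j < n + r then C $$ (i - (n + r), j) else D $$ (i - (n + r), j - (n + r)))"
    if "A \<in> carrier_mat (n + r) (n + r)" "D \<in> carrier_mat n n" for A B C D :: "'a mat"
    using that i j by (simp add: index_mat_four_block)
  have "block_element n r x y v w $$ (i, j) = (if i < n + r
      then if j < n + r then four_block_mat x (x * v) (0\<^sub>m r n) (1\<^sub>m r) $$ (i, j)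
        else ((x * w) @\<^sub>r (- (v\<^sup>T) * antidiag n)) $$ (i, j - (n + r))
      else if j < n + r then 0\<^sub>m n (n + r) $$ (i - (n + r), j)
        else (antidiag n * y\<^sup>T * antidiag n) $$ (i - (n + r), j - (n + r)))"
    unfolding block_element_def
    by (rule fb) (use x v in \<open>auto simp: antidiag_def\<close>)
  also have "\<dots> = (if i < n then if j < n then x $$ (i, j) else if j < n + r then (x * v) $$ (i, j - n)
        else (x * w) $$ (i, j - (n + r))
     else if i < n + r then if j < n + r then (if i = j then 1 else 0)
        else - v $$ (2 * n + r - 1 - j, i - n)
     else if j < n + r then 0 else y $$ (2 * n + r - 1 - j, 2 * n + r - 1 - i))"
  proof -
    have "four_block_mat x (x * v) (0\<^sub>m r n) (1\<^sub>m r) $$ (i, j) =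
      (if i < n then if j < n then x $$ (i, j) else (x * v) $$ (i, j - n) else if i = j then 1 else 0)"
      if "i < n + r" "j < n + r"
      using that x v by (auto simp: index_mat_four_block)
    moreover have "((x * w) @\<^sub>r (- (v\<^sup>T) * antidiag n)) $$ (i, j - (n + r)) =
      (if i < n then (x * w) $$ (i, j - (n + r)) else - v $$ (2 * n + r - 1 - j, i - n))"
      if "i < n + r" "\<not> j < n + r"
      using 1[of i "j - (n + r)"] e[of j] that j by auto
    moreover have "(antidiag n * y\<^sup>T * antidiag n) $$ (i - (n + r), j - (n + r)) =
      y $$ (2 * n + r - 1 - j, 2 * n + r - 1 - i)" if "\<not> i < n + r" "\<not> j < n + r"
      using 2[of "i - (n + r)" "j - (n + r)"] e[of j] e[of i] that i j by auto
    moreover have "(0\<^sub>m n (n + r) :: 'a mat) $$ (i - (n + r), j) = 0" if "\<not> i < n + r" "j < n + r"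
      using that i by auto
    ultimately show ?thesis by (auto split: if_splits)
  qed
  finally show ?thesis .
qed

section \<open>The isometries of the form\<close>

locale unipotent =
  fixes t :: classical_type and n :: nat and \<theta> :: "'a::{field,finite} \<Rightarrow> complex"
  assumes n: "n \<ge> 1" and two: "(2::'a) \<noteq> 0" and \<theta>: "nontrivial_additive_character \<theta>"
begin

abbreviation r where "r \<equiv> mid t"
abbreviation m where "m \<equiv> size_of t n"
abbreviation T where "T \<equiv> (unitriangular m :: 'a mat set)"
abbreviation U where "U \<equiv> (unipotent_carrier t n :: 'a mat set)"

text \<open>\<open>form\<^sup>T\<close> is \<open>\<sigma>\<close> times \<open>form\<close>, and
  \<open>B\<^sup>T\<close> is \<open>- \<sigma>\<close> times \<open>B\<close> for the elements
  \<open>B\<close> of \<open>forms\<close> below.\<close>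

definition \<sigma> :: 'a where "\<sigma> = (if t = Sp_even then -1 else 1)"

definition s :: "nat \<Rightarrow> 'a" where "s k = (if k < m - n then 1 else \<sigma>)"

definition form :: "'a mat" where
  "form = mat m m (\<lambda>(k, l). if k + l + 1 = m then s k else 0)"

lemma r_le: "r \<le> 1" by (cases t) auto
lemma m_eq: "m = 2 * n + r" by (simp add: size_of_def)
lemma mn: "m - n = n + r" "m - (n + r) = n" "m > 0" using n by (auto simp: m_eq)
lemma \<sigma>2: "\<sigma> * \<sigma> = 1" "\<sigma> \<noteq> 0" by (auto simp: \<sigma>_def)
lemma \<sigma>_cases: "t = Sp_even \<Longrightarrow> \<sigma> = -1" "t \<noteq> Sp_even \<Longrightarrow> \<sigma> = 1"
  unfolding \<sigma>_def by simp_all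
lemma r_cases: "t = Sp_even \<Longrightarrow> r = 0" "r = 1 \<longleftrightarrow> t = O_odd" by (cases t, auto)+
lemma s_bar: "k < m \<Longrightarrow> s (m - 1 - k) = \<sigma> * s k"
proof (cases "t = Sp_even")
  case True
  then have "r = 0" "\<sigma> = -1" by (rule r_cases, rule \<sigma>_cases)
  then show "s (m - 1 - k) = \<sigma> * s k" if "k < m" using that by (auto simp: s_def m_eq)
next
  case False
  then have "\<sigma> = 1" by (rule \<sigma>_cases)
  then show "s (m - 1 - k) = \<sigma> * s k" by (auto simp: s_def)
qed
lemma s2: "s k * s k = 1" "s k \<noteq> 0" by (auto simp: s_def \<sigma>2)
lemma form_carrier [simp]: "form \<in> carrier_mat m m" by (simp add: form_def)

lemma mult_form:
  assumes "A \<in> carrier_mat m m" "k < m" "l < m"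
  shows "(A * form) $$ (k, l) = A $$ (k, m - 1 - l) * s (m - 1 - l)"
proof -
  have "(A * form) $$ (k, l) = (\<Sum>c<m. if c = m - 1 - l then A $$ (k, m - 1 - l) * s (m - 1 - l) else 0)"
    unfolding mult_mat_index[OF assms(1) form_carrier assms(2,3)]
    using assms by (intro sum.cong refl) (auto simp: form_def)
  then show ?thesis using assms by simp
qed

lemma form_mult:
  assumes "A \<in> carrier_mat m m" "k < m" "l < m"
  shows "(form * A) $$ (k, l) = s k * A $$ (m - 1 - k, l)"
proof -
  have "(form * A) $$ (k, l) = (\<Sum>c<m. if c = m - 1 - k then s k * A $$ (m - 1 - k, l) else 0)"
    unfolding mult_mat_index[OF form_carrier assms]
    using assms by (intro sum.cong refl) (auto simp: form_def)
  then show ?thesis using assms by simp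
qed

lemma form_form: "form * form\<^sup>T = 1\<^sub>m m" "form\<^sup>T * form = 1\<^sub>m m"
proof -
  have a: "form * form\<^sup>T = 1\<^sub>m m"
  proof (rule eq_matI)
    fix i j assume "i < dim_row (1\<^sub>m m :: 'a mat)" "j < dim_col (1\<^sub>m m :: 'a mat)"
    then have i: "i < m" and j: "j < m" by auto
    have "(form * form\<^sup>T) $$ (i, j) = s i * form $$ (j, m - 1 - i)"
      using form_mult[of "form\<^sup>T" i j] i j by (simp add: form_def)
    also have "\<dots> = (1\<^sub>m m :: 'a mat) $$ (i, j)" using i j by (auto simp: form_def s2)
    finally show "(form * form\<^sup>T) $$ (i, j) = (1\<^sub>m m :: 'a mat) $$ (i, j)" .
  qed (auto simp: form_def)
  then show "form * form\<^sup>T = 1\<^sub>m m" .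
  show "form\<^sup>T * form = 1\<^sub>m m"
    by (rule mat_mult_left_right_inverse[OF form_carrier _ a]) simp
qed

text \<open>Equivalent to \<open>u\<^sup>T * form * u = form\<close>, because the inverse of
  \<open>form\<close> is \<open>\<sigma>\<close> times \<open>form\<close>. In this version products
  of rows of \<open>u\<close> are compared, and conjugation becomes congruence.\<close>

definition isometries :: "'a mat set" where
  "isometries = {u \<in> T. u * form * u\<^sup>T = form}"

lemma isometriesD:
  assumes "u \<in> isometries"
  shows "u \<in> T" "u \<in> carrier_mat m m" "u * form * u\<^sup>T = form"
  using assms by (auto simp: isometries_def unitriangularD)

text \<open>The third sum is the first one with \<open>p\<close> and \<open>q\<close> exchanged. So
  a single sum, \<open>S p q\<close> in \<open>block_element_isometry\<close>, together with the
  middle column controls all products of rows.\<close>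

lemma isometry_index:
  assumes u: "u \<in> carrier_mat m m" and p: "p < m" and q: "q < m"
  shows "(u * form * u\<^sup>T) $$ (p, q) = (\<Sum>k<n. u $$ (p, k) * u $$ (q, m - 1 - k)) +
    (\<Sum>k<r. u $$ (p, n + k) * u $$ (q, n + k)) + \<sigma> * (\<Sum>k<n. u $$ (q, k) * u $$ (p, m - 1 - k))"
proof -
  have "(u * form * u\<^sup>T) $$ (p, q) = (\<Sum>c<m. (u * form) $$ (p, c) * u $$ (q, c))"
    using mult_mat_index[of "u * form" m m "u\<^sup>T" m p q] u p q by auto
  also have "\<dots> = (\<Sum>c<m. u $$ (p, m - 1 - c) * s (m - 1 - c) * u $$ (q, c))"
    using mult_form[OF u p] by (intro sum.cong refl) simp
  also have "\<dots> = (\<Sum>k<m. s k * (u $$ (p, k) * u $$ (q, m - 1 - k)))"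
    by (rule sum.reindex_bij_witness[of _ "\<lambda>k. m - 1 - k" "\<lambda>k. m - 1 - k"]) (auto simp: mult_ac)
  also have "{..<m} = {..<n} \<union> ({n..<n + r} \<union> {n + r..<m})" by (auto simp: m_eq)
  also have "(\<Sum>k\<in>{..<n} \<union> ({n..<n + r} \<union> {n + r..<m}). s k * (u $$ (p, k) * u $$ (q, m - 1 - k))) =
     (\<Sum>k<n. s k * (u $$ (p, k) * u $$ (q, m - 1 - k))) +
     ((\<Sum>k=n..<n + r. s k * (u $$ (p, k) * u $$ (q, m - 1 - k))) +
     (\<Sum>k=n + r..<m. s k * (u $$ (p, k) * u $$ (q, m - 1 - k))))"
    by (subst sum.union_disjoint, auto)+
  also have "(\<Sum>k<n. s k * (u $$ (p, k) * u $$ (q, m - 1 - k))) = (\<Sum>k<n. u $$ (p, k) * u $$ (q, m - 1 - k))"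
    by (intro sum.cong refl) (auto simp: s_def mn)
  also have "(\<Sum>k=n..<n + r. s k * (u $$ (p, k) * u $$ (q, m - 1 - k))) = (\<Sum>k<r. u $$ (p, n + k) * u $$ (q, n + k))"
  proof (intro sum.reindex_bij_witness[of _ "\<lambda>k. n + k" "\<lambda>k. k - n"])
    fix a assume "a \<in> {n..<n + r}"
    then have "a = n" "m - 1 - a = n" "r = 1" using r_le by (auto simp: m_eq)
    then show "u $$ (p, n + (a - n)) * u $$ (q, n + (a - n)) = s a * (u $$ (p, a) * u $$ (q, m - 1 - a))"
      by (simp add: s_def mn)
  qed auto
  also have "(\<Sum>k=n + r..<m. s k * (u $$ (p, k) * u $$ (q, m - 1 - k))) = (\<Sum>k<n. \<sigma> * (u $$ (q, k) * u $$ (p, m - 1 - k)))"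
    by (intro sum.reindex_bij_witness[of _ "\<lambda>k. m - 1 - k" "\<lambda>k. m - 1 - k"]) (auto simp: s_def m_eq)
  finally show ?thesis by (simp add: sum_distrib_left add.assoc)
qed

text \<open>Brings the three cases to one equation: the sum over \<open>k < r\<close> is empty
  unless the middle index is present, and \<open>\<sigma>\<close> supplies the sign.\<close>

lemma w_condition_index:
  assumes v: "v \<in> carrier_mat n r" and w: "w \<in> carrier_mat n n"
  shows "w_condition t n v w \<longleftrightarrow>
    (\<forall>i<n. \<forall>j<n. w $$ (j, n - 1 - i) + \<sigma> * w $$ (i, n - 1 - j) = - (\<Sum>k<r. v $$ (i, k) * v $$ (j, k)))"
    (is "_ \<longleftrightarrow> (\<forall>i<n. \<forall>j<n. ?P i j)")
proof -
  have a: "(antidiag n * w\<^sup>T) $$ (i, j) = w $$ (j, n - 1 - i)" if "i < n" "j < n" for i j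
    using antidiag_mult[of "w\<^sup>T" n n i j] w that by auto
  have b: "(w * antidiag n) $$ (i, j) = w $$ (i, n - 1 - j)" if "i < n" "j < n" for i j
    by (rule mult_antidiag[OF w that])
  have c: "(v * v\<^sup>T) $$ (i, j) = (\<Sum>k<r. v $$ (i, k) * v $$ (j, k))" if "i < n" "j < n" for i j
    using mult_mat_index[of v n r "v\<^sup>T" n i j] v that by (auto intro!: sum.cong)
  have car: "antidiag n * w\<^sup>T \<in> carrier_mat n n" "w * antidiag n \<in> carrier_mat n n" "v * v\<^sup>T \<in> carrier_mat n n"
    using w v by (auto intro!: mult_carrier_mat[of _ n n])
  have ext: "A = B \<longleftrightarrow> (\<forall>i<n. \<forall>j<n. A $$ (i, j) = B $$ (i, j))"
    if "A \<in> carrier_mat n n" "B \<in> carrier_mat n n" for A B :: "'a mat"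
    using that by (auto intro!: eq_matI)
  define P Q V where "P = antidiag n * w\<^sup>T" and "Q = w * antidiag n" and "V = v * v\<^sup>T"
  note PQV = P_def[symmetric] Q_def[symmetric] V_def[symmetric]
  have z: "V = 0\<^sub>m n n" if "r = 0"
    using c car(3) that unfolding PQV by (intro eq_matI) auto
  have "w_condition t n v w \<longleftrightarrow> P + \<sigma> \<cdot>\<^sub>m Q = - V"
  proof (cases t)
    case Sp_even
    then have "- V = 0\<^sub>m n n" "P + \<sigma> \<cdot>\<^sub>m Q = P - Q"
      using z car \<sigma>_def unfolding PQV by (auto intro!: eq_matI)
    then show ?thesis using Sp_even by (simp add: PQV)
  next
    case O_even
    then have "- V = 0\<^sub>m n n" "P + \<sigma> \<cdot>\<^sub>m Q = P + Q"
      using z car \<sigma>_def unfolding PQV by (auto intro!: eq_matI)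
    then show ?thesis using O_even by (simp add: PQV)
  next
    case O_odd
    then have "P + \<sigma> \<cdot>\<^sub>m Q = P + Q"
      using car \<sigma>_def unfolding PQV by (auto intro!: eq_matI)
    then show ?thesis using O_odd by (simp add: PQV)
  qed
  also have "\<dots> \<longleftrightarrow> (\<forall>i<n. \<forall>j<n. (P + \<sigma> \<cdot>\<^sub>m Q) $$ (i, j) = (- V) $$ (i, j))"
    by (rule ext) (use car in \<open>auto simp: PQV\<close>)
  also have "\<dots> \<longleftrightarrow> (\<forall>i<n. \<forall>j<n. ?P i j)"
    using a b c car unfolding PQV by auto
  finally show ?thesis .
qed

text \<open>Each block answers for one kind of product of rows. Two upper rows give the condition on
  \<open>w\<close>, multiplied by \<open>x\<close> and its transpose; an upper and the middle row
  explain the block \<open>- v\<^sup>T J\<close>; an upper and a lower row amount to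
  \<open>x * y = 1\<close>.\<close>

lemma block_element_isometry:
  assumes x: "x \<in> unitriangular n" and y: "y \<in> carrier_mat n n" and xy: "x * y = 1\<^sub>m n" and yx: "y * x = 1\<^sub>m n"
    and v: "v \<in> carrier_mat n r" and w: "w \<in> carrier_mat n n" and wc: "w_condition t n v w"
  shows "block_element n r x y v w \<in> isometries"
proof -
  define u where "u = block_element n r x y v w"
  note xd = unitriangularD[OF x]
  have uc: "u \<in> carrier_mat m m" unfolding u_def m_eq by (rule block_element_carrier[OF xd(1) y v w])
  have u: "u $$ (i, j) = (if i < n then if j < n then x $$ (i, j) else if j < n + r then (x * v) $$ (i, j - n)
        else (x * w) $$ (i, j - (n + r))
     else if i < n + r then if j < n + r then (if i = j then 1 else 0)
        else - v $$ (m - 1 - j, i - n)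
     else if j < n + r then 0 else y $$ (m - 1 - j, m - 1 - i))" if "i < m" "j < m" for i j
    using block_element_index[OF xd(1) y v w, of i j] that unfolding u_def m_eq by simp
  obtain z where z: "z \<in> unitriangular n" "x * z = 1\<^sub>m n" "z * x = 1\<^sub>m n"
    using unitriangular_inverse[OF x] by blast
  have "y = y * (x * z)" using z y by simp
  also have "\<dots> = z" using assoc_mult_mat[OF y xd(1) unitriangularD(1)[OF z(1)], symmetric] yx z(1) unitriangularD(1)[OF z(1)] by simp
  finally have yu: "y \<in> unitriangular n" using z by simp
  note yd = unitriangularD[OF yu]
  have "u \<in> T"
  proof (rule unitriangularI[OF uc])
    fix i j assume "j < i" "i < m"
    then show "u $$ (i, j) = 0"
      using u[of i j] xd(2)[of j i] yd(2)[of "m - 1 - i" "m - 1 - j"] by (auto simp: m_eq)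
  next
    fix i assume "i < m"
    then show "u $$ (i, i) = 1"
      using u[of i i] xd(3)[of i] yd(3)[of "m - 1 - i"] by (auto simp: m_eq)
  qed
  moreover have "u * form * u\<^sup>T = form"
  proof (rule eq_matI)
    fix p q assume "p < dim_row form" "q < dim_col form"
    then have p: "p < m" and q: "q < m" by (auto simp: form_def)
    define S where "S p q = (\<Sum>k<n. u $$ (p, k) * u $$ (q, m - 1 - k))" for p q
    have e: "(u * form * u\<^sup>T) $$ (p, q) = S p q + (\<Sum>k<r. u $$ (p, n + k) * u $$ (q, n + k)) + \<sigma> * S q p"
      unfolding S_def by (rule isometry_index[OF uc p q])
    have S0: "S p q = 0" if "n \<le> p" "p < m" for p q
      unfolding S_def by (rule sum.neutral) (use u that in \<open>auto simp: m_eq\<close>)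
    have S1: "S p q = - (x * v) $$ (p, q - n)" if "p < n" "n \<le> q" "q < n + r" for p q
    proof -
      have "S p q = (\<Sum>k<n. - (x $$ (p, k) * v $$ (k, q - n)))"
        unfolding S_def
      proof (intro sum.cong refl)
        fix k assume "k \<in> {..<n}"
        then show "u $$ (p, k) * u $$ (q, m - 1 - k) = - (x $$ (p, k) * v $$ (k, q - n))"
          using u[of p k] u[of q "m - 1 - k"] that by (auto simp: m_eq)
      qed
      then show ?thesis using mult_mat_index[OF xd(1) v, of p "q - n"] that by (simp add: sum_negf)
    qed
    have S2: "S p q = (if p + q + 1 = m then 1 else 0)" if "p < n" "n + r \<le> q" "q < m" for p q
    proof -
      have "S p q = (\<Sum>k<n. x $$ (p, k) * y $$ (k, m - 1 - q))"
        unfolding S_def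
      proof (intro sum.cong refl)
        fix k assume "k \<in> {..<n}"
        then show "u $$ (p, k) * u $$ (q, m - 1 - k) = x $$ (p, k) * y $$ (k, m - 1 - q)"
          using u[of p k] u[of q "m - 1 - k"] that by (auto simp: m_eq)
      qed
      also have "\<dots> = (x * y) $$ (p, m - 1 - q)" using mult_mat_index[OF xd(1) y, of p "m - 1 - q"] that by (simp add: m_eq)
      finally show ?thesis using xy that by (auto simp: m_eq)
    qed
    have S3: "S p q = (\<Sum>k<n. \<Sum>l<n. x $$ (p, k) * x $$ (q, l) * w $$ (l, n - 1 - k))" if "p < n" "q < n" for p q
      unfolding S_def
    proof (intro sum.cong refl)
      fix k assume k: "k \<in> {..<n}"
      then have "u $$ (q, m - 1 - k) = (x * w) $$ (q, n - 1 - k)"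
        using u[of q "m - 1 - k"] that by (auto simp: m_eq)
      also have "\<dots> = (\<Sum>l<n. x $$ (q, l) * w $$ (l, n - 1 - k))"
        using mult_mat_index[OF xd(1) w, of q "n - 1 - k"] that k by simp
      finally show "u $$ (p, k) * u $$ (q, m - 1 - k) = (\<Sum>l<n. x $$ (p, k) * x $$ (q, l) * w $$ (l, n - 1 - k))"
        using u[of p k] that k by (simp add: m_eq sum_distrib_left mult.assoc)
    qed
    have mid_top: "u $$ (p, n + k) = (x * v) $$ (p, k)" if "p < n" "k < r" for p k
      using u[of p "n + k"] that by (auto simp: m_eq)
    have mid_mid: "u $$ (p, n + k) = 1" if "n \<le> p" "p < n + r" "k < r" for p k
      using u[of p "n + k"] that r_le by (auto simp: m_eq)
    have mid_bot: "u $$ (p, n + k) = 0" if "n + r \<le> p" "p < m" "k < r" for p k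
      using u[of p "n + k"] that by (auto simp: m_eq)
    consider (1) "p < n" "q < n" | (2) "p < n" "n \<le> q" "q < n + r" | (3) "p < n" "n + r \<le> q"
      | (4) "n \<le> p" "p < n + r" "q < n" | (5) "n + r \<le> p" "q < n" | (6) "n \<le> p" "n \<le> q" by linarith
    then show "(u * form * u\<^sup>T) $$ (p, q) = form $$ (p, q)"
    proof cases
      case 1
      have "S p q + \<sigma> * S q p = (\<Sum>k<n. \<Sum>l<n. x $$ (p, k) * x $$ (q, l) * w $$ (l, n - 1 - k)) +
          \<sigma> * (\<Sum>k<n. \<Sum>l<n. x $$ (p, k) * x $$ (q, l) * w $$ (k, n - 1 - l))"
        unfolding S3[OF 1] S3[OF 1(2,1)] by (subst (3) sum.swap) (simp add: mult_ac)
      also have "\<dots> = (\<Sum>k<n. \<Sum>l<n. x $$ (p, k) * x $$ (q, l) * (w $$ (l, n - 1 - k) + \<sigma> * w $$ (k, n - 1 - l)))"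
        by (simp add: sum_distrib_left sum.distrib distrib_left mult_ac)
      also have "\<dots> = (\<Sum>k<n. \<Sum>l<n. \<Sum>c<r. - (x $$ (p, k) * v $$ (k, c) * (x $$ (q, l) * v $$ (l, c))))"
        using wc unfolding w_condition_index[OF v w]
        by (intro sum.cong refl) (simp add: sum_distrib_left sum_negf[symmetric] mult_ac)
      also have "\<dots> = (\<Sum>k<n. \<Sum>c<r. \<Sum>l<n. - (x $$ (p, k) * v $$ (k, c) * (x $$ (q, l) * v $$ (l, c))))"
        by (intro sum.cong refl sum.swap)
      also have "\<dots> = (\<Sum>c<r. \<Sum>k<n. \<Sum>l<n. - (x $$ (p, k) * v $$ (k, c) * (x $$ (q, l) * v $$ (l, c))))"
        by (rule sum.swap)
      also have "\<dots> = - (\<Sum>c<r. u $$ (p, n + c) * u $$ (q, n + c))"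
        unfolding sum_negf[symmetric]
      proof (intro sum.cong refl)
        fix c assume c: "c \<in> {..<r}"
        have xv: "u $$ (p, n + c) = (\<Sum>k<n. x $$ (p, k) * v $$ (k, c))" if "p < n" for p
          using mid_top[OF that, of c] mult_mat_index[OF xd(1) v that, of c] c by simp
        show "(\<Sum>k<n. \<Sum>l<n. - (x $$ (p, k) * v $$ (k, c) * (x $$ (q, l) * v $$ (l, c)))) = - (u $$ (p, n + c) * u $$ (q, n + c))"
          unfolding xv[OF 1(1)] xv[OF 1(2)] by (simp add: sum_product sum_negf)
      qed
      finally have "S p q + \<sigma> * S q p + (\<Sum>c<r. u $$ (p, n + c) * u $$ (q, n + c)) = 0" by simp
      then have "(u * form * u\<^sup>T) $$ (p, q) = 0" unfolding e by (simp only: ac_simps)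
      then show ?thesis using 1 by (simp add: form_def m_eq)
    next
      case 2
      then have "r = 1" "q = n" using r_le by auto
      have "(u * form * u\<^sup>T) $$ (p, q) = 0"
        unfolding e using S1[OF 2] S0[of q p] 2 mid_top[of p 0] mid_mid[of q 0] \<open>r = 1\<close> \<open>q = n\<close> q by simp
      then show ?thesis using 2 by (simp add: form_def m_eq)
    next
      case 3
      have "(u * form * u\<^sup>T) $$ (p, q) = (if p + q + 1 = m then 1 else 0)"
        unfolding e using S2[OF 3 q] S0[of q p] 3 q mid_bot[of q] by simp
      then show ?thesis using 3 p q by (auto simp: form_def s_def mn)
    next
      case 4
      then have "r = 1" "p = n" using r_le by auto
      then have "\<sigma> = 1" using r_cases(2) \<sigma>_cases(2) by simp
      have "(u * form * u\<^sup>T) $$ (p, q) = 0"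
        unfolding e using S1[OF 4(3,1,2)] S0[of p q] 4 mid_top[of q 0] mid_mid[of p 0] \<open>r = 1\<close> \<open>p = n\<close> \<open>\<sigma> = 1\<close> p by simp
      then show ?thesis using 4 by (simp add: form_def m_eq)
    next
      case 5
      have "(u * form * u\<^sup>T) $$ (p, q) = \<sigma> * (if p + q + 1 = m then 1 else 0)"
        unfolding e using S2[OF 5(2,1) p] S0[of p q] 5 p mid_bot[of p] by (simp add: add_ac)
      then show ?thesis using 5 p q by (auto simp: form_def s_def mn)
    next
      case 6
      have "(u * form * u\<^sup>T) $$ (p, q) = (\<Sum>k<r. u $$ (p, n + k) * u $$ (q, n + k))"
        unfolding e using S0[of p q] S0[of q p] 6 p q by simp
      also have "\<dots> = (if p + q + 1 = m then 1 else 0)"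
      proof (cases "p < n + r \<and> q < n + r")
        case True
        then have "r = 1" "p = n" "q = n" using r_le 6 by auto
        then show ?thesis using mid_mid[of n 0] by (simp add: m_eq)
      next
        case False
        then show ?thesis using 6 p q mid_bot[of p] mid_bot[of q] by (auto simp: m_eq)
      qed
      finally show ?thesis using 6 p q by (auto simp: form_def s_def m_eq)
    qed
  qed (use uc in \<open>auto simp: form_def\<close>)
  ultimately show ?thesis unfolding u_def[symmetric] isometries_def by simp
qed

lemma unipotent_carrier_isometries: "U \<subseteq> isometries"
  unfolding unipotent_carrier_def
  by (auto intro!: block_element_isometry simp: inverts_mat_def unitriangularD(1) dest: unitriangularD(1))

section \<open>The bijection onto forms\<close>

lemma form_dim [simp]: "dim_row form = m" "dim_col form = m"
  by (simp_all add: form_def)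

text \<open>
  Up to multiplication by the Gram matrix, \<open>bil\<close> is the Springer-type map \<open>u \<mapsto> (u - u\<^sup>-\<^sup>1) / 2\<close>
  from the group to its Lie algebra. It is linear in the entries of \<open>u\<close>.
\<close>

definition bil :: "'a mat \<Rightarrow> 'a mat" where
  "bil u = inverse 2 \<cdot>\<^sub>m (u * form - form * u\<^sup>T)"

text \<open>The Lie algebra of \<open>U\<close>, multiplied by \<open>form\<close>. The positions
  with \<open>m \<le> k + l + 1\<close> are the antidiagonal and what lies below it. Under
  \<open>pairing\<close> this space also serves as its own dual.\<close>

definition forms :: "'a mat set" where
  "forms = {B \<in> carrier_mat m m. (\<forall>k<m. \<forall>l<m. B $$ (l, k) = - \<sigma> * B $$ (k, l)) \<and>
     (\<forall>k<m. \<forall>l<m. m \<le> k + l + 1 \<longrightarrow> B $$ (k, l) = 0)}"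

lemma formsD:
  assumes "B \<in> forms"
  shows "B \<in> carrier_mat m m" "\<And>k l. k < m \<Longrightarrow> l < m \<Longrightarrow> B $$ (l, k) = - \<sigma> * B $$ (k, l)"
    "\<And>k l. k < m \<Longrightarrow> l < m \<Longrightarrow> m \<le> k + l + 1 \<Longrightarrow> B $$ (k, l) = 0"
  using assms unfolding forms_def by blast+

lemma finite_forms: "finite forms"
  using finite_subset[OF _ finite_carrier_mat[of m m], of forms] unfolding forms_def by blast

lemma finite_T: "finite T"
  using finite_subset[OF _ finite_carrier_mat[of m m], of T] unitriangularD(1) by blast

lemma bil_carrier [simp]: "u \<in> carrier_mat m m \<Longrightarrow> bil u \<in> carrier_mat m m"
  unfolding bil_def by (intro smult_carrier_mat minus_carrier_mat mult_carrier_mat[of _ m m]) auto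

lemma bil_index:
  assumes "u \<in> carrier_mat m m" "k < m" "l < m"
  shows "bil u $$ (k, l) = (u $$ (k, m - 1 - l) * s (m - 1 - l) - s k * u $$ (l, m - 1 - k)) / 2"
proof -
  have "bil u $$ (k, l) = inverse 2 * ((u * form) $$ (k, l) - (form * u\<^sup>T) $$ (k, l))"
  proof -
    have "u * form \<in> carrier_mat m m" "form * u\<^sup>T \<in> carrier_mat m m"
      using assms by (auto intro!: mult_carrier_mat[of _ m m])
    then show ?thesis using assms unfolding bil_def by simp
  qed
  also have "(form * u\<^sup>T) $$ (k, l) = s k * u $$ (l, m - 1 - k)"
    using form_mult[of "u\<^sup>T" k l] assms by simp
  finally show ?thesis using mult_form[OF assms] by (simp add: field_simps)
qed

lemma bil_forms:
  assumes u: "u \<in> T"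
  shows "bil u \<in> forms"
proof -
  note ud = unitriangularD[OF u]
  have "bil u $$ (l, k) = - \<sigma> * bil u $$ (k, l)" if "k < m" "l < m" for k l
  proof -
    have "s l = s (m - 1 - (m - 1 - l))" using that by simp
    also have "\<dots> = \<sigma> * s (m - 1 - l)" using that by (intro s_bar) simp
    finally show ?thesis
      unfolding bil_index[OF ud(1) that] bil_index[OF ud(1) that(2,1)]
      using s_bar[OF that(1)] \<sigma>2 by (simp add: field_simps)
  qed
  moreover have "bil u $$ (k, l) = 0" if "k < m" "l < m" "m \<le> k + l + 1" for k l
  proof (cases "m = k + l + 1")
    case True
    then have "m - 1 - l = k" "m - 1 - k = l" by auto
    then show ?thesis using bil_index[OF ud(1) that(1,2)] ud(3) that by simp
  next
    case False
    then have "u $$ (k, m - 1 - l) = 0" "u $$ (l, m - 1 - k) = 0" using that ud(2) by auto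
    then show ?thesis using bil_index[OF ud(1) that(1,2)] by simp
  qed
  ultimately show ?thesis using bil_carrier[OF ud(1)] unfolding forms_def by blast
qed

section \<open>Isometries and their images under \<open>bil\<close>\<close>

lemmas assoc = assoc_mult_mat[of _ m m _ m _ m]

lemma isometries_one: "1\<^sub>m m \<in> isometries"
  using left_mult_one_mat[OF form_carrier] right_mult_one_mat[OF form_carrier]
  by (simp add: isometries_def unitriangular_one)

lemma isometries_mult:
  assumes "u \<in> isometries" "v \<in> isometries"
  shows "u * v \<in> isometries"
proof -
  note u = isometriesD[OF assms(1)] and v = isometriesD[OF assms(2)]
  have "u * v * form * (u * v)\<^sup>T = u * (v * form * v\<^sup>T) * u\<^sup>T"
    using u(2) v(2) by (simp add: transpose_mult[OF u(2) v(2)] assoc mult_carrier_mat[of _ m m _ m])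
  then show ?thesis using u v by (simp add: isometries_def unitriangular_mult)
qed

text \<open>The inverse of an isometry is its adjoint. This links the definition of
  \<open>bil\<close>, which is linear in \<open>u\<close>, to the difference of \<open>u\<close> and
  its inverse.\<close>

lemma isometry_inverse:
  assumes "u \<in> isometries"
  obtains u' where "u' \<in> isometries" "u * u' = 1\<^sub>m m" "u' * u = 1\<^sub>m m"
    "form * u\<^sup>T = u' * form" "form * u'\<^sup>T = u * form"
proof -
  note u = isometriesD[OF assms]
  obtain u' where u': "u' \<in> T" "u * u' = 1\<^sub>m m" "u' * u = 1\<^sub>m m"
    using unitriangular_inverse[OF u(1)] by blast
  note c = u(2) unitriangularD(1)[OF u'(1)]
  have "u' * (u * form * u\<^sup>T) = (u' * u) * (form * u\<^sup>T)"
    using c by (simp add: assoc mult_carrier_mat[of _ m m _ m])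
  then have 1: "form * u\<^sup>T = u' * form"
    unfolding u(3) u'(3) using c by (simp add: left_mult_one_mat[of _ m m] mult_carrier_mat[of _ m m _ m])
  have tt: "u\<^sup>T * u'\<^sup>T = 1\<^sub>m m"
    using transpose_mult[OF c(2,1)] u'(3) by simp
  have "(u * form * u\<^sup>T) * u'\<^sup>T = u * form * (u\<^sup>T * u'\<^sup>T)"
    using c by (simp add: assoc mult_carrier_mat[of _ m m _ m])
  then have 2: "form * u'\<^sup>T = u * form"
    unfolding u(3) tt using c by (simp add: mult_carrier_mat[of _ m m _ m])
  have "u' * form * u'\<^sup>T = u' * u * form"
    using c 2 by (simp add: assoc mult_carrier_mat[of _ m m _ m])
  then have "u' * form * u'\<^sup>T = form" unfolding u'(3) by simp
  then show ?thesis using that[OF _ u'(2,3) 1 2] u'(1) by (simp add: isometries_def)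
qed

text \<open>Moving the inverse of \<open>k\<close> past \<open>form\<close> turns it into
  \<open>k\<^sup>T\<close>, and this happens in the same way in \<open>u * form\<close> and in
  \<open>form * u\<^sup>T\<close>.\<close>

lemma bil_conjugate:
  assumes k: "k \<in> isometries" and u: "u \<in> isometries" and k': "k' \<in> carrier_mat m m" and kk: "k' * k = 1\<^sub>m m"
  shows "bil (k * u * k') = k * bil u * k\<^sup>T"
proof -
  obtain l where l: "l \<in> isometries" "k * l = 1\<^sub>m m" "form * k\<^sup>T = l * form" "form * l\<^sup>T = k * form"
    using isometry_inverse[OF k] by blast
  note c = isometriesD(2)[OF k] isometriesD(2)[OF u] isometriesD(2)[OF l(1)]
  have "k' = k' * (k * l)" using l(2) k' by simp
  also have "\<dots> = l" using assoc[OF k' c(1,3)] kk c(3) by simp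
  finally have kl: "k' = l" .
  have 1: "k * u * l * form = k * (u * form) * k\<^sup>T"
    using c l(3) by (simp add: assoc mult_carrier_mat[of _ m m _ m])
  have "(k * u * l)\<^sup>T = l\<^sup>T * (u\<^sup>T * k\<^sup>T)"
    using c by (simp add: transpose_mult[of _ m m _ m] mult_carrier_mat[of _ m m _ m])
  then have "form * (k * u * l)\<^sup>T = (form * l\<^sup>T) * (u\<^sup>T * k\<^sup>T)"
    using c by (simp add: assoc mult_carrier_mat[of _ m m _ m])
  then have 2: "form * (k * u * l)\<^sup>T = k * (form * u\<^sup>T) * k\<^sup>T"
    using c l(4) by (simp add: assoc mult_carrier_mat[of _ m m _ m])
  define P Q where "P = u * form" and "Q = form * u\<^sup>T"
  have PQ: "P \<in> carrier_mat m m" "Q \<in> carrier_mat m m"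
    using c by (auto simp: P_def Q_def intro!: mult_carrier_mat[of _ m m])
  have kT: "k\<^sup>T \<in> carrier_mat m m" using c by simp
  have "k * (inverse 2 \<cdot>\<^sub>m (P - Q)) * k\<^sup>T = inverse 2 \<cdot>\<^sub>m (k * P * k\<^sup>T - k * Q * k\<^sup>T)"
    using PQ c(1) kT mult_smult_distrib[OF c(1) minus_carrier_mat[OF PQ(2)], of "inverse 2" P]
      mult_smult_assoc_mat[OF mult_carrier_mat[OF c(1) minus_carrier_mat[OF PQ(2)]] kT, of "inverse 2" P]
      mult_minus_distrib_mat[OF c(1) PQ]
      minus_mult_distrib_mat[OF mult_carrier_mat[OF c(1) PQ(1)] mult_carrier_mat[OF c(1) PQ(2)] kT]
    by simp
  then show ?thesis unfolding bil_def kl 1 2 P_def Q_def by simp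
qed

text \<open>With \<open>d = u - v\<close>, equality of the images shows that \<open>d\<close> is
  also the difference of the inverses of \<open>u\<close> and \<open>v\<close>. Then
  \<open>u * d * v = v - u = - d\<close>, and \<open>sandwich_negate\<close> applies.\<close>

lemma bil_inj: "inj_on bil isometries"
proof (rule inj_onI)
  fix u v assume u: "u \<in> isometries" and v: "v \<in> isometries" and e: "bil u = bil v"
  obtain u' where u': "u' \<in> isometries" "u * u' = 1\<^sub>m m" "form * u\<^sup>T = u' * form"
    using isometry_inverse[OF u] by blast
  obtain v' where v': "v' \<in> isometries" "v' * v = 1\<^sub>m m" "form * v\<^sup>T = v' * form"
    using isometry_inverse[OF v] by blast
  note c = isometriesD(2)[OF u] isometriesD(2)[OF v] isometriesD(2)[OF u'(1)] isometriesD(2)[OF v'(1)]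
  have f: "u * form - form * u\<^sup>T = (u - u') * form" "v * form - form * v\<^sup>T = (v - v') * form"
    unfolding u'(3) v'(3)
    by (rule minus_mult_distrib_mat[OF c(1,3) form_carrier, symmetric],
        rule minus_mult_distrib_mat[OF c(2,4) form_carrier, symmetric])
  have "2 \<cdot>\<^sub>m bil w = w * form - form * w\<^sup>T" if "w \<in> carrier_mat m m" for w
    unfolding bil_def using two that by (intro eq_matI) (auto simp: form_def)
  from this[OF c(1)] this[OF c(2)] have "(u - u') * form = (v - v') * form" unfolding e f by simp
  then have "(u - u') * (form * form\<^sup>T) = (v - v') * (form * form\<^sup>T)"
    using assoc[OF minus_carrier_mat[OF c(3), of u] form_carrier transpose_carrier_mat[THEN iffD2, OF form_carrier]]
      assoc[OF minus_carrier_mat[OF c(4), of v] form_carrier transpose_carrier_mat[THEN iffD2, OF form_carrier]] by simp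
  then have d: "u - u' = v - v'" unfolding form_form using c by simp
  have e2: "u - v = u' - v'"
  proof (rule eq_matI)
    fix i j assume "i < dim_row (u' - v')" "j < dim_col (u' - v')"
    then have ij: "i < m" "j < m" using c by auto
    have "(u - u') $$ (i, j) = (v - v') $$ (i, j)" unfolding d ..
    then show "(u - v) $$ (i, j) = (u' - v') $$ (i, j)" using ij c by (simp add: algebra_simps)
  qed (use c in auto)
  have "u * (u - v) * v = u * (u' * v) - u * (v' * v)"
    unfolding e2 using c by (simp add: mult_minus_distrib_mat[of _ m m] minus_mult_distrib_mat[of _ m m] assoc mult_carrier_mat[of _ m m _ m])
  also have "u * (u' * v) = v" using assoc[OF c(1,3,2)] u'(2) c by simp
  also have "v - u * (v' * v) = - (u - v)" unfolding v'(2) using c by (intro eq_matI) auto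
  finally have "u - v = 0\<^sub>m m m"
    by (rule sandwich_negate[OF two isometriesD(1)[OF u] isometriesD(1)[OF v] minus_carrier_mat[OF c(2)]])
  show "u = v"
  proof (rule eq_matI)
    fix i j assume "i < dim_row v" "j < dim_col v"
    then have ij: "i < m" "j < m" using c by auto
    have "(u - v) $$ (i, j) = 0" unfolding \<open>u - v = 0\<^sub>m m m\<close> using ij by simp
    then show "u $$ (i, j) = v $$ (i, j)" using ij c by simp
  qed (use c in auto)
qed

section \<open>Elements of \<open>U\<close> with prescribed blocks, and a count\<close>

definition tri_inv :: "'a mat \<Rightarrow> 'a mat" where
  "tri_inv x = (SOME y. y \<in> unitriangular (dim_row x) \<and> x * y = 1\<^sub>m (dim_row x) \<and> y * x = 1\<^sub>m (dim_row x))"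

lemma tri_inv:
  assumes "x \<in> unitriangular k"
  shows "tri_inv x \<in> unitriangular k" "x * tri_inv x = 1\<^sub>m k" "tri_inv x * x = 1\<^sub>m k"
proof -
  have "dim_row x = k" using unitriangularD(1)[OF assms] by simp
  moreover have "\<exists>y. y \<in> unitriangular k \<and> x * y = 1\<^sub>m k \<and> y * x = 1\<^sub>m k"
    using unitriangular_inverse[OF assms] by metis
  ultimately have "tri_inv x \<in> unitriangular k \<and> x * tri_inv x = 1\<^sub>m k \<and> tri_inv x * x = 1\<^sub>m k"
    unfolding tri_inv_def by (metis (mono_tags, lifting) someI_ex)
  then show "tri_inv x \<in> unitriangular k" "x * tri_inv x = 1\<^sub>m k" "tri_inv x * x = 1\<^sub>m k" by auto
qed

text \<open>\<open>half_w v Z\<close> solves the equation for \<open>w\<close>, the general solution being parametrized by \<open>Z\<close>.\<close>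

definition half_w :: "'a mat \<Rightarrow> 'a mat \<Rightarrow> 'a mat" where
  "half_w v Z = (Z - inverse 2 \<cdot>\<^sub>m (v * v\<^sup>T)) * antidiag n"

text \<open>The parameter \<open>p\<close> is the upper middle block \<open>x * v\<close> rather
  than \<open>v\<close>, so that this part of the upper rows can be prescribed as it stands.\<close>

definition block_of :: "'a mat \<Rightarrow> 'a mat \<Rightarrow> 'a mat \<Rightarrow> 'a mat" where
  "block_of x p Z = block_element n r x (tri_inv x) (tri_inv x * p) (half_w (tri_inv x * p) Z)"

lemma half_w_index:
  assumes "v \<in> carrier_mat n r" "Z \<in> carrier_mat n n" "i < n" "j < n"
  shows "half_w v Z $$ (i, n - 1 - j) = Z $$ (i, j) - (\<Sum>k<r. v $$ (i, k) * v $$ (j, k)) / 2"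
proof -
  have V: "v * v\<^sup>T \<in> carrier_mat n n" using assms by (auto intro!: mult_carrier_mat[of _ n r])
  have "half_w v Z $$ (i, n - 1 - j) = (Z - inverse 2 \<cdot>\<^sub>m (v * v\<^sup>T)) $$ (i, n - 1 - (n - 1 - j))"
    unfolding half_w_def using assms V by (intro mult_antidiag[of _ n]) auto
  also have "\<dots> = Z $$ (i, j) - inverse 2 * (v * v\<^sup>T) $$ (i, j)"
    using assms V by simp
  also have "(v * v\<^sup>T) $$ (i, j) = (\<Sum>k<r. v $$ (i, k) * v $$ (j, k))"
    using mult_mat_index[of v n r "v\<^sup>T" n i j] assms by (auto intro!: sum.cong)
  finally show ?thesis by (simp add: field_simps)
qed

lemma half_w_carrier:
  "v \<in> carrier_mat n r \<Longrightarrow> Z \<in> carrier_mat n n \<Longrightarrow> half_w v Z \<in> carrier_mat n n"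
  unfolding half_w_def by (intro mult_carrier_mat[of _ n n] minus_carrier_mat smult_carrier_mat mult_carrier_mat[of _ n r]) auto

text \<open>When the middle index is present, the inhomogeneous part \<open>- v v\<^sup>T\<close> is
  symmetric, so half of it in each of the two terms solves the equation. \<open>Z\<close> runs
  through the solutions of the homogeneous equation.\<close>

lemma block_of_U:
  assumes x: "x \<in> unitriangular n" and p: "p \<in> carrier_mat n r" and Z: "Z \<in> carrier_mat n n"
    and sym: "\<And>i j. i < n \<Longrightarrow> j < n \<Longrightarrow> Z $$ (j, i) = - \<sigma> * Z $$ (i, j)"
  shows "block_of x p Z \<in> U"
proof -
  note y = tri_inv[OF x]
  define v where "v = tri_inv x * p"
  have v: "v \<in> carrier_mat n r" using unitriangularD(1)[OF y(1)] p by (auto simp: v_def)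
  note w = half_w_carrier[OF v Z]
  have "half_w v Z $$ (j, n - 1 - i) + \<sigma> * half_w v Z $$ (i, n - 1 - j) = - (\<Sum>k<r. v $$ (i, k) * v $$ (j, k))"
    if i: "i < n" and j: "j < n" for i j
  proof -
    define V where "V = (\<Sum>k<r. v $$ (i, k) * v $$ (j, k))"
    have V': "(\<Sum>k<r. v $$ (j, k) * v $$ (i, k)) = V" unfolding V_def by (simp add: mult.commute)
    have "half_w v Z $$ (j, n - 1 - i) + \<sigma> * half_w v Z $$ (i, n - 1 - j) = - (1 + \<sigma>) * (V / 2)"
      unfolding half_w_index[OF v Z j i] half_w_index[OF v Z i j] V' V_def[symmetric] sym[OF i j]
      by (simp add: algebra_simps)
    also have "\<dots> = - V"
    proof (cases "t = Sp_even")
      case True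
      then have "V = 0" using r_cases(1) by (simp add: V_def)
      then show ?thesis by simp
    next
      case False
      then show ?thesis using \<sigma>_cases(2) two by (simp add: field_simps)
    qed
    finally show ?thesis unfolding V_def .
  qed
  then have "w_condition t n v (half_w v Z)" using w_condition_index[OF v w] by blast
  moreover have "inverts_mat x (tri_inv x)" "inverts_mat (tri_inv x) x"
    using y x by (auto simp: inverts_mat_def dest!: unitriangularD(1))
  ultimately show ?thesis
    unfolding unipotent_carrier_def block_of_def v_def[symmetric]
    using x unitriangularD(1)[OF y(1)] v w by blast
qed

lemma block_of_index:
  assumes x: "x \<in> unitriangular n" and p: "p \<in> carrier_mat n r" and Z: "Z \<in> carrier_mat n n" and i: "i < n"
  shows "j < n \<Longrightarrow> block_of x p Z $$ (i, j) = x $$ (i, j)"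
    "j < r \<Longrightarrow> block_of x p Z $$ (i, n + j) = p $$ (i, j)"
    "j < n \<Longrightarrow> block_of x p Z $$ (i, n + r + j) = (x * half_w (tri_inv x * p) Z) $$ (i, j)"
proof -
  note y = tri_inv[OF x] and xc = unitriangularD(1)[OF x]
  have yc: "tri_inv x \<in> carrier_mat n n" using y unitriangularD(1) by blast
  have v: "tri_inv x * p \<in> carrier_mat n r" using yc p by auto
  have "x * (tri_inv x * p) = p" using assoc_mult_mat[OF xc yc p] y p by simp
  then show "j < n \<Longrightarrow> block_of x p Z $$ (i, j) = x $$ (i, j)"
    "j < r \<Longrightarrow> block_of x p Z $$ (i, n + j) = p $$ (i, j)"
    "j < n \<Longrightarrow> block_of x p Z $$ (i, n + r + j) = (x * half_w (tri_inv x * p) Z) $$ (i, j)"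
    unfolding block_of_def
    using block_element_index[OF xc yc v half_w_carrier[OF v Z]] i by auto
qed

text \<open>The blocks \<open>x\<close> and \<open>x * v\<close> of an element of \<open>U\<close>
  are free. This is what splits \<open>T\<close> into \<open>stab a b\<close> and \<open>U\<close>
  later on.\<close>

lemma match_rows:
  assumes g: "g \<in> T"
  obtains k where "k \<in> U" "\<And>i j. i < n \<Longrightarrow> j < m - n \<Longrightarrow> k $$ (i, j) = g $$ (i, j)"
proof -
  note gd = unitriangularD[OF g]
  define x where "x = mat n n (\<lambda>ij. g $$ ij)"
  define p where "p = mat n r (\<lambda>(i, j). g $$ (i, n + j))"
  have x: "x \<in> unitriangular n"
    by (rule unitriangularI) (use gd in \<open>auto simp: x_def m_eq\<close>)
  have p: "p \<in> carrier_mat n r" by (simp add: p_def)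
  have "block_of x p (0\<^sub>m n n) \<in> U" by (rule block_of_U[OF x p]) auto
  moreover have "block_of x p (0\<^sub>m n n) $$ (i, j) = g $$ (i, j)" if "i < n" "j < m - n" for i j
  proof (cases "j < n")
    case True
    then show ?thesis using block_of_index(1)[OF x p zero_carrier_mat that(1)] that by (simp add: x_def)
  next
    case False
    then show ?thesis using block_of_index(2)[OF x p zero_carrier_mat that(1), of "j - n"] that by (simp add: p_def mn)
  qed
  ultimately show ?thesis using that by blast
qed

text \<open>In the upper rows of a form, the entries to the right of the middle become
  \<open>x\<close>, the middle column becomes \<open>x * v\<close>, and the left block becomes
  \<open>Z\<close>; symmetry and the zero region determine the rest of the form. The map serves only
  for counting.\<close>

lemma forms_le_U: "card forms \<le> card U"
proof (rule card_inj_on_le)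
  define X where "X B = mat n n (\<lambda>(a, k). if a = k then 1 else if a < k then B $$ (a, m - 1 - k) else 0)" for B :: "'a mat"
  define P where "P B = mat n r (\<lambda>(a, k). B $$ (a, n))" for B :: "'a mat"
  define Z where "Z B = mat n n (\<lambda>ac. B $$ ac)" for B :: "'a mat"
  let ?f = "\<lambda>B. block_of (X B) (P B) (Z B)"
  have X: "X B \<in> unitriangular n" for B by (rule unitriangularI) (auto simp: X_def)
  have P: "P B \<in> carrier_mat n r" and Z: "Z B \<in> carrier_mat n n" for B by (auto simp: P_def Z_def)
  show "?f ` forms \<subseteq> U"
  proof (rule image_subsetI)
    fix B assume B: "B \<in> forms"
    show "?f B \<in> U"
    proof (rule block_of_U[OF X P Z])
      fix i j assume "i < n" "j < n"
      then show "Z B $$ (j, i) = - \<sigma> * Z B $$ (i, j)"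
        using formsD(2)[OF B, of i j] by (simp add: Z_def m_eq)
    qed
  qed
  show "finite U"
    by (rule finite_subset[OF _ finite_T]) (use unipotent_carrier_isometries isometriesD(1) in blast)
  show "inj_on ?f forms"
  proof (rule inj_onI)
    fix B C assume B: "B \<in> forms" and C: "C \<in> forms" and e: "?f B = ?f C"
    note Bd = formsD[OF B] and Cd = formsD[OF C]
    have XX: "X B = X C"
    proof (rule eq_matI)
      fix i j assume "i < dim_row (X C)" "j < dim_col (X C)"
      then have ij: "i < n" "j < n" by (auto simp: X_def)
      then show "X B $$ (i, j) = X C $$ (i, j)"
        using block_of_index(1)[OF X P Z ij, of B B B] block_of_index(1)[OF X P Z ij, of C C C] e by simp
    qed (auto simp: X_def)
    have PP: "P B = P C"
    proof (rule eq_matI)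
      fix i j assume "i < dim_row (P C)" "j < dim_col (P C)"
      then have ij: "i < n" "j < r" by (auto simp: P_def)
      then show "P B $$ (i, j) = P C $$ (i, j)"
        using block_of_index(2)[OF X P Z ij, of B B B] block_of_index(2)[OF X P Z ij, of C C C] e by simp
    qed (auto simp: P_def)
    define x y where "x = X B" and "y = tri_inv x"
    define v where "v = y * P B"
    have x: "x \<in> unitriangular n" unfolding x_def by (rule X)
    note y = tri_inv[OF x, folded y_def]
    have c: "x \<in> carrier_mat n n" "y \<in> carrier_mat n n" "v \<in> carrier_mat n r"
      using x y P by (auto simp: v_def dest: unitriangularD(1) intro!: mult_carrier_mat[of _ n n])
    note w = half_w_carrier[OF c(3) Z[of B]] half_w_carrier[OF c(3) Z[of C]]
    have "x * half_w v (Z B) = x * half_w v (Z C)"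
    proof (rule eq_matI)
      fix i j assume "i < dim_row (x * half_w v (Z C))" "j < dim_col (x * half_w v (Z C))"
      then have ij: "i < n" "j < n" using c w by auto
      have "(x * half_w v (Z B)) $$ (i, j) = ?f B $$ (i, n + r + j)"
        using block_of_index(3)[OF X P Z ij, of B B B] unfolding v_def y_def x_def by simp
      also have "\<dots> = ?f C $$ (i, n + r + j)" unfolding e ..
      also have "\<dots> = (x * half_w v (Z C)) $$ (i, j)"
        using block_of_index(3)[OF X P Z ij, of C C C] unfolding v_def y_def x_def XX PP by simp
      finally show "(x * half_w v (Z B)) $$ (i, j) = (x * half_w v (Z C)) $$ (i, j)" .
    qed (use c w in auto)
    then have "y * (x * half_w v (Z B)) = y * (x * half_w v (Z C))" by simp
    then have ww: "half_w v (Z B) = half_w v (Z C)"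
      using assoc_mult_mat[OF c(2,1) w(1)] assoc_mult_mat[OF c(2,1) w(2)] y(3) w by simp
    have top: "B $$ (i, j) = C $$ (i, j)" if "i < n" "j < m" for i j
    proof -
      consider "j < n" | "n \<le> j" "j < n + r" | "n + r \<le> j" "i < m - 1 - j" | "n + r \<le> j" "m - 1 - j \<le> i" by linarith
      then show ?thesis
      proof cases
        case 1
        have "Z B $$ (i, j) = Z C $$ (i, j)"
          using half_w_index[OF c(3) Z that(1) 1, of B] half_w_index[OF c(3) Z that(1) 1, of C] ww by simp
        then show ?thesis using that 1 by (simp add: Z_def)
      next
        case 2
        then have "j = n" "0 < r" using r_le by auto
        moreover have "P B $$ (i, 0) = P C $$ (i, 0)" unfolding PP ..
        ultimately show ?thesis using that by (simp add: P_def)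
      next
        case 3
        have "X B $$ (i, m - 1 - j) = X C $$ (i, m - 1 - j)" unfolding XX ..
        then show ?thesis using that 3 by (simp add: X_def m_eq)
      next
        case 4
        then show ?thesis using Bd(3)[of i j] Cd(3)[of i j] that by (simp add: m_eq)
      qed
    qed
    show "B = C"
    proof (rule eq_matI)
      fix i j assume "i < dim_row C" "j < dim_col C"
      then have ij: "i < m" "j < m" using Cd(1) by auto
      consider "i < n" | "j < n" | "n \<le> i" "n \<le> j" by linarith
      then show "B $$ (i, j) = C $$ (i, j)"
      proof cases
        case 1 then show ?thesis using top ij by simp
      next
        case 2 then show ?thesis using top[OF 2 ij(1)] Bd(2)[OF ij(2,1)] Cd(2)[OF ij(2,1)] by simp
      next
        case 3
        then show ?thesis using Bd(3)[of i j] Cd(3)[of i j] ij r_le by (simp add: m_eq)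
      qed
    qed (use Bd(1) Cd(1) in auto)
  qed
qed

text \<open>\<open>U\<close> lies in \<open>isometries\<close>, these inject into
  \<open>forms\<close>, and \<open>forms\<close> is no larger than \<open>U\<close>. So all three
  have the same size, which gives the description of \<open>U\<close> and the surjectivity of
  \<open>bil\<close> at once.\<close>

lemma U_isometries: "U = isometries" and bil_bij: "bij_betw bil U forms"
proof -
  have fin: "finite isometries" by (rule finite_subset[OF _ finite_T]) (simp add: isometries_def)
  have sub: "bil ` isometries \<subseteq> forms" using bil_forms isometriesD(1) by blast
  have "card isometries \<le> card forms" by (rule card_inj_on_le[OF bil_inj sub finite_forms])
  then have le: "card isometries \<le> card U" using forms_le_U by simp
  then show U: "U = isometries" using card_seteq[OF fin unipotent_carrier_isometries] by simp
  have "card (bil ` isometries) = card isometries" using bil_inj by (rule card_image)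
  then have "bil ` isometries = forms"
    using card_seteq[OF finite_forms sub] forms_le_U U by simp
  then show "bij_betw bil U forms" unfolding U using bil_inj by (simp add: bij_betw_def)
qed

section \<open>Orbit sums and root conditions\<close>

lemma \<theta>_add: "\<theta> (a + b) = \<theta> a * \<theta> b"
  using \<theta> by (simp add: nontrivial_additive_character_def)

lemma \<theta>_0: "\<theta> 0 = 1"
proof -
  have "\<theta> 0 * \<theta> 0 = \<theta> 0" "\<theta> 0 \<noteq> 0"
    using \<theta>_add[of 0 0] \<theta> by (auto simp: nontrivial_additive_character_def)
  then show ?thesis by simp
qed

lemma \<theta>_sum: "finite S \<Longrightarrow> \<theta> (\<Sum>x\<in>S. f x) = (\<Prod>x\<in>S. \<theta> (f x))"
  by (induction S rule: finite_induct) (auto simp: \<theta>_0 \<theta>_add)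

lemma \<theta>_nontrivial:
  assumes "c \<noteq> 0"
  obtains x where "\<theta> (c * x) \<noteq> 1"
proof -
  obtain a where "\<theta> a \<noteq> 1" using \<theta> by (auto simp: nontrivial_additive_character_def)
  then show ?thesis using that[of "a / c"] assms by simp
qed

text \<open>The standard reason why a nontrivial character sums to zero: the substitution
  \<open>h\<close> multiplies the sum by \<open>z\<close>.\<close>

lemma sum_zero_of_twist:
  fixes f :: "'b \<Rightarrow> complex"
  assumes "(\<Sum>x\<in>S. f (h x)) = (\<Sum>x\<in>S. f x)" "\<And>x. x \<in> S \<Longrightarrow> f (h x) = z * f x" "z \<noteq> 1"
  shows "(\<Sum>x\<in>S. f x) = 0"
proof -
  have "(\<Sum>x\<in>S. f x) = z * (\<Sum>x\<in>S. f x)"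
    using assms(1,2) by (simp add: sum_distrib_left)
  then show ?thesis using assms(3) by simp
qed

section \<open>Unitriangular translations and congruences\<close>

lemma translate_sum:
  assumes S: "S \<subseteq> T" and g: "g \<in> T" and cl: "\<And>x. x \<in> S \<Longrightarrow> g * x \<in> S"
  shows "(\<Sum>x\<in>S. f (g * x)) = (\<Sum>x\<in>S. f x)"
proof -
  obtain y where y: "y \<in> T" "y * g = 1\<^sub>m m" using unitriangular_inverse[OF g] by blast
  have inj: "inj_on ((*) g) S"
  proof (rule inj_onI)
    fix x z assume x: "x \<in> S" and z: "z \<in> S" and e: "g * x = g * z"
    have c: "x \<in> carrier_mat m m" "z \<in> carrier_mat m m" "y \<in> carrier_mat m m" "g \<in> carrier_mat m m"
      using S x z y g by (auto intro: unitriangularD(1))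
    have "y * (g * x) = y * (g * z)" unfolding e ..
    then show "x = z" using assoc_mult_mat[OF c(3,4,1)] assoc_mult_mat[OF c(3,4,2)] y c by simp
  qed
  have "finite S" using finite_T S finite_subset by blast
  then have "(*) g ` S = S" using endo_inj_surj[OF _ _ inj] cl by blast
  then show ?thesis using sum.reindex[OF inj, of f] by simp
qed

lemma translate_sum_right:
  assumes S: "S \<subseteq> T" and g: "g \<in> T" and cl: "\<And>x. x \<in> S \<Longrightarrow> x * g \<in> S"
  shows "(\<Sum>x\<in>S. f (x * g)) = (\<Sum>x\<in>S. f x)"
proof -
  obtain y where y: "y \<in> T" "g * y = 1\<^sub>m m" using unitriangular_inverse[OF g] by blast
  have inj: "inj_on (\<lambda>x. x * g) S"
  proof (rule inj_onI)
    fix x z assume x: "x \<in> S" and z: "z \<in> S" and e: "x * g = z * g"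
    have c: "x \<in> carrier_mat m m" "z \<in> carrier_mat m m" "g \<in> carrier_mat m m" "y \<in> carrier_mat m m"
      using S x z y g by (auto intro: unitriangularD(1))
    have "x * g * y = z * g * y" unfolding e ..
    then show "x = z" using assoc_mult_mat[OF c(1,3,4)] assoc_mult_mat[OF c(2,3,4)] y c by simp
  qed
  have "finite S" using finite_T S finite_subset by blast
  then have "(\<lambda>x. x * g) ` S = S" using endo_inj_surj[OF _ _ inj] cl by blast
  then show ?thesis using sum.reindex[OF inj, of f] by simp
qed

lemma card_pos: "S \<subseteq> T \<Longrightarrow> S \<noteq> {} \<Longrightarrow> card S > 0"
  using finite_T finite_subset by (metis card_gt_0_iff)

lemma congruence_mult:
  fixes g h B :: "'a mat"
  assumes "g \<in> carrier_mat m m" "h \<in> carrier_mat m m" "B \<in> carrier_mat m m"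
  shows "(g * h) * B * (g * h)\<^sup>T = g * (h * B * h\<^sup>T) * g\<^sup>T"
  using assms by (simp add: transpose_mult[OF assms(1,2)] assoc mult_carrier_mat[of _ m m _ m])

text \<open>Congruence by a unitriangular matrix builds the entry \<open>(k, l)\<close> from entries
  \<open>(c, d)\<close> with \<open>c \<ge> k\<close> and \<open>d \<ge> l\<close>, so the zero
  region is preserved. All of \<open>T\<close> acts, not only \<open>U\<close>.\<close>

lemma congruence_forms:
  assumes g: "g \<in> T" and B: "B \<in> forms"
  shows "g * B * g\<^sup>T \<in> forms"
proof -
  note gd = unitriangularD[OF g] and Bd = formsD[OF B]
  have "(g * B * g\<^sup>T) $$ (l, k) = - \<sigma> * (g * B * g\<^sup>T) $$ (k, l)" if "k < m" "l < m" for k l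
  proof -
    have "(g * B * g\<^sup>T) $$ (l, k) = (\<Sum>c<m. \<Sum>d<m. g $$ (l, c) * B $$ (c, d) * g $$ (k, d))"
      by (rule congruence_index[OF gd(1) Bd(1) that(2,1)])
    also have "\<dots> = (\<Sum>d<m. \<Sum>c<m. g $$ (l, c) * B $$ (c, d) * g $$ (k, d))" by (rule sum.swap)
    also have "\<dots> = (\<Sum>d<m. \<Sum>c<m. - \<sigma> * (g $$ (k, d) * B $$ (d, c) * g $$ (l, c)))"
    proof (intro sum.cong refl)
      fix d c assume "d \<in> {..<m}" "c \<in> {..<m}"
      then have "B $$ (c, d) = - \<sigma> * B $$ (d, c)" using Bd(2)[of d c] by simp
      then show "g $$ (l, c) * B $$ (c, d) * g $$ (k, d) = - \<sigma> * (g $$ (k, d) * B $$ (d, c) * g $$ (l, c))"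
        by (simp only: ac_simps mult_minus_left mult_minus_right)
    qed
    also have "\<dots> = - \<sigma> * (g * B * g\<^sup>T) $$ (k, l)"
      unfolding congruence_index[OF gd(1) Bd(1) that] by (simp only: sum_distrib_left)
    finally show ?thesis .
  qed
  moreover have "(g * B * g\<^sup>T) $$ (k, l) = 0" if "k < m" "l < m" "m \<le> k + l + 1" for k l
    unfolding congruence_index[OF gd(1) Bd(1) that(1,2)]
  proof (intro sum.neutral ballI)
    fix c d assume "c \<in> {..<m}" "d \<in> {..<m}"
    then show "g $$ (k, c) * B $$ (c, d) * g $$ (l, d) = 0"
      using gd(2)[of c k] gd(2)[of d l] Bd(3)[of c d] that by (cases "c < k \<or> d < l") auto
  qed
  moreover have "g * B * g\<^sup>T \<in> carrier_mat m m"
    using gd(1) Bd(1) by (intro mult_carrier_mat[of _ m m]) auto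
  ultimately show ?thesis unfolding forms_def by blast
qed

definition elem :: "nat \<Rightarrow> nat \<Rightarrow> 'a \<Rightarrow> 'a mat" where
  "elem a k x = mat m m (\<lambda>(i, j). if i = j then 1 else if i = a \<and> j = k then x else 0)"

lemma elem_T: "a < k \<Longrightarrow> elem a k x \<in> T"
  by (rule unitriangularI) (auto simp: elem_def)

lemma elem_mult:
  assumes "a < k" "k < m" "C \<in> carrier_mat m m" "i < m" "j < m"
  shows "(elem a k x * C) $$ (i, j) = C $$ (i, j) + (if i = a then x * C $$ (k, j) else 0)"
proof -
  have "(elem a k x * C) $$ (i, j) = (\<Sum>l<m. (if l = i then C $$ (i, j) else 0) + (if l = k then if i = a then x * C $$ (k, j) else 0 else 0))"
    unfolding mult_mat_index[OF unitriangularD(1)[OF elem_T[OF assms(1)]] assms(3-5)]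
    using assms by (intro sum.cong refl) (auto simp: elem_def)
  then show ?thesis using assms by (simp add: sum.distrib)
qed

lemma elem_congruence:
  assumes "a < k" "k < m" and C: "C \<in> carrier_mat m m" and "i < m" "j < m"
  shows "(elem a k x * C * (elem a k x)\<^sup>T) $$ (i, j) = C $$ (i, j) + (if i = a then x * C $$ (k, j) else 0) +
    (if j = a then x * (C $$ (i, k) + (if i = a then x * C $$ (k, k) else 0)) else 0)"
proof -
  let ?e = "elem a k x"
  have e: "?e \<in> carrier_mat m m" using unitriangularD(1)[OF elem_T[OF assms(1)]] .
  have "(?e * C * ?e\<^sup>T) $$ (i, j) = (\<Sum>l<m. (?e * C) $$ (i, l) * ?e $$ (j, l))"
    using mult_mat_index[of "?e * C" m m "?e\<^sup>T" m i j] e assms by auto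
  also have "\<dots> = (\<Sum>l<m. (if l = j then (?e * C) $$ (i, j) else 0) + (if l = k then if j = a then (?e * C) $$ (i, k) * x else 0 else 0))"
    using assms by (intro sum.cong refl) (auto simp: elem_def)
  also have "\<dots> = (?e * C) $$ (i, j) + (if j = a then (?e * C) $$ (i, k) * x else 0)"
    using assms by (simp add: sum.distrib)
  finally show ?thesis
    using elem_mult[OF assms(1-5), of x] elem_mult[OF assms(1-4) assms(2), of x] by (simp add: mult.commute)
qed

text \<open>Coordinates on \<open>forms\<close>: one position from each pair of mirror images.
  Diagonal positions occur only in the symplectic case, since in the other two the forms are
  skew-symmetric.\<close>

definition root_pairs :: "(nat \<times> nat) set" where
  "root_pairs = {(a, b). a \<le> b \<and> a + b + 1 < m \<and> (a = b \<longrightarrow> t = Sp_even)}"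

lemma root_pairsD:
  assumes "(a, b) \<in> root_pairs"
  shows "a \<le> b" "a < n" "a < m" "b < m" "a + b + 1 < m" "a = b \<Longrightarrow> t = Sp_even \<and> \<sigma> = -1 \<and> m - n = n"
  using assms r_le r_cases(1) \<sigma>_cases(1) mn(1) unfolding root_pairs_def by (auto simp: m_eq)

text \<open>The condition on \<open>bil u\<close> that characterizes membership in the root subgroup.\<close>

definition root_cond :: "nat \<Rightarrow> nat \<Rightarrow> 'a mat \<Rightarrow> bool" where
  "root_cond a b B \<longleftrightarrow> (\<forall>c. b < c \<and> m - n \<le> c \<and> c < m \<longrightarrow> B $$ (a, c) = 0) \<and>
     (\<forall>d. n \<le> d \<and> d < m \<longrightarrow> B $$ (b, d) = 0)"

text \<open>Large enough for \<open>T\<close> to be the product of this set with \<open>U\<close>,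
  and small enough that congruence by its elements changes the \<open>(a, b)\<close> entry of a form
  only through the entries that \<open>root_cond\<close> tests.\<close>

definition stab :: "nat \<Rightarrow> nat \<Rightarrow> 'a mat set" where
  "stab a b = {g \<in> T. (\<forall>k<n. k \<noteq> a \<longrightarrow> g $$ (a, k) = 0) \<and> (\<forall>l<m - n. l \<noteq> b \<longrightarrow> g $$ (b, l) = 0)}"

lemma stabD:
  assumes "g \<in> stab a b"
  shows "g \<in> T" "\<And>k. k < n \<Longrightarrow> k \<noteq> a \<Longrightarrow> g $$ (a, k) = 0" "\<And>l. l < m - n \<Longrightarrow> l \<noteq> b \<Longrightarrow> g $$ (b, l) = 0"
  using assms by (auto simp: stab_def)

lemma stab_one: "a < m \<Longrightarrow> b < m \<Longrightarrow> 1\<^sub>m m \<in> stab a b"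
  by (auto simp: stab_def unitriangular_one m_eq)

lemma stab_mult:
  assumes ab: "a < m" "b < m" and g: "g \<in> stab a b" and h: "h \<in> stab a b"
  shows "g * h \<in> stab a b"
proof -
  note gd = unitriangularD[OF stabD(1)[OF g]] and hd = unitriangularD[OF stabD(1)[OF h]]
  have "(g * h) $$ (a, k) = 0" if k: "k < n" "k \<noteq> a" for k
  proof -
    have km: "k < m" using k by (simp add: m_eq)
    have "g $$ (a, l) * h $$ (l, k) = 0" if "l < m" for l
      using stabD(2)[OF g, of l] stabD(2)[OF h k] hd(2)[of k l] that k by (cases "l < n"; cases "l = a") auto
    then show ?thesis unfolding mult_mat_index[OF gd(1) hd(1) ab(1) km] by (intro sum.neutral) simp
  qed
  moreover have "(g * h) $$ (b, k) = 0" if k: "k < m - n" "k \<noteq> b" for k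
  proof -
    have km: "k < m" using k by simp
    have "g $$ (b, l) * h $$ (l, k) = 0" if "l < m" for l
      using stabD(3)[OF g, of l] stabD(3)[OF h k] hd(2)[of k l] that k by (cases "l < m - n"; cases "l = b") auto
    then show ?thesis unfolding mult_mat_index[OF gd(1) hd(1) ab(2) km] by (intro sum.neutral) simp
  qed
  ultimately show ?thesis
    using unitriangular_mult[OF stabD(1)[OF g] stabD(1)[OF h]] by (simp add: stab_def)
qed

text \<open>
  Averaging over \<open>stab a b\<close> produces the root condition: if it fails, translating by a suitable
  elementary matrix multiplies the sum by a value of \<open>\<theta>\<close> different from \<open>1\<close>.
\<close>

lemma stab_sum:
  assumes ab: "(a, b) \<in> root_pairs" and B: "B \<in> forms" and c: "c \<noteq> 0"
  shows "(\<Sum>g\<in>stab a b. \<theta> (c * (g * B * g\<^sup>T) $$ (a, b))) =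
    (if root_cond a b B then of_nat (card (stab a b)) * \<theta> (c * B $$ (a, b)) else 0)"
proof -
  note d = root_pairsD[OF ab] and Bd = formsD[OF B]
  have sub: "stab a b \<subseteq> T" by (auto simp: stab_def)
  have twist: "(\<Sum>g\<in>stab a b. \<theta> (c * (g * B * g\<^sup>T) $$ (a, b))) = 0"
    if ij: "i < j" "j < m" and st: "\<And>x. elem i j x \<in> stab a b" and z: "z \<noteq> 0"
      and eff: "\<And>g x. g \<in> stab a b \<Longrightarrow>
        (elem i j x * (g * B * g\<^sup>T) * (elem i j x)\<^sup>T) $$ (a, b) = (g * B * g\<^sup>T) $$ (a, b) + x * z"
    for i j z
  proof -
    obtain x where x: "\<theta> (c * z * x) \<noteq> 1" using \<theta>_nontrivial[of "c * z"] c z by auto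
    show ?thesis
    proof (rule sum_zero_of_twist[where h = "(*) (elem i j x)"])
      show "(\<Sum>g\<in>stab a b. \<theta> (c * (elem i j x * g * B * (elem i j x * g)\<^sup>T) $$ (a, b))) =
         (\<Sum>g\<in>stab a b. \<theta> (c * (g * B * g\<^sup>T) $$ (a, b)))"
        by (rule translate_sum[OF sub elem_T[OF ij(1)] stab_mult[OF d(3,4) st]])
      fix g assume g: "g \<in> stab a b"
      have e: "elem i j x * g * B * (elem i j x * g)\<^sup>T = elem i j x * (g * B * g\<^sup>T) * (elem i j x)\<^sup>T"
        using unitriangularD(1)[OF elem_T[OF ij(1)]] unitriangularD(1)[OF stabD(1)[OF g]] Bd(1)
        by (rule congruence_mult)
      show "\<theta> (c * (elem i j x * g * B * (elem i j x * g)\<^sup>T) $$ (a, b)) =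
        \<theta> (c * z * x) * \<theta> (c * (g * B * g\<^sup>T) $$ (a, b))"
        unfolding e eff[OF g] \<theta>_add[symmetric] by (simp add: algebra_simps)
    qed (rule x)
  qed
  \<comment> \<open>For \<open>a = b\<close> the two clauses of \<open>root_cond\<close> test the
    same entries, so the last case may assume \<open>a \<noteq> b\<close>.\<close>
  consider (1) "root_cond a b B" | (2) "\<exists>c. b < c \<and> m - n \<le> c \<and> c < m \<and> B $$ (a, c) \<noteq> 0"
    | (3) "a \<noteq> b" "\<exists>d. n \<le> d \<and> d < m \<and> B $$ (b, d) \<noteq> 0"
    using d(2,6) unfolding root_cond_def by (metis leD le_neq_implies_less nat_neq_iff order.strict_trans2)
  then show ?thesis
  proof cases
    case 1
    have "(g * B * g\<^sup>T) $$ (a, b) = B $$ (a, b)" if g: "g \<in> stab a b" for g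
    proof -
      note gd = unitriangularD[OF stabD(1)[OF g]]
      have "(g * B * g\<^sup>T) $$ (a, b) = (\<Sum>i<m. \<Sum>j<m. g $$ (a, i) * B $$ (i, j) * g $$ (b, j))"
        by (rule congruence_index[OF gd(1) Bd(1) d(3,4)])
      also have "\<dots> = (\<Sum>i<m. \<Sum>j<m. if i = a \<and> j = b then B $$ (a, b) else 0)"
      proof (intro sum.cong refl)
        fix i j assume ij: "i \<in> {..<m}" "j \<in> {..<m}"
        consider "i = a" "j = b" | "i = a" "j \<noteq> b" "j < b \<or> j < m - n" | "i = a" "b < j" "m - n \<le> j"
          | "i \<noteq> a" "i < n" | "n \<le> i" "i \<noteq> a" "j = b" | "n \<le> i" "i \<noteq> a" "j \<noteq> b" "j < m - n" | "n \<le> i" "i \<noteq> a" "j \<noteq> b" "m - n \<le> j"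
          by linarith
        then show "g $$ (a, i) * B $$ (i, j) * g $$ (b, j) = (if i = a \<and> j = b then B $$ (a, b) else 0)"
        proof cases
          case 1 then show ?thesis using gd(3) d by simp
        next
          case 2 then show ?thesis using gd(2)[of j b] stabD(3)[OF g, of j] d by auto
        next
          case 3 then show ?thesis using \<open>root_cond a b B\<close> ij by (auto simp: root_cond_def)
        next
          case 4 then show ?thesis using stabD(2)[OF g, of i] by simp
        next
          case 5
          then have "B $$ (b, i) = 0" using \<open>root_cond a b B\<close> ij by (auto simp: root_cond_def)
          then show ?thesis using Bd(2)[of b i] 5 d ij by simp
        next
          case 6 then show ?thesis using stabD(3)[OF g, of j] by simp
        next
          case 7 then show ?thesis using Bd(3)[of i j] ij by simp
        qed
      qed
      also have "\<dots> = (\<Sum>i<m. if i = a then B $$ (a, b) else 0)"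
        using d by (intro sum.cong refl) auto
      finally show ?thesis using d by simp
    qed
    then show ?thesis using 1 by simp
  next
    case 2
    \<comment> \<open>The last column that violates the condition: with nothing to its right,
      congruence by \<open>stab a b\<close> leaves the entry \<open>(a, k)\<close> unchanged, which
      makes the effect of the elementary matrix uniform in \<open>g\<close>.\<close>
    define K where "K = {c. b < c \<and> m - n \<le> c \<and> c < m \<and> B $$ (a, c) \<noteq> 0}"
    have K: "finite K" "K \<noteq> {}" using 2 by (auto simp: K_def)
    define k where "k = Max K"
    have k: "b < k" "m - n \<le> k" "k < m" "B $$ (a, k) \<noteq> 0" using Max_in[OF K] by (auto simp: k_def K_def)
    have kmax: "B $$ (a, j) = 0" if "k < j" "j < m" for j
    proof (rule ccontr)
      assume "\<not> ?thesis"
      then have "j \<in> K" using that k by (simp add: K_def)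
      then show False using Max_ge[OF K(1), of j] that by (simp add: k_def)
    qed
    have val: "(g * B * g\<^sup>T) $$ (a, k) = B $$ (a, k)" if g: "g \<in> stab a b" for g
    proof -
      note gd = unitriangularD[OF stabD(1)[OF g]]
      have "(g * B * g\<^sup>T) $$ (a, k) = (\<Sum>i<m. \<Sum>j<m. g $$ (a, i) * B $$ (i, j) * g $$ (k, j))"
        by (rule congruence_index[OF gd(1) Bd(1) d(3) k(3)])
      also have "\<dots> = (\<Sum>i<m. \<Sum>j<m. if i = a \<and> j = k then B $$ (a, k) else 0)"
      proof (intro sum.cong refl)
        fix i j assume ij: "i \<in> {..<m}" "j \<in> {..<m}"
        consider "i = a" "j = k" | "j < k" | "i = a" "k < j" | "i \<noteq> a" "i < n" | "i \<noteq> a" "n \<le> i" "k \<le> j" by linarith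
        then show "g $$ (a, i) * B $$ (i, j) * g $$ (k, j) = (if i = a \<and> j = k then B $$ (a, k) else 0)"
        proof cases
          case 1 then show ?thesis using gd(3) d k by simp
        next
          case 2 then show ?thesis using gd(2)[of j k] k by simp
        next
          case 3 then show ?thesis using kmax[of j] ij by simp
        next
          case 4 then show ?thesis using stabD(2)[OF g, of i] by simp
        next
          case 5 then show ?thesis using Bd(3)[of i j] ij k by simp
        qed
      qed
      also have "\<dots> = (\<Sum>i<m. if i = a then B $$ (a, k) else 0)"
        using k by (intro sum.cong refl) auto
      finally show ?thesis using d by simp
    qed
    have "\<not> root_cond a b B" using k by (auto simp: root_cond_def)
    moreover have "(\<Sum>g\<in>stab a b. \<theta> (c * (g * B * g\<^sup>T) $$ (a, b))) = 0"
    proof (rule twist[OF k(1,3)])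
      show "elem b k x \<in> stab a b" for x
        unfolding stab_def using elem_T[OF k(1)] d k mn by (auto simp: elem_def m_eq)
      \<comment> \<open>On the diagonal the row and the column operation both hit the entry
        \<open>(a, b)\<close>, which doubles the effect; the quadratic term carries the entry
        \<open>(k, k)\<close> and vanishes.\<close>
      show "(if a = b then 2 else 1) * B $$ (a, k) \<noteq> 0" using k two by simp
      fix g x assume g: "g \<in> stab a b"
      define C where "C = g * B * g\<^sup>T"
      have C: "C \<in> forms" unfolding C_def by (rule congruence_forms[OF stabD(1)[OF g] B])
      note Cd = formsD[OF C]
      have "(elem b k x * C * (elem b k x)\<^sup>T) $$ (a, b) = C $$ (a, b) + (if a = b then x * C $$ (k, b) else 0) +
        x * (C $$ (a, k) + (if a = b then x * C $$ (k, k) else 0))"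
        using elem_congruence[OF k(1,3) Cd(1) d(3,4), of x] by simp
      also have "\<dots> = C $$ (a, b) + x * ((if a = b then 2 else 1) * C $$ (a, k))"
      proof (cases "a = b")
        case True
        have "\<sigma> = -1" using d(6)[OF True] by blast
        then have "C $$ (k, b) = C $$ (a, k)" using Cd(2)[OF d(3) k(3)] True by simp
        moreover have "C $$ (k, k) = 0" using Cd(3)[OF k(3,3)] k d(6)[OF True] by auto
        ultimately show ?thesis using True by (simp add: algebra_simps)
      qed simp
      finally show "(elem b k x * (g * B * g\<^sup>T) * (elem b k x)\<^sup>T) $$ (a, b) =
          (g * B * g\<^sup>T) $$ (a, b) + x * ((if a = b then 2 else 1) * B $$ (a, k))"
        using val[OF g] unfolding C_def by simp
    qed
    ultimately show ?thesis by simp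
  next
    case 3
    \<comment> \<open>As before, with row \<open>b\<close> in place of row \<open>a\<close>; now the
      twist adds row \<open>k\<close> to row \<open>a\<close> instead of row
      \<open>b\<close>.\<close>
    define K where "K = {d. n \<le> d \<and> d < m \<and> B $$ (b, d) \<noteq> 0}"
    have K: "finite K" "K \<noteq> {}" using 3 by (auto simp: K_def)
    define k where "k = Max K"
    have k: "n \<le> k" "k < m" "B $$ (b, k) \<noteq> 0" using Max_in[OF K] by (auto simp: k_def K_def)
    have ak: "a < k" using k d by simp
    have kmax: "B $$ (b, j) = 0" if "k < j" "j < m" for j
    proof (rule ccontr)
      assume "\<not> ?thesis"
      then have "j \<in> K" using that k by (simp add: K_def)
      then show False using Max_ge[OF K(1), of j] that by (simp add: k_def)
    qed
    have val: "(g * B * g\<^sup>T) $$ (k, b) = B $$ (k, b)" if g: "g \<in> stab a b" for g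
    proof -
      note gd = unitriangularD[OF stabD(1)[OF g]]
      have "(g * B * g\<^sup>T) $$ (k, b) = (\<Sum>i<m. \<Sum>j<m. g $$ (k, i) * B $$ (i, j) * g $$ (b, j))"
        by (rule congruence_index[OF gd(1) Bd(1) k(2) d(4)])
      also have "\<dots> = (\<Sum>i<m. \<Sum>j<m. if i = k \<and> j = b then B $$ (k, b) else 0)"
      proof (intro sum.cong refl)
        fix i j assume ij: "i \<in> {..<m}" "j \<in> {..<m}"
        consider "i = k" "j = b" | "i < k" | "k < i" "j = b" | "j \<noteq> b" "j < m - n" | "j \<noteq> b" "m - n \<le> j" "k \<le> i" by linarith
        then show "g $$ (k, i) * B $$ (i, j) * g $$ (b, j) = (if i = k \<and> j = b then B $$ (k, b) else 0)"
        proof cases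
          case 1 then show ?thesis using gd(3) d k by simp
        next
          case 2 then show ?thesis using gd(2)[of i k] k by simp
        next
          case 3 then show ?thesis using kmax[of i] Bd(2)[of b i] ij d by simp
        next
          case 4 then show ?thesis using stabD(3)[OF g, of j] by simp
        next
          case 5 then show ?thesis using Bd(3)[of i j] ij k by simp
        qed
      qed
      also have "\<dots> = (\<Sum>i<m. if i = k then B $$ (k, b) else 0)"
        using d by (intro sum.cong refl) auto
      finally show ?thesis using k by simp
    qed
    have "\<not> root_cond a b B" using k by (auto simp: root_cond_def)
    moreover have "(\<Sum>g\<in>stab a b. \<theta> (c * (g * B * g\<^sup>T) $$ (a, b))) = 0"
    proof (rule twist[OF ak k(2)])
      show "elem a k x \<in> stab a b" for x
        unfolding stab_def using elem_T[OF ak] d k 3(1) by (auto simp: elem_def m_eq)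
      show "B $$ (k, b) \<noteq> 0" using k Bd(2)[OF d(4) k(2)] \<sigma>2 by simp
      fix g x assume g: "g \<in> stab a b"
      have C: "g * B * g\<^sup>T \<in> carrier_mat m m" using congruence_forms[OF stabD(1)[OF g] B] by (rule formsD(1))
      show "(elem a k x * (g * B * g\<^sup>T) * (elem a k x)\<^sup>T) $$ (a, b) = (g * B * g\<^sup>T) $$ (a, b) + x * B $$ (k, b)"
        using elem_congruence[OF ak k(2) C d(3,4), of x] 3(1) val[OF g] by simp
    qed
    ultimately show ?thesis by simp
  qed
qed

text \<open>Every \<open>g\<close> in \<open>T\<close> is \<open>h * k\<close> with \<open>h\<close>
  in \<open>stab a b\<close> and \<open>k\<close> in \<open>U\<close>, by matching rows. Since both
  sets are closed under products, the double sum of \<open>\<psi> (h * g * k)\<close> is the same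
  for all \<open>g\<close>, and averaging over \<open>g\<close> turns it into a sum over
  \<open>T\<close>.\<close>

lemma stab_U_sum:
  fixes \<psi> :: "'a mat \<Rightarrow> complex"
  assumes ab: "(a, b) \<in> root_pairs"
  shows "of_nat (card T) * (\<Sum>g\<in>stab a b. \<Sum>k\<in>U. \<psi> (g * k)) =
    of_nat (card (stab a b)) * of_nat (card U) * (\<Sum>g\<in>T. \<psi> g)"
proof -
  note d = root_pairsD[OF ab]
  have sub: "stab a b \<subseteq> T" "U \<subseteq> T" using U_isometries by (auto simp: stab_def isometries_def)
  have fact: "\<exists>h\<in>stab a b. \<exists>k\<in>U. g = h * k" if g: "g \<in> T" for g
  proof -
    obtain k where k: "k \<in> U" "\<And>i j. i < n \<Longrightarrow> j < m - n \<Longrightarrow> k $$ (i, j) = g $$ (i, j)"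
      using match_rows[OF g] by blast
    obtain l where l: "l \<in> T" "k * l = 1\<^sub>m m" "l * k = 1\<^sub>m m" using unitriangular_inverse k(1) sub by blast
    have kT: "k \<in> T" using k(1) sub by blast
    note c = unitriangularD(1)[OF g] unitriangularD(1)[OF l(1)] unitriangularD(1)[OF kT]
    have row: "(g * l) $$ (i, j) = (if i = j then 1 else 0)" if "i < n" "j < m - n" for i j
    proof -
      have ij: "i < m" "j < m" using that by (auto simp: m_eq)
      have "(g * l) $$ (i, j) = (\<Sum>x<m. k $$ (i, x) * l $$ (x, j))"
        unfolding mult_mat_index[OF c(1,2) ij]
      proof (intro sum.cong refl)
        fix x assume "x \<in> {..<m}"
        then show "g $$ (i, x) * l $$ (x, j) = k $$ (i, x) * l $$ (x, j)"
          using unitriangularD(2)[OF l(1), of j x] k(2)[of i x] that by (cases "j < x") auto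
      qed
      also have "\<dots> = (k * l) $$ (i, j)" using mult_mat_index[OF c(3,2) ij] by simp
      finally show ?thesis using l ij by simp
    qed
    have T': "g * l \<in> T" by (rule unitriangular_mult[OF g l(1)])
    have "g * l \<in> stab a b"
      unfolding stab_def
    proof (intro CollectI conjI allI impI)
      fix k assume "k < n" "k \<noteq> a"
      then show "(g * l) $$ (a, k) = 0" using row[of a k] d by (simp add: mn)
    next
      fix j assume j: "j < m - n" "j \<noteq> b"
      show "(g * l) $$ (b, j) = 0"
      proof (cases "b < n")
        case True then show ?thesis using row[of b j] j by simp
      next
        case False
        then have "j < b" using j r_le by (simp add: mn)
        then show ?thesis using unitriangularD(2)[OF T', of j b] d by simp
      qed
    qed (rule T')
    moreover have "g = g * l * k" using assoc_mult_mat[OF c] l(3) c by simp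
    ultimately show ?thesis using k(1) by blast
  qed
  have mid: "(\<Sum>h\<in>stab a b. \<Sum>k\<in>U. \<psi> (h * g * k)) = (\<Sum>h\<in>stab a b. \<Sum>k\<in>U. \<psi> (h * k))" if g: "g \<in> T" for g
  proof -
    obtain h0 k0 where hk: "h0 \<in> stab a b" "k0 \<in> U" "g = h0 * k0" using fact[OF g] by blast
    have c0: "h0 \<in> carrier_mat m m" "k0 \<in> carrier_mat m m" using hk sub unitriangularD(1) by blast+
    have Uc: "k \<in> U \<Longrightarrow> k0 * k \<in> U" for k using isometries_mult hk(2) unfolding U_isometries by blast
    have "(\<Sum>h\<in>stab a b. \<Sum>k\<in>U. \<psi> (h * g * k)) = (\<Sum>h\<in>stab a b. \<Sum>k\<in>U. \<psi> (h * h0 * (k0 * k)))"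
    proof (intro sum.cong refl)
      fix h k assume hk': "h \<in> stab a b" "k \<in> U"
      have c: "h \<in> carrier_mat m m" "k \<in> carrier_mat m m" using hk' sub unitriangularD(1) by blast+
      show "\<psi> (h * g * k) = \<psi> (h * h0 * (k0 * k))"
        unfolding hk(3) using c c0 by (simp add: assoc mult_carrier_mat[of _ m m _ m])
    qed
    also have "\<dots> = (\<Sum>h\<in>stab a b. \<Sum>k\<in>U. \<psi> (h * h0 * k))"
      using sub(2) hk(2) Uc by (intro sum.cong refl translate_sum) auto
    also have "\<dots> = (\<Sum>h\<in>stab a b. \<Sum>k\<in>U. \<psi> (h * k))"
      using sub hk(1) stab_mult[OF d(3,4) _ hk(1)]
      by (intro translate_sum_right[of _ _ "\<lambda>h. \<Sum>k\<in>U. \<psi> (h * k)"]) auto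
    finally show ?thesis .
  qed
  have "of_nat (card T) * (\<Sum>g\<in>stab a b. \<Sum>k\<in>U. \<psi> (g * k)) = (\<Sum>g\<in>T. \<Sum>h\<in>stab a b. \<Sum>k\<in>U. \<psi> (h * g * k))"
    using mid by simp
  also have "\<dots> = (\<Sum>h\<in>stab a b. \<Sum>g\<in>T. \<Sum>k\<in>U. \<psi> (h * g * k))" by (rule sum.swap)
  also have "\<dots> = (\<Sum>h\<in>stab a b. \<Sum>k\<in>U. \<Sum>g\<in>T. \<psi> (h * g * k))" by (intro sum.cong refl sum.swap)
  also have "\<dots> = (\<Sum>h\<in>stab a b. \<Sum>k\<in>U. \<Sum>g\<in>T. \<psi> g)"
  proof (rule sum.cong[OF refl], rule sum.cong[OF refl])
    fix h k assume hk: "h \<in> stab a b" "k \<in> U"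
    then have hkT: "h \<in> T" "k \<in> T" using sub by auto
    have "(\<Sum>g\<in>T. \<psi> (h * g * k)) = (\<Sum>g\<in>T. \<psi> (g * k))"
      by (rule translate_sum[of T h "\<lambda>g. \<psi> (g * k)"]) (use hkT unitriangular_mult in auto)
    also have "\<dots> = (\<Sum>g\<in>T. \<psi> g)"
      by (rule translate_sum_right) (use hkT unitriangular_mult in auto)
    finally show "(\<Sum>g\<in>T. \<psi> (h * g * k)) = (\<Sum>g\<in>T. \<psi> g)" .
  qed
  finally show ?thesis by simp
qed

text \<open>The double sum over \<open>stab a b\<close> and \<open>U\<close> in two ways:
  \<open>stab_sum\<close> evaluates the part over \<open>stab a b\<close>, and
  \<open>stab_U_sum\<close> collapses everything to \<open>T\<close>. The left side is an induced
  character in disguise; the right side carries no condition.\<close>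

lemma root_sum:
  assumes ab: "(a, b) \<in> root_pairs" and B: "B \<in> forms" and c: "c \<noteq> 0"
  shows "of_nat (card T) * (\<Sum>k\<in>U. if root_cond a b (k * B * k\<^sup>T) then \<theta> (c * (k * B * k\<^sup>T) $$ (a, b)) else 0) =
    of_nat (card U) * (\<Sum>g\<in>T. \<theta> (c * (g * B * g\<^sup>T) $$ (a, b)))"
proof -
  note d = root_pairsD[OF ab]
  define \<psi> where "\<psi> g = \<theta> (c * (g * B * g\<^sup>T) $$ (a, b))" for g
  define F where "F k = (if root_cond a b (k * B * k\<^sup>T) then \<theta> (c * (k * B * k\<^sup>T) $$ (a, b)) else 0)" for k
  have UT: "U \<subseteq> T" using U_isometries by (auto simp: isometries_def)
  have st: "stab a b \<subseteq> T" by (auto simp: stab_def)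
  have "card (stab a b) > 0" using card_pos[OF st] stab_one[OF d(3,4)] by blast
  then have S0: "(of_nat (card (stab a b)) :: complex) \<noteq> 0" by simp
  have "(\<Sum>g\<in>stab a b. \<Sum>k\<in>U. \<psi> (g * k)) = (\<Sum>k\<in>U. \<Sum>g\<in>stab a b. \<psi> (g * k))" by (rule sum.swap)
  also have "\<dots> = (\<Sum>k\<in>U. of_nat (card (stab a b)) * F k)"
  proof (intro sum.cong refl)
    fix k assume k: "k \<in> U"
    then have kT: "k \<in> T" using UT by blast
    have "(\<Sum>g\<in>stab a b. \<psi> (g * k)) = (\<Sum>g\<in>stab a b. \<theta> (c * (g * (k * B * k\<^sup>T) * g\<^sup>T) $$ (a, b)))"
    proof (intro sum.cong refl)
      fix g assume "g \<in> stab a b"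
      then have "g \<in> carrier_mat m m" using st unitriangularD(1) by blast
      then show "\<psi> (g * k) = \<theta> (c * (g * (k * B * k\<^sup>T) * g\<^sup>T) $$ (a, b))"
        unfolding \<psi>_def using congruence_mult[OF _ unitriangularD(1)[OF kT] formsD(1)[OF B]] by simp
    qed
    also have "\<dots> = of_nat (card (stab a b)) * F k"
      unfolding F_def using stab_sum[OF ab congruence_forms[OF kT B] c] by simp
    finally show "(\<Sum>g\<in>stab a b. \<psi> (g * k)) = of_nat (card (stab a b)) * F k" .
  qed
  also have "\<dots> = of_nat (card (stab a b)) * (\<Sum>k\<in>U. F k)" by (simp add: sum_distrib_left)
  finally have "of_nat (card T) * (of_nat (card (stab a b)) * (\<Sum>k\<in>U. F k)) =
    of_nat (card (stab a b)) * of_nat (card U) * (\<Sum>g\<in>T. \<psi> g)"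
    using stab_U_sum[OF ab, of \<psi>] by simp
  then have "of_nat (card (stab a b)) * (of_nat (card T) * (\<Sum>k\<in>U. F k)) =
    of_nat (card (stab a b)) * (of_nat (card U) * (\<Sum>g\<in>T. \<psi> g))" by (simp only: ac_simps)
  then show ?thesis using S0 unfolding F_def \<psi>_def mult_cancel_left by blast
qed

section \<open>Induction from root subgroups\<close>

abbreviation G where "G \<equiv> (unipotent_group t n :: 'a mat monoid)"

lemma G_simps: "carrier G = U" "mult G = (*)" "one G = 1\<^sub>m m"
  by (simp_all add: unipotent_group_def)

lemma U_T: "u \<in> U \<Longrightarrow> u \<in> T"
  using U_isometries by (auto simp: isometries_def)

lemma U_carrier: "u \<in> U \<Longrightarrow> u \<in> carrier_mat m m"
  using U_T unitriangularD(1) by blast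

lemma finite_U: "finite U"
  using finite_T U_T by (meson finite_subset subsetI)

lemma group_G: "group G"
proof (rule groupI)
  fix x assume "x \<in> carrier G"
  then have x: "x \<in> isometries" unfolding G_simps U_isometries .
  then obtain y where "y \<in> isometries" "y * x = 1\<^sub>m m" using isometry_inverse[OF x] by blast
  then show "\<exists>y\<in>carrier G. y \<otimes>\<^bsub>G\<^esub> x = \<one>\<^bsub>G\<^esub>"
    unfolding G_simps U_isometries by blast
qed (use isometries_mult isometries_one in \<open>auto simp: G_simps U_isometries assoc dest!: isometriesD(2)\<close>)

lemma inv_G:
  assumes "u \<in> U"
  shows "inv\<^bsub>G\<^esub> u \<in> U" "inv\<^bsub>G\<^esub> u * u = 1\<^sub>m m" "u * inv\<^bsub>G\<^esub> u = 1\<^sub>m m"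
  using group.inv_closed[OF group_G, of u] group.l_inv[OF group_G, of u] group.r_inv[OF group_G, of u] assms
  by (simp_all add: G_simps)

lemma inverse_index:
  assumes u: "u \<in> U" and l: "l < m" and c: "c < m"
  shows "(inv\<^bsub>G\<^esub> u) $$ (l, c) = s l * s c * u $$ (m - 1 - c, m - 1 - l)"
proof -
  obtain u' where u': "u' \<in> isometries" "u' * u = 1\<^sub>m m" "form * u\<^sup>T = u' * form"
    using isometry_inverse u unfolding U_isometries by blast
  have c': "u \<in> carrier_mat m m" "u' \<in> carrier_mat m m" using U_carrier[OF u] isometriesD(2)[OF u'(1)] by auto
  have "inv\<^bsub>G\<^esub> u = u'"
    using group.inv_equality[OF group_G, of u' u] u u'(1,2) unfolding G_simps U_isometries by simp
  moreover have "(form * u\<^sup>T) $$ (l, m - 1 - c) = s l * u $$ (m - 1 - c, m - 1 - l)"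
    using form_mult[of "u\<^sup>T" l "m - 1 - c"] c' l c by simp
  moreover have "(u' * form) $$ (l, m - 1 - c) = u' $$ (l, c) * s c"
    using mult_form[OF c'(2) l, of "m - 1 - c"] c by simp
  ultimately have "(inv\<^bsub>G\<^esub> u) $$ (l, c) * s c = s l * u $$ (m - 1 - c, m - 1 - l)" using u'(3) by simp
  then have "(inv\<^bsub>G\<^esub> u) $$ (l, c) * (s c * s c) = s l * s c * u $$ (m - 1 - c, m - 1 - l)"
    by (simp add: algebra_simps)
  then show ?thesis by (simp add: s2)
qed

lemma bil_inverse_index:
  assumes u: "u \<in> U" and k: "k < m" and l: "l < m"
  shows "bil u $$ (k, l) = (u $$ (k, m - 1 - l) - (inv\<^bsub>G\<^esub> u) $$ (k, m - 1 - l)) * s (m - 1 - l) / 2"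
proof -
  have "(inv\<^bsub>G\<^esub> u) $$ (k, m - 1 - l) * s (m - 1 - l) = s k * u $$ (l, m - 1 - k) * (s (m - 1 - l) * s (m - 1 - l))"
    using inverse_index[OF u k, of "m - 1 - l"] l by simp
  then have "(inv\<^bsub>G\<^esub> u) $$ (k, m - 1 - l) * s (m - 1 - l) = s k * u $$ (l, m - 1 - k)" by (simp add: s2)
  then show ?thesis unfolding bil_index[OF U_carrier[OF u] k l] by (simp add: left_diff_distrib)
qed

lemma bil_inverse:
  assumes u: "u \<in> U"
  shows "bil (inv\<^bsub>G\<^esub> u) = - bil u"
proof (rule eq_matI)
  note u' = inv_G(1)[OF u]
  have uu: "inv\<^bsub>G\<^esub> (inv\<^bsub>G\<^esub> u) = u" using group.inv_inv[OF group_G] u by (simp add: G_simps)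
  have c: "bil u \<in> carrier_mat m m" using U_carrier[OF u] by simp
  fix i j assume "i < dim_row (- bil u)" "j < dim_col (- bil u)"
  then have ij: "i < m" "j < m" using c by auto
  show "bil (inv\<^bsub>G\<^esub> u) $$ (i, j) = (- bil u) $$ (i, j)"
    unfolding index_uminus_mat(1)[of i "bil u" j, unfolded carrier_matD[OF c], OF ij]
      bil_inverse_index[OF u ij] bil_inverse_index[OF u' ij] uu
    by (metis minus_diff_eq minus_divide_left minus_mult_left)
qed (use bil_carrier[OF U_carrier[OF u]] bil_carrier[OF U_carrier[OF inv_G(1)[OF u]]] in auto)

lemma inverse_row:
  assumes u: "u \<in> U" and k: "i < k" "k < m" and z: "\<And>l. i < l \<Longrightarrow> l < k \<Longrightarrow> u $$ (i, l) * (inv\<^bsub>G\<^esub> u) $$ (l, k) = 0"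
  shows "(inv\<^bsub>G\<^esub> u) $$ (i, k) = - u $$ (i, k)"
proof -
  let ?v = "inv\<^bsub>G\<^esub> u"
  note ud = unitriangularD[OF U_T[OF u]] and vd = unitriangularD[OF U_T[OF inv_G(1)[OF u]]]
  have i: "i < m" using k by simp
  have "0 = (u * ?v) $$ (i, k)" using inv_G(3)[OF u] i k by simp
  also have "\<dots> = (\<Sum>l<m. u $$ (i, l) * ?v $$ (l, k))" by (rule mult_mat_index[OF ud(1) vd(1) i k(2)])
  also have "\<dots> = (\<Sum>l<m. (if l = i then ?v $$ (i, k) else 0) + (if l = k then u $$ (i, k) else 0))"
  proof (intro sum.cong refl)
    fix l assume l: "l \<in> {..<m}"
    consider "l < i" | "l = i" | "i < l" "l < k" | "l = k" | "k < l" by linarith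
    then show "u $$ (i, l) * ?v $$ (l, k) = (if l = i then ?v $$ (i, k) else 0) + (if l = k then u $$ (i, k) else 0)"
      by cases (use ud(2)[of l i] vd(2)[of k l] ud(3)[of i] vd(3)[of k] z[of l] k i l in auto)
  qed
  also have "\<dots> = ?v $$ (i, k) + u $$ (i, k)" using i k by (simp add: sum.distrib)
  finally show ?thesis by (simp add: eq_neg_iff_add_eq_0)
qed

text \<open>The root subgroups in terms of positions, uniformly in the kind of root. For
  \<open>Minus\<close> the effective bound is \<open>m - 1 - b\<close> and the second condition is
  empty; otherwise the bound is \<open>n\<close>, and the second condition is new only for
  \<open>Plus\<close>.\<close>

definition H :: "nat \<Rightarrow> nat \<Rightarrow> 'a mat set" where
  "H a b = {x \<in> U. (\<forall>k. a < k \<and> k < n \<and> k < m - 1 - b \<longrightarrow> x $$ (a, k) = 0) \<and>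
     (\<forall>l. b < l \<and> l < m - n \<longrightarrow> x $$ (b, l) = 0)}"

lemma HD:
  assumes "x \<in> H a b"
  shows "x \<in> U" "\<And>k. a < k \<Longrightarrow> k < n \<Longrightarrow> k < m - 1 - b \<Longrightarrow> x $$ (a, k) = 0"
    "\<And>l. b < l \<Longrightarrow> l < m - n \<Longrightarrow> x $$ (b, l) = 0"
  using assms by (auto simp: H_def)

text \<open>\<open>bil\<close> only sees the difference of \<open>u\<close> and its inverse. The
  first nonzero entry to the right of the diagonal appears in the inverse with the opposite sign, so
  agreement up to column \<open>K\<close> forces it to be zero, as \<open>2\<close> is
  invertible.\<close>

lemma row_vanishes_iff:
  assumes u: "u \<in> U" and i: "i < m" and K: "K \<le> m"
  shows "(\<forall>k. i < k \<and> k < K \<longrightarrow> u $$ (i, k) = 0) \<longleftrightarrow> (\<forall>k<K. u $$ (i, k) = (inv\<^bsub>G\<^esub> u) $$ (i, k))"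
proof -
  let ?v = "inv\<^bsub>G\<^esub> u"
  note ud = unitriangularD[OF U_T[OF u]] and vd = unitriangularD[OF U_T[OF inv_G(1)[OF u]]]
  show ?thesis
  proof (intro iffI allI impI)
    fix k assume h: "\<forall>k. i < k \<and> k < K \<longrightarrow> u $$ (i, k) = 0" and k: "k < K"
    show "u $$ (i, k) = ?v $$ (i, k)"
    proof (cases "i < k")
      case True
      have "?v $$ (i, k) = - u $$ (i, k)"
        by (rule inverse_row[OF u True]) (use h k K in auto)
      then show ?thesis using h True k by simp
    next
      case False
      then show ?thesis using ud(2)[of k i] vd(2)[of k i] ud(3)[of i] vd(3)[of i] i by (cases "k = i") auto
    qed
  next
    fix k assume h: "\<forall>k<K. u $$ (i, k) = ?v $$ (i, k)" and k: "i < k \<and> k < K"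
    from k show "u $$ (i, k) = 0"
    proof (induction k rule: less_induct)
      case (less k)
      have "?v $$ (i, k) = - u $$ (i, k)"
        by (rule inverse_row[OF u]) (use less K in auto)
      then have "2 * u $$ (i, k) = 0" using h less.prems by (simp add: eq_neg_iff_add_eq_0)
      then show ?case using two by simp
    qed
  qed
qed

text \<open>Column \<open>c\<close> of \<open>bil u\<close> is, up to a unit, column
  \<open>m - 1 - c\<close> of the difference of \<open>u\<close> and its inverse. So the lower
  bounds in \<open>root_cond\<close> become upper bounds on columns, and
  \<open>row_vanishes_iff\<close> passes from the difference to \<open>u\<close>.\<close>

lemma H_root_cond:
  assumes u: "u \<in> U" and ab: "(a, b) \<in> root_pairs"
  shows "u \<in> H a b \<longleftrightarrow> root_cond a b (bil u)"
proof -
  note d = root_pairsD[OF ab]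
  let ?v = "inv\<^bsub>G\<^esub> u"
  have eq: "bil u $$ (k, l) = 0 \<longleftrightarrow> u $$ (k, m - 1 - l) = ?v $$ (k, m - 1 - l)" if "k < m" "l < m" for k l
    unfolding bil_inverse_index[OF u that] using two s2 by simp
  have "(\<forall>c. b < c \<and> m - n \<le> c \<and> c < m \<longrightarrow> bil u $$ (a, c) = 0) \<longleftrightarrow>
    (\<forall>k<min n (m - 1 - b). u $$ (a, k) = ?v $$ (a, k))"
  proof (intro iffI allI impI)
    fix k assume h: "\<forall>c. b < c \<and> m - n \<le> c \<and> c < m \<longrightarrow> bil u $$ (a, c) = 0" and k: "k < min n (m - 1 - b)"
    have "b < m - 1 - k \<and> m - n \<le> m - 1 - k \<and> m - 1 - k < m" using k d by auto
    then have "bil u $$ (a, m - 1 - k) = 0" using h by blast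
    then show "u $$ (a, k) = ?v $$ (a, k)" using eq[of a "m - 1 - k"] d k by simp
  next
    fix c assume h: "\<forall>k<min n (m - 1 - b). u $$ (a, k) = ?v $$ (a, k)" and c: "b < c \<and> m - n \<le> c \<and> c < m"
    then have "m - 1 - c < min n (m - 1 - b)" by auto
    then show "bil u $$ (a, c) = 0" using eq[of a c] d h c by blast
  qed
  also have "\<dots> \<longleftrightarrow> (\<forall>k. a < k \<and> k < min n (m - 1 - b) \<longrightarrow> u $$ (a, k) = 0)"
    by (rule row_vanishes_iff[OF u d(3), symmetric]) (use d in auto)
  finally have 1: "(\<forall>c. b < c \<and> m - n \<le> c \<and> c < m \<longrightarrow> bil u $$ (a, c) = 0) \<longleftrightarrow>
    (\<forall>k. a < k \<and> k < n \<and> k < m - 1 - b \<longrightarrow> u $$ (a, k) = 0)" by auto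
  have "(\<forall>c. n \<le> c \<and> c < m \<longrightarrow> bil u $$ (b, c) = 0) \<longleftrightarrow> (\<forall>k<m - n. u $$ (b, k) = ?v $$ (b, k))"
  proof (intro iffI allI impI)
    fix k assume h: "\<forall>c. n \<le> c \<and> c < m \<longrightarrow> bil u $$ (b, c) = 0" and k: "k < m - n"
    then have "bil u $$ (b, m - 1 - k) = 0" by auto
    then show "u $$ (b, k) = ?v $$ (b, k)" using eq[of b "m - 1 - k"] d k by simp
  next
    fix c assume h: "\<forall>k<m - n. u $$ (b, k) = ?v $$ (b, k)" and c: "n \<le> c \<and> c < m"
    then have "m - 1 - c < m - n" by auto
    then show "bil u $$ (b, c) = 0" using eq[of b c] d h c by blast
  qed
  also have "\<dots> \<longleftrightarrow> (\<forall>l. b < l \<and> l < m - n \<longrightarrow> u $$ (b, l) = 0)"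
    by (rule row_vanishes_iff[OF u d(4), symmetric]) auto
  finally have 2: "(\<forall>c. n \<le> c \<and> c < m \<longrightarrow> bil u $$ (b, c) = 0) \<longleftrightarrow> (\<forall>l. b < l \<and> l < m - n \<longrightarrow> u $$ (b, l) = 0)" .
  show ?thesis unfolding H_def root_cond_def 1 2 using u by blast
qed

lemma H_inv:
  assumes x: "x \<in> H a b" and ab: "(a, b) \<in> root_pairs"
  shows "inv\<^bsub>G\<^esub> x \<in> H a b"
proof -
  have "root_cond a b (bil x)" using H_root_cond[OF HD(1)[OF x] ab] x by blast
  then have "root_cond a b (- bil x)"
    using root_pairsD(3,4)[OF ab] carrier_matD[OF bil_carrier[OF U_carrier[OF HD(1)[OF x]]]]
    unfolding root_cond_def by auto
  then show ?thesis
    using H_root_cond[OF inv_G(1)[OF HD(1)[OF x]] ab] bil_inverse[OF HD(1)[OF x]] by simp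
qed

lemma H_inverse_column:
  assumes x: "x \<in> H a b" and ab: "(a, b) \<in> root_pairs" and l: "n \<le> l" "l < m - 1 - b"
  shows "(inv\<^bsub>G\<^esub> x) $$ (l, m - 1 - b) = 0"
proof -
  have "x $$ (b, m - 1 - l) = 0" using HD(3)[OF x, of "m - 1 - l"] l by auto
  then show ?thesis
    using inverse_index[OF HD(1)[OF x], of l "m - 1 - b"] l root_pairsD[OF ab] by simp
qed

text \<open>At the root position the inverse has exactly the negated entry. The intermediate terms
  of \<open>x\<close> times its inverse vanish there, by the first condition in \<open>H\<close> for
  \<open>l < n\<close>, and by the second one, read through \<open>inverse_index\<close>, for
  \<open>l \<ge> n\<close>. So half the difference is the entry itself.\<close>

lemma H_entry:
  assumes x: "x \<in> H a b" and ab: "(a, b) \<in> root_pairs"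
  shows "x $$ (a, m - 1 - b) = s (m - 1 - b) * bil x $$ (a, b)"
proof -
  note d = root_pairsD[OF ab] and xU = HD(1)[OF x]
  have "(inv\<^bsub>G\<^esub> x) $$ (a, m - 1 - b) = - x $$ (a, m - 1 - b)"
  proof (rule inverse_row[OF xU])
    fix l assume l: "a < l" "l < m - 1 - b"
    show "x $$ (a, l) * (inv\<^bsub>G\<^esub> x) $$ (l, m - 1 - b) = 0"
      using HD(2)[OF x, of l] H_inverse_column[OF x ab, of l] l by (cases "l < n") auto
  qed (use d in auto)
  then have "bil x $$ (a, b) = x $$ (a, m - 1 - b) * s (m - 1 - b)"
    using bil_inverse_index[OF xU d(3,4)] two by (simp add: field_simps)
  then have "s (m - 1 - b) * bil x $$ (a, b) = x $$ (a, m - 1 - b) * (s (m - 1 - b) * s (m - 1 - b))"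
    by (simp only: ac_simps)
  then show ?thesis by (simp add: s2)
qed

lemma H_mult:
  assumes x: "x \<in> H a b" and y: "y \<in> H a b" and ab: "(a, b) \<in> root_pairs"
  shows "x * y \<in> H a b" "(x * y) $$ (a, m - 1 - b) = x $$ (a, m - 1 - b) + y $$ (a, m - 1 - b)"
proof -
  note d = root_pairsD[OF ab]
  note xd = unitriangularD[OF U_T[OF HD(1)[OF x]]] and yd = unitriangularD[OF U_T[OF HD(1)[OF y]]]
  have entry: "(x * y) $$ (i, k) = x $$ (i, k) + y $$ (i, k)"
    if ik: "i < k" "k < m" and z: "\<And>l. i < l \<Longrightarrow> l < k \<Longrightarrow> x $$ (i, l) * y $$ (l, k) = 0" for i k
  proof -
    have i: "i < m" using ik by simp
    have "(x * y) $$ (i, k) = (\<Sum>l<m. (if l = i then y $$ (i, k) else 0) + (if l = k then x $$ (i, k) else 0))"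
      unfolding mult_mat_index[OF xd(1) yd(1) i ik(2)]
    proof (intro sum.cong refl)
      fix l assume l: "l \<in> {..<m}"
      consider "l < i" | "l = i" | "i < l" "l < k" | "l = k" | "k < l" by linarith
      then show "x $$ (i, l) * y $$ (l, k) = (if l = i then y $$ (i, k) else 0) + (if l = k then x $$ (i, k) else 0)"
        by cases (use xd(2)[of l i] yd(2)[of k l] xd(3)[of i] yd(3)[of k] z[of l] ik i l in auto)
    qed
    then show ?thesis using i ik by (simp add: sum.distrib)
  qed
  have "x * y \<in> U"
    using isometries_mult HD(1)[OF x] HD(1)[OF y] unfolding U_isometries by blast
  moreover have "(x * y) $$ (a, k) = 0" if k: "a < k" "k < n" "k < m - 1 - b" for k
  proof -
    have "(x * y) $$ (a, k) = x $$ (a, k) + y $$ (a, k)"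
      by (rule entry) (use HD(2)[OF x] k in auto)
    then show ?thesis using HD(2)[OF x k] HD(2)[OF y k] by simp
  qed
  moreover have "(x * y) $$ (b, k) = 0" if k: "b < k" "k < m - n" for k
  proof -
    have "(x * y) $$ (b, k) = x $$ (b, k) + y $$ (b, k)"
      by (rule entry) (use HD(3)[OF x] k in auto)
    then show ?thesis using HD(3)[OF x k] HD(3)[OF y k] by simp
  qed
  ultimately show "x * y \<in> H a b" by (simp add: H_def)
  \<comment> \<open>\<open>H_inverse_column\<close> speaks of inverses, so \<open>y\<close> is
    regarded as the inverse of its inverse. The intermediate terms then vanish as in
    \<open>H_entry\<close>, which makes the root position additive.\<close>
  have yy: "inv\<^bsub>G\<^esub> (inv\<^bsub>G\<^esub> y) = y" using group.inv_inv[OF group_G] HD(1)[OF y] by (simp add: G_simps)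
  show "(x * y) $$ (a, m - 1 - b) = x $$ (a, m - 1 - b) + y $$ (a, m - 1 - b)"
  proof (rule entry)
    fix l assume l: "a < l" "l < m - 1 - b"
    show "x $$ (a, l) * y $$ (l, m - 1 - b) = 0"
      using HD(2)[OF x, of l] H_inverse_column[OF H_inv[OF y ab] ab, of l] yy l by (cases "l < n") auto
  qed (use d in auto)
qed

lemma H_one: "a < m \<Longrightarrow> b < m \<Longrightarrow> 1\<^sub>m m \<in> H a b"
  using isometries_one by (auto simp: H_def U_isometries)

lemma H_subgroup:
  assumes ab: "(a, b) \<in> root_pairs"
  shows "subgroup (H a b) G"
  by (rule group.subgroupI[OF group_G])
    (use H_one[OF root_pairsD(3,4)[OF ab]] H_inv[OF _ ab] H_mult(1)[OF _ _ ab] HD(1) in \<open>auto simp: G_simps\<close>)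

text \<open>Conjugation in \<open>U\<close> becomes congruence of \<open>bil u\<close>, membership
  in \<open>H a b\<close> becomes \<open>root_cond\<close>, and \<open>H_entry\<close> reads off the
  linear character at the price of the sign \<open>s (m - 1 - b)\<close>. Then
  \<open>root_sum\<close> replaces \<open>U\<close> by \<open>T\<close>.\<close>

lemma induced_H:
  assumes ab: "(a, b) \<in> root_pairs" and c: "c \<noteq> 0" and u: "u \<in> U"
  shows "induced_character G (H a b) (\<lambda>x. \<theta> (c * x $$ (a, m - 1 - b))) u =
    of_nat (card U) / (of_nat (card (H a b)) * of_nat (card T)) *
      (\<Sum>g\<in>T. \<theta> (c * s (m - 1 - b) * (g * bil u * g\<^sup>T) $$ (a, b)))"
proof -
  interpret group G by (rule group_G)
  let ?F = "\<lambda>x. if x \<in> H a b then \<theta> (c * x $$ (a, m - 1 - b)) else 0"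
  have uT: "bil u \<in> forms" using bil_forms U_T[OF u] by blast
  have "(\<Sum>g\<in>{g\<in>carrier G. inv\<^bsub>G\<^esub> g \<otimes>\<^bsub>G\<^esub> u \<otimes>\<^bsub>G\<^esub> g \<in> H a b}. \<theta> (c * (inv\<^bsub>G\<^esub> g \<otimes>\<^bsub>G\<^esub> u \<otimes>\<^bsub>G\<^esub> g) $$ (a, m - 1 - b)))
    = (\<Sum>g\<in>U. ?F (inv\<^bsub>G\<^esub> g * u * g))"
    using sum.inter_filter[OF finite_U, of "\<lambda>g. \<theta> (c * (inv\<^bsub>G\<^esub> g * u * g) $$ (a, m - 1 - b))" "\<lambda>g. inv\<^bsub>G\<^esub> g * u * g \<in> H a b"]
    by (simp add: G_simps)
  also have "\<dots> = (\<Sum>k\<in>U. ?F (k * u * inv\<^bsub>G\<^esub> k))"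
    by (rule sum.reindex_bij_witness[of _ "\<lambda>g. inv\<^bsub>G\<^esub> g" "\<lambda>g. inv\<^bsub>G\<^esub> g"])
      (use inv_inv inv_G(1) in \<open>auto simp: G_simps\<close>)
  also have "\<dots> = (\<Sum>k\<in>U. if root_cond a b (k * bil u * k\<^sup>T) then \<theta> (c * s (m - 1 - b) * (k * bil u * k\<^sup>T) $$ (a, b)) else 0)"
  proof (intro sum.cong refl)
    fix k assume k: "k \<in> U"
    have x: "k * u * inv\<^bsub>G\<^esub> k \<in> U"
      using isometries_mult k u inv_G(1)[OF k] unfolding U_isometries by blast
    have e: "bil (k * u * inv\<^bsub>G\<^esub> k) = k * bil u * k\<^sup>T"
      by (rule bil_conjugate) (use k u U_isometries inv_G[OF k] U_carrier in auto)
    show "?F (k * u * inv\<^bsub>G\<^esub> k) = (if root_cond a b (k * bil u * k\<^sup>T) then \<theta> (c * s (m - 1 - b) * (k * bil u * k\<^sup>T) $$ (a, b)) else 0)"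
      using H_root_cond[OF x ab] H_entry[OF _ ab, of "k * u * inv\<^bsub>G\<^esub> k"] unfolding e
      by (auto simp: mult.assoc)
  qed
  finally have ind: "induced_character G (H a b) (\<lambda>x. \<theta> (c * x $$ (a, m - 1 - b))) u =
    (\<Sum>k\<in>U. if root_cond a b (k * bil u * k\<^sup>T) then \<theta> (c * s (m - 1 - b) * (k * bil u * k\<^sup>T) $$ (a, b)) else 0) / of_nat (card (H a b))"
    using u unfolding induced_character_def by (simp add: G_simps)
  have "c * s (m - 1 - b) \<noteq> 0" using c s2 by simp
  note R = root_sum[OF ab uT this]
  have nz: "(of_nat (card T) :: complex) \<noteq> 0"
    using card_pos[of T] unitriangular_one by auto
  have q: "X / h = v / (h * w) * Y" if "w * X = v * Y" "w \<noteq> 0" for X Y v w h :: complex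
  proof -
    have "X = v * Y / w" using that by (simp add: field_simps)
    then show ?thesis by simp
  qed
  show ?thesis unfolding ind by (rule q[OF R nz])
qed

section \<open>Roots and pairs of positions\<close>

text \<open>
  The entries of a root, after reversal of the columns, are \<open>(a, b)\<close> and \<open>(b, a)\<close>. A set of roots is
  basic iff the pairs \<open>{a, b}\<close> are disjoint.
\<close>

definition root_pair :: "root \<Rightarrow> nat \<times> nat" where
  "root_pair \<alpha> = (case \<alpha> of Minus i j \<Rightarrow> (nat i - 1, m - nat j) | Plus i j \<Rightarrow> (nat i - 1, nat j - 1)
     | Twice i \<Rightarrow> (nat i - 1, nat i - 1) | Single i \<Rightarrow> (nat i - 1, n))"

lemma roots_cases [consumes 1, case_names Minus Plus Twice Single]:
  assumes "\<alpha> \<in> roots t n"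
  obtains i j where "\<alpha> = Minus i j" "1 \<le> i" "i < j" "j \<le> int n"
  | i j where "\<alpha> = Plus i j" "1 \<le> i" "i < j" "j \<le> int n"
  | i where "\<alpha> = Twice i" "1 \<le> i" "i \<le> int n" "r = 0"
  | i where "\<alpha> = Single i" "1 \<le> i" "i \<le> int n" "r = 1"
  using assms unfolding roots_def by (cases t) auto

lemma roots_iff:
  "Minus i j \<in> roots t n \<longleftrightarrow> 1 \<le> i \<and> i < j \<and> j \<le> int n"
  "Plus i j \<in> roots t n \<longleftrightarrow> 1 \<le> i \<and> i < j \<and> j \<le> int n"
  "Twice i \<in> roots t n \<longleftrightarrow> 1 \<le> i \<and> i \<le> int n \<and> t = Sp_even"
  "Single i \<in> roots t n \<longleftrightarrow> 1 \<le> i \<and> i \<le> int n \<and> t = O_odd"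
  unfolding roots_def by (cases t; auto)+

lemma root_pair_mem:
  assumes "\<alpha> \<in> roots t n"
  shows "root_pair \<alpha> \<in> root_pairs"
  using assms
proof (cases rule: roots_cases)
  case (Minus i j)
  then show ?thesis by (auto simp: root_pair_def root_pairs_def m_eq)
next
  case (Plus i j)
  then show ?thesis by (auto simp: root_pair_def root_pairs_def m_eq)
next
  case (Twice i)
  have "2 * (nat i - 1) + 1 < 2 * n" using Twice(2,3) by linarith
  moreover have "t = Sp_even" using assms Twice(1) roots_iff(3) by blast
  moreover have "root_pair \<alpha> = (nat i - 1, nat i - 1)" using Twice(1) by (simp add: root_pair_def)
  ultimately show ?thesis using Twice(4) unfolding root_pairs_def m_eq by simp
next
  case (Single i)
  have "nat i - 1 + n + 1 < 2 * n + 1" "nat i - 1 < n" using Single(2,3) by linarith+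
  then show ?thesis using Single(1,4) by (simp add: root_pair_def root_pairs_def m_eq)
qed

lemma root_pair_inj: "inj_on root_pair (roots t n)"
proof (rule inj_onI)
  fix \<alpha> \<beta> assume a: "\<alpha> \<in> roots t n" and b: "\<beta> \<in> roots t n" and e: "root_pair \<alpha> = root_pair \<beta>"
  show "\<alpha> = \<beta>"
    by (use a in \<open>cases rule: roots_cases\<close>; use b in \<open>cases rule: roots_cases\<close>;
        use e in \<open>auto simp: root_pair_def m_eq\<close>)
qed

lemma root_pair_surj:
  assumes ab: "(a, b) \<in> root_pairs"
  obtains \<alpha> where "\<alpha> \<in> roots t n" "root_pair \<alpha> = (a, b)"
proof -
  note d = root_pairsD[OF ab]
  consider "b < n" "a = b" | "b < n" "a < b" | "n \<le> b" "b < n + r" | "n + r \<le> b" using d(1) by linarith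
  then show ?thesis
  proof cases
    case 1
    have "Twice (int a + 1) \<in> roots t n" unfolding roots_iff using d(2) d(6)[OF 1(2)] by simp
    moreover have "root_pair (Twice (int a + 1)) = (a, b)" using 1(2) by (simp add: root_pair_def)
    ultimately show ?thesis by (rule that)
  next
    case 2
    then show ?thesis using that[of "Plus (int a + 1) (int b + 1)"] d by (auto simp: roots_iff root_pair_def nat_add_distrib)
  next
    case 3
    then have "r = 1" "b = n" using r_le by auto
    then have "Single (int a + 1) \<in> roots t n" unfolding roots_iff using d(2) r_cases(2) by simp
    moreover have "root_pair (Single (int a + 1)) = (a, b)" using \<open>b = n\<close> by (simp add: root_pair_def)
    ultimately show ?thesis by (rule that)
  next
    case 4
    have "nat (int m - int b) = m - b" by simp
    then show ?thesis using that[of "Minus (int a + 1) (int m - int b)"] d 4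
      by (auto simp: roots_iff root_pair_def nat_add_distrib m_eq)
  qed
qed

section \<open>Labels, positions and root subgroups\<close>

lemma pos_inj: "inj_on (pos t n) (index_set t n)"
proof (rule inj_onI)
  fix x y assume x: "x \<in> index_set t n" and y: "y \<in> index_set t n" and e: "pos t n x = pos t n y"
  have h: "pos t n z < n \<longleftrightarrow> 0 < z" "pos t n z < n + r \<longleftrightarrow> 0 \<le> z" "pos t n z < m" if "z \<in> index_set t n" for z
    using that r_cases(2) n by (auto simp: index_set_def pos_def m_eq)
  consider "0 < x" "0 < y" | "x = 0" "y = 0" | "x < 0" "y < 0"
    using h(1,2)[OF x] h(1,2)[OF y] e by linarith
  then show "x = y"
    using e x y by cases (auto simp: index_set_def pos_def m_eq)
qed

lemma entries_pos_all:
  assumes "\<alpha> \<in> roots t n" and ab: "root_pair \<alpha> = (a, b)"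
  shows "(\<lambda>(x, y). (pos t n x, m - 1 - pos t n y)) ` entries \<alpha> = {(a, b), (b, a)} \<and>
    entries \<alpha> \<subseteq> index_set t n \<times> index_set t n \<and>
    pos t n (fst (positive_entry \<alpha>)) = a \<and> pos t n (snd (positive_entry \<alpha>)) = m - 1 - b"
  using assms(1)
proof (cases rule: roots_cases)
  case (Minus i j)
  then have "pos t n i = a" "pos t n j = m - 1 - b" "pos t n (- j) = b" "pos t n (- i) = m - 1 - a" "a < m" "b < m"
    using ab by (auto simp: root_pair_def pos_def m_eq)
  then show ?thesis
    using Minus by (auto simp: index_set_def)
next
  case (Plus i j)
  then have "pos t n i = a" "pos t n j = b" "pos t n (- j) = m - 1 - b" "pos t n (- i) = m - 1 - a" "a < m" "b < m"
    using ab by (auto simp: root_pair_def pos_def m_eq)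
  then show ?thesis
    using Plus by (auto simp: index_set_def)
next
  case (Twice i)
  then have "pos t n i = a" "a = b" "pos t n (- i) = m - 1 - a" "a < m"
    using ab by (auto simp: root_pair_def pos_def m_eq)
  then show ?thesis
    using Twice(1-3) by (auto simp: index_set_def)
next
  case (Single i)
  have bn: "b = n" "nat i - 1 = a" using ab Single(1) by (simp_all add: root_pair_def)
  have "pos t n i = a" "pos t n 0 = b" "m - 1 - b = b" "pos t n (- i) = m - 1 - a" "a < m"
    using bn Single(2-4) unfolding pos_def m_eq by auto
  then show ?thesis
    using Single(1-4) r_cases(2) by (auto simp: index_set_def)
qed

lemmas entries_pos = entries_pos_all[THEN conjunct1] entries_pos_all[THEN conjunct2, THEN conjunct1]
  entries_pos_all[THEN conjunct2, THEN conjunct2, THEN conjunct1]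
  entries_pos_all[THEN conjunct2, THEN conjunct2, THEN conjunct2]

text \<open>Labels from \<open>1\<close> to \<open>n\<close> are shifted by one against positions;
  the bound on \<open>K\<close> keeps the labels \<open>k < K\<close> within this range.\<close>

lemma row_condition_pos:
  assumes "1 \<le> i" "K \<le> int n + 1"
  shows "(\<forall>k. i < k \<and> k < K \<longrightarrow> entry t n x c k = 0) \<longleftrightarrow>
    (\<forall>k. nat i - 1 < k \<and> k < nat K - 1 \<longrightarrow> x $$ (pos t n c, k) = 0)"
proof (intro iffI allI impI)
  fix k assume h: "\<forall>k. i < k \<and> k < K \<longrightarrow> entry t n x c k = 0" and k: "nat i - 1 < k \<and> k < nat K - 1"
  have "i < int k + 1 \<and> int k + 1 < K" using k assms by linarith
  then have "entry t n x c (int k + 1) = 0" using h by blast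
  then show "x $$ (pos t n c, k) = 0" by (simp add: entry_def pos_def nat_add_distrib)
next
  fix k assume h: "\<forall>k. nat i - 1 < k \<and> k < nat K - 1 \<longrightarrow> x $$ (pos t n c, k) = 0" and k: "i < k \<and> k < K"
  then have "nat i - 1 < nat k - 1 \<and> nat k - 1 < nat K - 1" using assms by auto
  then have "x $$ (pos t n c, nat k - 1) = 0" using h by blast
  then show "entry t n x c k = 0" using k assms by (simp add: entry_def pos_def)
qed

lemma root_subgroup_H:
  assumes \<alpha>: "\<alpha> \<in> roots t n" and ab: "root_pair \<alpha> = (a, b)"
  shows "root_subgroup t n \<alpha> = H a b"
  using \<alpha>
proof (cases rule: roots_cases)
  case (Minus i j)
  then have p: "nat i - 1 = a" "nat j - 1 = m - 1 - b" "m - n \<le> b" "pos t n i = a" "m - 1 - b < n"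
    using ab by (auto simp: root_pair_def pos_def m_eq)
  have "(\<forall>k. i < k \<and> k < j \<longrightarrow> entry t n x i k = 0) \<longleftrightarrow> (\<forall>k. a < k \<and> k < m - 1 - b \<longrightarrow> x $$ (a, k) = 0)" for x :: "'a mat"
    using row_condition_pos[of i j x i] Minus p by simp
  then show ?thesis using Minus(1) p(3,5) by (auto simp: H_def)
next
  case (Plus i j)
  then have p: "nat i - 1 = a" "nat j - 1 = b" "b < n" "a < b" "pos t n i = a" "pos t n j = b" "n \<le> m - 1 - b"
    using ab by (auto simp: root_pair_def pos_def m_eq)
  have 1: "(\<forall>k. i < k \<and> k \<le> int n \<longrightarrow> entry t n x i k = 0) \<longleftrightarrow> (\<forall>k. a < k \<and> k < n \<longrightarrow> x $$ (a, k) = 0)" for x :: "'a mat"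
    using row_condition_pos[of i "int n + 1" x i] Plus p by (simp add: zless_add1_eq nat_add_distrib order_le_less)
  have 2: "(\<forall>l\<in>index_set t n. prec t n j l \<and> 0 \<le> l \<longrightarrow> entry t n x j l = 0) \<longleftrightarrow> (\<forall>l. b < l \<and> l < m - n \<longrightarrow> x $$ (b, l) = 0)" for x :: "'a mat"
  proof (intro iffI allI impI ballI)
    fix l assume h: "\<forall>l\<in>index_set t n. prec t n j l \<and> 0 \<le> l \<longrightarrow> entry t n x j l = 0" and l: "b < l \<and> l < m - n"
    \<comment> \<open>Position \<open>l < m - n\<close> carries the label \<open>l + 1\<close>,
      except for the middle position \<open>n\<close>, whose label is \<open>0\<close>.\<close>
    define k where "k = (if l < n then int l + 1 else 0)"
    have k: "k \<in> index_set t n" "0 \<le> k" "pos t n k = l"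
      using l r_le r_cases(2) by (auto simp: k_def index_set_def pos_def mn nat_add_distrib)
    then have "entry t n x j k = 0" using h l p by (simp add: prec_def)
    then show "x $$ (b, l) = 0" using k p by (simp add: entry_def)
  next
    fix l assume h: "\<forall>l. b < l \<and> l < m - n \<longrightarrow> x $$ (b, l) = 0" and l: "l \<in> index_set t n" "prec t n j l \<and> 0 \<le> l"
    have "pos t n l < m - n" using l n r_cases(2) by (auto simp: pos_def mn index_set_def)
    then show "entry t n x j l = 0" using h l p by (simp add: entry_def prec_def)
  qed
  show ?thesis using Plus(1) 1 2 p(7) by (auto simp: H_def)
next
  case (Twice i)
  then have p: "nat i - 1 = a" "b = a" "pos t n i = a" "n \<le> m - 1 - b" "m - n = n"
    using ab by (auto simp: root_pair_def pos_def m_eq)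
  have 1: "(\<forall>k. i < k \<and> k \<le> int n \<longrightarrow> entry t n x i k = 0) \<longleftrightarrow> (\<forall>k. a < k \<and> k < n \<longrightarrow> x $$ (a, k) = 0)" for x :: "'a mat"
    using row_condition_pos[of i "int n + 1" x i] Twice(2,3) p by (simp add: zless_add1_eq nat_add_distrib order_le_less)
  show ?thesis using Twice(1) 1 p by (auto simp: H_def)
next
  case (Single i)
  have bn: "b = n" "nat i - 1 = a" using ab Single(1) by (simp_all add: root_pair_def)
  have p: "nat i - 1 = a" "b = n" "pos t n i = a" "m - 1 - b = n" "m - n = n + 1"
    using bn Single(2-4) unfolding pos_def m_eq by simp_all
  have 1: "(\<forall>k. i < k \<and> k \<le> int n \<longrightarrow> entry t n x i k = 0) \<longleftrightarrow> (\<forall>k. a < k \<and> k < n \<longrightarrow> x $$ (a, k) = 0)" for x :: "'a mat"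
    using row_condition_pos[of i "int n + 1" x i] Single(2,3) p by (simp add: zless_add1_eq nat_add_distrib order_le_less)
  show ?thesis using Single(1) 1 p by (auto simp: H_def)
qed

lemma elementary_character_eq:
  assumes \<alpha>: "\<alpha> \<in> roots t n" and ab: "root_pair \<alpha> = (a, b)"
  shows "elementary_character \<theta> t n \<alpha> c = induced_character G (H a b) (\<lambda>x. \<theta> (c * x $$ (a, m - 1 - b)))"
  unfolding elementary_character_def root_subgroup_H[OF assms] root_character_def entry_def
    entries_pos(3,4)[OF assms] ..

lemma elementary_character_sum:
  assumes "\<alpha> \<in> roots t n" and "root_pair \<alpha> = (a, b)" and "c \<noteq> 0"
  obtains K where "K \<noteq> 0"
    "\<And>u. u \<in> U \<Longrightarrow> elementary_character \<theta> t n \<alpha> c u =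
       K * (\<Sum>g\<in>T. \<theta> (c * s (m - 1 - b) * (g * bil u * g\<^sup>T) $$ (a, b)))"
proof -
  have p: "(a, b) \<in> root_pairs" using root_pair_mem[OF assms(1)] assms(2) by simp
  have "1\<^sub>m m \<in> H a b" using H_one root_pairsD(3,4)[OF p] by blast
  moreover have sub: "H a b \<subseteq> T" "U \<subseteq> T" using U_T HD(1) by blast+
  ultimately have "card (H a b) > 0" "card U > 0" "card T > 0"
    using card_pos[of "H a b"] card_pos[of U] card_pos[of T] HD(1) by blast+
  then show ?thesis
    using that[of "of_nat (card U) / (of_nat (card (H a b)) * of_nat (card T))"]
      induced_H[OF p assms(3)] elementary_character_eq[OF assms(1,2)] by simp
qed

text \<open>
  Distinct rows of an element of \<open>T\<close> are independent, since rows can be exchanged between two elements.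
\<close>

definition mix :: "nat set \<Rightarrow> 'a mat \<Rightarrow> 'a mat \<Rightarrow> 'a mat" where
  "mix R g h = mat m m (\<lambda>(i, j). if i \<in> R then g $$ (i, j) else h $$ (i, j))"

lemma mix_T: "g \<in> T \<Longrightarrow> h \<in> T \<Longrightarrow> mix R g h \<in> T"
  by (rule unitriangularI) (auto simp: mix_def unitriangularD(2,3))

definition depends_on_rows :: "nat set \<Rightarrow> ('a mat \<Rightarrow> complex) \<Rightarrow> bool" where
  "depends_on_rows R \<psi> \<longleftrightarrow> (\<forall>g\<in>T. \<forall>h\<in>T. (\<forall>i\<in>R. \<forall>j<m. g $$ (i, j) = h $$ (i, j)) \<longrightarrow> \<psi> g = \<psi> h)"

lemma sum_mult_independent:
  assumes \<psi>: "depends_on_rows R \<psi>" and \<psi>': "depends_on_rows R' \<psi>'" and dis: "R \<inter> R' = {}" and R: "R \<subseteq> {..<m}" "R' \<subseteq> {..<m}"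
  shows "(\<Sum>g\<in>T. \<psi> g) * (\<Sum>g\<in>T. \<psi>' g) = of_nat (card T) * (\<Sum>g\<in>T. \<psi> g * \<psi>' g)"
proof -
  have "(\<Sum>g\<in>T. \<psi> g) * (\<Sum>g\<in>T. \<psi>' g) = (\<Sum>(g, h)\<in>T \<times> T. \<psi> g * \<psi>' h)"
    by (simp add: sum_product sum.cartesian_product)
  also have "\<dots> = (\<Sum>(g, h)\<in>T \<times> T. \<psi> g * \<psi>' g)"
  \<comment> \<open>The substitution exchanges all rows outside \<open>R\<close> between
    \<open>g\<close> and \<open>h\<close>, so it is its own inverse.\<close>
  proof (rule sum.reindex_bij_witness[of _ "\<lambda>(g, h). (mix R g h, mix R h g)" "\<lambda>(g, h). (mix R g h, mix R h g)"])
    have inv: "mix R (mix R g h) (mix R h g) = g" if "g \<in> T" "h \<in> T" for g h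
      using unitriangularD(1)[OF that(1)] unitriangularD(1)[OF that(2)] by (intro eq_matI) (auto simp: mix_def)
    fix x assume x: "x \<in> T \<times> T"
    obtain g h where gh: "x = (g, h)" "g \<in> T" "h \<in> T" using x by auto
    have m': "mix R g h \<in> T" "mix R h g \<in> T" using mix_T gh by auto
    show "(case case x of (g, h) \<Rightarrow> (mix R g h, mix R h g) of (g, h) \<Rightarrow> (mix R g h, mix R h g)) = x"
      using inv gh by simp
    then show "(case case x of (g, h) \<Rightarrow> (mix R g h, mix R h g) of (g, h) \<Rightarrow> (mix R g h, mix R h g)) = x" .
    show "(case x of (g, h) \<Rightarrow> (mix R g h, mix R h g)) \<in> T \<times> T" using m' gh by simp
    then show "(case x of (g, h) \<Rightarrow> (mix R g h, mix R h g)) \<in> T \<times> T" .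
    have "\<forall>i\<in>R. \<forall>j<m. mix R g h $$ (i, j) = g $$ (i, j)" using R by (auto simp: mix_def)
    then have 1: "\<psi> (mix R g h) = \<psi> g" using \<psi> gh m' unfolding depends_on_rows_def by blast
    have "\<forall>i\<in>R'. \<forall>j<m. mix R g h $$ (i, j) = h $$ (i, j)"
    proof (intro ballI allI impI)
      fix i j assume "i \<in> R'" "j < m"
      then have "i < m" "i \<notin> R" "j < m" using R dis by auto
      then show "mix R g h $$ (i, j) = h $$ (i, j)" by (simp add: mix_def)
    qed
    then have 2: "\<psi>' (mix R g h) = \<psi>' h" using \<psi>' gh m' unfolding depends_on_rows_def by blast
    show "(case case x of (g, h) \<Rightarrow> (mix R g h, mix R h g) of (g, h) \<Rightarrow> \<psi> g * \<psi>' g) = (case x of (g, h) \<Rightarrow> \<psi> g * \<psi>' h)"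
      using 1 2 gh by simp
  qed
  also have "\<dots> = (\<Sum>g\<in>T. \<Sum>h\<in>T. \<psi> g * \<psi>' g)" by (rule sum.cartesian_product[symmetric])
  also have "\<dots> = of_nat (card T) * (\<Sum>g\<in>T. \<psi> g * \<psi>' g)" by (simp add: sum_distrib_left)
  finally show ?thesis .
qed

text \<open>The additional factor on the left avoids the exponent \<open>card D - 1\<close>, which
  would be wrong for empty \<open>D\<close>.\<close>

lemma prod_sum_independent:
  assumes "finite D" and "\<And>\<alpha>. \<alpha> \<in> D \<Longrightarrow> depends_on_rows (R \<alpha>) (\<psi> \<alpha>)" and "\<And>\<alpha>. \<alpha> \<in> D \<Longrightarrow> R \<alpha> \<subseteq> {..<m}"
    and "\<And>\<alpha> \<beta>. \<alpha> \<in> D \<Longrightarrow> \<beta> \<in> D \<Longrightarrow> \<alpha> \<noteq> \<beta> \<Longrightarrow> R \<alpha> \<inter> R \<beta> = {}"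
  shows "of_nat (card T) * (\<Prod>\<alpha>\<in>D. \<Sum>g\<in>T. \<psi> \<alpha> g) = of_nat (card T) ^ card D * (\<Sum>g\<in>T. \<Prod>\<alpha>\<in>D. \<psi> \<alpha> g)"
  using assms
proof (induction D rule: finite_induct)
  case empty
  then show ?case by simp
next
  case (insert \<alpha> D)
  have 1: "depends_on_rows (R \<alpha>) (\<psi> \<alpha>)" using insert.prems by simp
  have 2: "depends_on_rows (\<Union>\<beta>\<in>D. R \<beta>) (\<lambda>g. \<Prod>\<beta>\<in>D. \<psi> \<beta> g)"
    unfolding depends_on_rows_def
  proof (intro ballI impI prod.cong refl)
    fix g h \<beta> assume gh: "g \<in> T" "h \<in> T" "\<forall>i\<in>\<Union>\<beta>\<in>D. R \<beta>. \<forall>j<m. g $$ (i, j) = h $$ (i, j)" and \<beta>: "\<beta> \<in> D"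
    have "depends_on_rows (R \<beta>) (\<psi> \<beta>)" using insert.prems(1) \<beta> by simp
    then show "\<psi> \<beta> g = \<psi> \<beta> h" unfolding depends_on_rows_def using gh \<beta> by blast
  qed
  have dis: "R \<alpha> \<inter> (\<Union>\<beta>\<in>D. R \<beta>) = {}" using insert.prems(3)[of \<alpha>] insert.hyps by blast
  have sub: "R \<alpha> \<subseteq> {..<m}" "(\<Union>\<beta>\<in>D. R \<beta>) \<subseteq> {..<m}" using insert.prems(2) by blast+
  have "of_nat (card T) * (\<Prod>\<alpha>\<in>insert \<alpha> D. \<Sum>g\<in>T. \<psi> \<alpha> g) =
    (\<Sum>g\<in>T. \<psi> \<alpha> g) * (of_nat (card T) * (\<Prod>\<alpha>\<in>D. \<Sum>g\<in>T. \<psi> \<alpha> g))"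
    using insert.hyps by (simp add: mult_ac)
  also have "of_nat (card T) * (\<Prod>\<alpha>\<in>D. \<Sum>g\<in>T. \<psi> \<alpha> g) = of_nat (card T) ^ card D * (\<Sum>g\<in>T. \<Prod>\<alpha>\<in>D. \<psi> \<alpha> g)"
    by (rule insert.IH) (use insert.prems in blast)+
  also have "(\<Sum>g\<in>T. \<psi> \<alpha> g) * (of_nat (card T) ^ card D * (\<Sum>g\<in>T. \<Prod>\<alpha>\<in>D. \<psi> \<alpha> g)) =
     of_nat (card T) ^ card D * ((\<Sum>g\<in>T. \<psi> \<alpha> g) * (\<Sum>g\<in>T. \<Prod>\<alpha>\<in>D. \<psi> \<alpha> g))" by (simp only: ac_simps)
  also have "(\<Sum>g\<in>T. \<psi> \<alpha> g) * (\<Sum>g\<in>T. \<Prod>\<alpha>\<in>D. \<psi> \<alpha> g) = of_nat (card T) * (\<Sum>g\<in>T. \<psi> \<alpha> g * (\<Prod>\<alpha>\<in>D. \<psi> \<alpha> g))"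
    by (rule sum_mult_independent[OF 1 2 dis sub])
  finally show ?case using insert.hyps by (simp add: mult_ac)
qed

section \<open>Supercharacters as orbit sums\<close>

definition pairing :: "'a mat \<Rightarrow> 'a mat \<Rightarrow> 'a" where
  "pairing A B = (\<Sum>k<m. \<Sum>l<m. A $$ (k, l) * B $$ (k, l))"

text \<open>The coordinate of the functional \<open>pairing A\<close> at \<open>p\<close>. An
  off-diagonal entry occurs twice in the pairing with a form, and with the same product, since the
  two signs multiply to \<open>\<sigma> * \<sigma> = 1\<close>.\<close>

definition coef :: "'a mat \<Rightarrow> nat \<times> nat \<Rightarrow> 'a" where
  "coef A p = (if fst p = snd p then 1 else 2) * A $$ p"

lemma coef_0_iff: "coef A p = 0 \<longleftrightarrow> A $$ p = 0"
  using two by (simp add: coef_def)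

section \<open>Coordinates of forms and the pairing\<close>

lemma root_pairs_subset: "root_pairs \<subseteq> {..<m} \<times> {..<m}"
  by (auto dest: root_pairsD(3,4))

lemma finite_root_pairs: "finite root_pairs"
  by (rule finite_subset[OF root_pairs_subset]) simp

lemma forms_sym_0:
  assumes "A \<in> forms" "k < m" "l < m"
  shows "A $$ (k, l) = 0 \<longleftrightarrow> A $$ (l, k) = 0"
  using formsD(2)[OF assms] \<sigma>2 by simp

lemma forms_root_pairs:
  assumes A: "A \<in> forms" and "k < m" "l < m" "k \<le> l" "A $$ (k, l) \<noteq> 0"
  shows "(k, l) \<in> root_pairs"
proof -
  have "k + l + 1 < m" using formsD(3)[OF assms(1-3)] assms(5) by linarith
  moreover have "t = Sp_even" if "k = l"
  proof (rule ccontr)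
    assume "t \<noteq> Sp_even"
    then have "2 * A $$ (k, l) = 0" using formsD(2)[OF assms(1-3)] \<sigma>_cases(2) that by (simp add: eq_neg_iff_add_eq_0)
    then show False using two assms(5) by simp
  qed
  ultimately show ?thesis using assms(4) by (simp add: root_pairs_def)
qed

lemma forms_eqI:
  assumes A: "A \<in> forms" and B: "B \<in> forms" and e: "\<And>p. p \<in> root_pairs \<Longrightarrow> A $$ p = B $$ p"
  shows "A = B"
proof (rule eq_matI)
  have h: "A $$ (k, l) = B $$ (k, l)" if "k < m" "l < m" "k \<le> l" for k l
    using forms_root_pairs[OF A that] forms_root_pairs[OF B that] e by metis
  fix i j assume "i < dim_row B" "j < dim_col B"
  then have ij: "i < m" "j < m" using formsD(1)[OF B] by auto
  show "A $$ (i, j) = B $$ (i, j)"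
  proof (cases "i \<le> j")
    case True then show ?thesis using h ij by blast
  next
    case False
    then show ?thesis
      using h[OF ij(2,1)] formsD(2)[OF A ij(2,1)] formsD(2)[OF B ij(2,1)] by simp
  qed
qed (use formsD(1)[OF A] formsD(1)[OF B] in auto)

lemma pairing_root_pairs:
  assumes A: "A \<in> forms" and B: "B \<in> forms"
  shows "pairing A B = (\<Sum>p\<in>root_pairs. coef A p * B $$ p)"
proof -
  define f where "f p = A $$ p * B $$ p" for p
  define P where "P = {p \<in> root_pairs. fst p \<noteq> snd p}"
  define Q where "Q = prod.swap ` P"
  have sym: "f (l, k) = f (k, l)" if "k < m" "l < m" for k l
  proof -
    have "f (l, k) = \<sigma> * \<sigma> * f (k, l)"
      unfolding f_def using formsD(2)[OF A that] formsD(2)[OF B that] by (simp add: mult_ac)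
    then show ?thesis by (simp add: \<sigma>2)
  qed
  have fin: "finite P" "finite Q" using finite_root_pairs by (auto simp: P_def Q_def)
  have dis: "root_pairs \<inter> Q = {}" by (auto simp: Q_def P_def root_pairs_def)
  have sub: "root_pairs \<union> Q \<subseteq> {..<m} \<times> {..<m}" using root_pairs_subset by (auto simp: Q_def P_def)
  have zero: "f p = 0" if p: "p \<in> {..<m} \<times> {..<m} - (root_pairs \<union> Q)" for p
  proof -
    obtain k l where kl: "p = (k, l)" "k < m" "l < m" using p by auto
    have nq: "(k, l) \<notin> root_pairs" "(k, l) \<notin> Q" using p kl by auto
    have "A $$ (k, l) = 0"
    proof (cases "k \<le> l")
      case True
      then show ?thesis using forms_root_pairs[OF A kl(2,3)] nq by blast
    next
      case False
      have "(l, k) \<notin> root_pairs"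
      proof
        assume "(l, k) \<in> root_pairs"
        then have "(l, k) \<in> P" using False by (simp add: P_def)
        then have "(k, l) \<in> Q" unfolding Q_def by (metis image_eqI swap_simp)
        then show False using nq by blast
      qed
      then have "A $$ (l, k) = 0" using forms_root_pairs[OF A kl(3,2)] False by auto
      then show ?thesis using forms_sym_0[OF A kl(2,3)] by blast
    qed
    then show ?thesis by (simp add: f_def kl)
  qed
  have "pairing A B = (\<Sum>p\<in>{..<m} \<times> {..<m}. f p)"
    unfolding pairing_def f_def by (simp add: sum.cartesian_product case_prod_unfold)
  also have "\<dots> = (\<Sum>p\<in>root_pairs \<union> Q. f p)"
    using sub zero by (intro sum.mono_neutral_right) auto
  also have "\<dots> = (\<Sum>p\<in>root_pairs. f p) + (\<Sum>p\<in>Q. f p)"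
    using fin finite_root_pairs dis by (intro sum.union_disjoint) auto
  also have "(\<Sum>p\<in>Q. f p) = (\<Sum>p\<in>P. f (prod.swap p))"
    unfolding Q_def by (subst sum.reindex) (auto simp: inj_on_def)
  also have "\<dots> = (\<Sum>p\<in>P. f p)"
  proof (intro sum.cong refl)
    fix p assume "p \<in> P"
    then have "fst p < m" "snd p < m" using sub by (auto simp: P_def)
    then show "f (prod.swap p) = f p" using sym[of "fst p" "snd p"] by (simp add: prod.swap_def)
  qed
  also have "\<dots> = (\<Sum>p\<in>root_pairs. if fst p \<noteq> snd p then f p else 0)"
    unfolding P_def by (rule sum.inter_filter[OF finite_root_pairs])
  also have "(\<Sum>p\<in>root_pairs. f p) + (\<Sum>p\<in>root_pairs. if fst p \<noteq> snd p then f p else 0) =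
     (\<Sum>p\<in>root_pairs. coef A p * B $$ p)"
    unfolding sum.distrib[symmetric] by (intro sum.cong refl) (simp add: f_def coef_def)
  finally show ?thesis .
qed

lemma pairing_commute: "pairing A B = pairing B A"
  by (simp add: pairing_def mult.commute)

definition orbit_sum :: "'a mat \<Rightarrow> 'a mat \<Rightarrow> complex" where
  "orbit_sum A u = (\<Sum>g\<in>T. \<theta> (pairing A (g * bil u * g\<^sup>T)))"

definition root_set :: "'a mat \<Rightarrow> root set" where
  "root_set A = {\<alpha> \<in> roots t n. A $$ root_pair \<alpha> \<noteq> 0}"

text \<open>Chosen to make \<open>elementary_character_sum\<close> produce \<open>coef A\<close>:
  the sign \<open>s (m - 1 - b)\<close>, which \<open>H_entry\<close> attaches to the matrix entry,
  is its own inverse.\<close>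

definition root_coeff :: "'a mat \<Rightarrow> root \<Rightarrow> 'a" where
  "root_coeff A \<alpha> = coef A (root_pair \<alpha>) * s (m - 1 - snd (root_pair \<alpha>))"

text \<open>Rows suffice here; the symmetry of forms yields the columns in
  \<open>monomial_column\<close>.\<close>

definition monomial :: "'a mat \<Rightarrow> bool" where
  "monomial A \<longleftrightarrow> (\<forall>k<m. \<forall>l<m. \<forall>l'<m. A $$ (k, l) \<noteq> 0 \<longrightarrow> A $$ (k, l') \<noteq> 0 \<longrightarrow> l = l')"

section \<open>Basic pairs and monomial forms\<close>

lemma monomial_column:
  assumes A: "A \<in> forms" and mono: "monomial A" and "k < m" "k' < m" "l < m" "A $$ (k, l) \<noteq> 0" "A $$ (k', l) \<noteq> 0"
  shows "k = k'"
  using mono assms(3-) forms_sym_0[OF A assms(3,5)] forms_sym_0[OF A assms(4,5)] unfolding monomial_def by blast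

lemma entry_cases:
  assumes \<alpha>: "\<alpha> \<in> roots t n" and "(x, y) \<in> entries \<alpha>"
  shows "x \<in> index_set t n" "y \<in> index_set t n" "pos t n x < m" "pos t n y < m"
    "root_pair \<alpha> = (pos t n x, m - 1 - pos t n y) \<or> root_pair \<alpha> = (m - 1 - pos t n y, pos t n x)"
proof -
  obtain a b where ab: "root_pair \<alpha> = (a, b)" by force
  note e = entries_pos[OF \<alpha> ab]
  show i: "x \<in> index_set t n" "y \<in> index_set t n" using e(2) assms(2) by auto
  show "pos t n x < m" "pos t n y < m" using i n by (auto simp: pos_def index_set_def m_eq)
  have "(\<lambda>(x, y). (pos t n x, m - 1 - pos t n y)) (x, y) \<in> {(a, b), (b, a)}"
    using e(1) assms(2) by blast
  then show "root_pair \<alpha> = (pos t n x, m - 1 - pos t n y) \<or> root_pair \<alpha> = (m - 1 - pos t n y, pos t n x)"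
    using ab by auto
qed

lemma monomial_basic:
  assumes A: "A \<in> forms" and mono: "monomial A"
  shows "basic_pair t n (root_set A) (root_coeff A)"
proof -
  have ent: "A $$ (pos t n x, m - 1 - pos t n y) \<noteq> 0"
    if "\<alpha> \<in> root_set A" "(x, y) \<in> entries \<alpha>" for \<alpha> x y
  proof -
    have \<alpha>: "\<alpha> \<in> roots t n" "A $$ root_pair \<alpha> \<noteq> 0" using that by (auto simp: root_set_def)
    note c = entry_cases[OF \<alpha>(1) that(2)]
    have "m - 1 - pos t n y < m" using c(4) by simp
    from c(5) \<alpha>(2) forms_sym_0[OF A c(3) this] show ?thesis by auto
  qed
  have idx: "pos t n x < m" "pos t n y < m" "x \<in> index_set t n" "y \<in> index_set t n"
    if "\<alpha> \<in> root_set A" "(x, y) \<in> entries \<alpha>" for \<alpha> x y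
    using entry_cases[OF _ that(2)] that(1) by (auto simp: root_set_def)
  have "inj_on fst (\<Union>\<alpha>\<in>root_set A. entries \<alpha>)"
  proof (rule inj_onI)
    fix e e' assume "e \<in> (\<Union>\<alpha>\<in>root_set A. entries \<alpha>)" "e' \<in> (\<Union>\<alpha>\<in>root_set A. entries \<alpha>)" and f: "fst e = fst e'"
    then obtain \<alpha> \<beta> x y y' where ab: "\<alpha> \<in> root_set A" "\<beta> \<in> root_set A" "e = (x, y)" "e' = (x, y')"
      "(x, y) \<in> entries \<alpha>" "(x, y') \<in> entries \<beta>" by (cases e; cases e'; auto)
    note i = idx[OF ab(1,5)] idx[OF ab(2,6)]
    have "m - 1 - pos t n y < m" "m - 1 - pos t n y' < m" using i by auto
    then have "m - 1 - pos t n y = m - 1 - pos t n y'"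
      using mono i(1) ent[OF ab(1,5)] ent[OF ab(2,6)] unfolding monomial_def by blast
    then have "pos t n y = pos t n y'" using i by linarith
    then have "y = y'" using pos_inj i by (auto dest: inj_onD)
    then show "e = e'" using ab by simp
  qed
  moreover have "inj_on snd (\<Union>\<alpha>\<in>root_set A. entries \<alpha>)"
  proof (rule inj_onI)
    fix e e' assume "e \<in> (\<Union>\<alpha>\<in>root_set A. entries \<alpha>)" "e' \<in> (\<Union>\<alpha>\<in>root_set A. entries \<alpha>)" and f: "snd e = snd e'"
    then obtain \<alpha> \<beta> x y x' where ab: "\<alpha> \<in> root_set A" "\<beta> \<in> root_set A" "e = (x, y)" "e' = (x', y)"
      "(x, y) \<in> entries \<alpha>" "(x', y) \<in> entries \<beta>" by (cases e; cases e'; auto)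
    note i = idx[OF ab(1,5)] idx[OF ab(2,6)]
    have "m - 1 - pos t n y < m" using i by auto
    then have "pos t n x = pos t n x'"
      using monomial_column[OF A mono i(1) i(5) _ ent[OF ab(1,5)] ent[OF ab(2,6)]] by blast
    then have "x = x'" using pos_inj i by (auto dest: inj_onD)
    then show "e = e'" using ab by simp
  qed
  moreover have "root_coeff A \<alpha> \<noteq> 0" if "\<alpha> \<in> root_set A" for \<alpha>
    using that coef_0_iff s2 by (simp add: root_coeff_def root_set_def)
  ultimately show ?thesis by (auto simp: basic_pair_def basic_def root_set_def)
qed

lemma basic_monomial:
  assumes "basic_pair t n D \<phi>"
  obtains A where "A \<in> forms" "monomial A" "root_set A = D" "\<And>\<alpha>. \<alpha> \<in> D \<Longrightarrow> root_coeff A \<alpha> = \<phi> \<alpha>"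
proof -
  have D: "D \<subseteq> roots t n" and inj: "inj_on fst (\<Union>\<alpha>\<in>D. entries \<alpha>)" and \<phi>: "\<And>\<alpha>. \<alpha> \<in> D \<Longrightarrow> \<phi> \<alpha> \<noteq> 0"
    using assms by (auto simp: basic_pair_def basic_def)
  define P where "P = root_pair ` D"
  have PR: "P \<subseteq> root_pairs" using D root_pair_mem by (auto simp: P_def)
  \<comment> \<open>Solves \<open>root_coeff A \<alpha> = \<phi> \<alpha>\<close> for the entry of
    \<open>A\<close>: the sign \<open>s\<close> is its own inverse, and the denominator is the
    weight in \<open>coef\<close>.\<close>
  define w where "w p = \<phi> (the_inv_into (roots t n) root_pair p) * s (m - 1 - snd p) / (if fst p = snd p then 1 else 2)" for p
  have w\<phi>: "w (root_pair \<alpha>) = \<phi> \<alpha> * s (m - 1 - snd (root_pair \<alpha>)) / (if fst (root_pair \<alpha>) = snd (root_pair \<alpha>) then 1 else 2)"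
    if "\<alpha> \<in> D" for \<alpha>
    using the_inv_into_f_f[OF root_pair_inj] that D by (auto simp: w_def)
  have w0: "w p \<noteq> 0" if "p \<in> P" for p
    using that w\<phi> \<phi> s2 two by (auto simp: P_def split: if_splits)
  define A where "A = mat m m (\<lambda>(k, l). if (k, l) \<in> P then w (k, l) else if (l, k) \<in> P then - \<sigma> * w (l, k) else 0)"
  have idx: "A $$ (k, l) = (if (k, l) \<in> P then w (k, l) else if (l, k) \<in> P then - \<sigma> * w (l, k) else 0)" if "k < m" "l < m" for k l
    using that by (simp add: A_def)
  \<comment> \<open>A position and its mirror image can both lie in \<open>P\<close> only on the
    diagonal, where \<open>\<sigma> = -1\<close> makes the two clauses of \<open>A\<close>
    agree.\<close>
  have both: "k = l \<and> \<sigma> = -1" if "(k, l) \<in> P" "(l, k) \<in> P" for k l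
  proof -
    have "(k, l) \<in> root_pairs" "(l, k) \<in> root_pairs" using that PR by blast+
    then have "k = l" using root_pairsD(1) by (meson le_antisym)
    then show ?thesis using root_pairsD(6) \<open>(k, l) \<in> root_pairs\<close> by blast
  qed
  have A: "A \<in> forms"
    unfolding forms_def
  proof (intro CollectI conjI allI impI)
    show "A \<in> carrier_mat m m" by (simp add: A_def)
    fix k l assume kl: "k < m" "l < m"
    have "- \<sigma> * (- \<sigma> * w (l, k)) = w (l, k)" using \<sigma>2 by (simp flip: mult.assoc)
    then show "A $$ (l, k) = - \<sigma> * A $$ (k, l)"
      unfolding idx[OF kl] idx[OF kl(2,1)] using both[of k l] by auto
    show "A $$ (k, l) = 0" if "m \<le> k + l + 1"
    proof -
      have "(k, l) \<notin> root_pairs" "(l, k) \<notin> root_pairs" using root_pairsD(5) that by fastforce+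
      then show ?thesis unfolding idx[OF kl] using PR by auto
    qed
  qed
  have A0: "A $$ (k, l) \<noteq> 0 \<longleftrightarrow> (k, l) \<in> P \<or> (l, k) \<in> P" if "k < m" "l < m" for k l
    unfolding idx[OF that] using w0 \<sigma>2 by auto
  have ent: "\<exists>\<alpha>\<in>D. \<exists>x y. (x, y) \<in> entries \<alpha> \<and> pos t n x = k \<and> m - 1 - pos t n y = l"
    if kl: "k < m" "l < m" "A $$ (k, l) \<noteq> 0" for k l
  proof -
    obtain \<alpha> where \<alpha>: "\<alpha> \<in> D" "root_pair \<alpha> = (k, l) \<or> root_pair \<alpha> = (l, k)"
      using A0[OF kl(1,2)] kl(3) unfolding P_def by (metis imageE)
    have "(k, l) \<in> (\<lambda>(x, y). (pos t n x, m - 1 - pos t n y)) ` entries \<alpha>"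
      using \<alpha>(2)
    proof
      assume "root_pair \<alpha> = (k, l)"
      from entries_pos(1)[OF _ this] show ?thesis using \<alpha>(1) D by blast
    next
      assume "root_pair \<alpha> = (l, k)"
      from entries_pos(1)[OF _ this] show ?thesis using \<alpha>(1) D by blast
    qed
    then show ?thesis using \<alpha>(1) by fastforce
  qed
  have "monomial A"
    unfolding monomial_def
  proof (intro allI impI)
    fix k l l' assume kl: "k < m" "l < m" "l' < m" "A $$ (k, l) \<noteq> 0" "A $$ (k, l') \<noteq> 0"
    obtain \<alpha> x y where 1: "\<alpha> \<in> D" "(x, y) \<in> entries \<alpha>" "pos t n x = k" "m - 1 - pos t n y = l"
      using ent[OF kl(1,2,4)] by blast
    obtain \<beta> x' y' where 2: "\<beta> \<in> D" "(x', y') \<in> entries \<beta>" "pos t n x' = k" "m - 1 - pos t n y' = l'"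
      using ent[OF kl(1,3,5)] by blast
    have "x \<in> index_set t n" "x' \<in> index_set t n"
      using entry_cases(1) 1(1,2) 2(1,2) D by blast+
    then have "x = x'" using pos_inj 1(3) 2(3) by (auto dest: inj_onD)
    then have "(x, y) = (x', y')" using inj_onD[OF inj, of "(x, y)" "(x', y')"] 1(1,2) 2(1,2) by auto
    then show "l = l'" using 1 2 by simp
  qed
  moreover have "root_set A = D"
  proof
    show "D \<subseteq> root_set A"
    proof
      fix \<alpha> assume \<alpha>: "\<alpha> \<in> D"
      obtain a b where ab: "root_pair \<alpha> = (a, b)" by force
      have "(a, b) \<in> P" using \<alpha> ab unfolding P_def by force
      then have "A $$ (a, b) \<noteq> 0" using A0 PR root_pairsD(3,4) by blast
      then show "\<alpha> \<in> root_set A" using \<alpha> D ab by (auto simp: root_set_def)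
    qed
    show "root_set A \<subseteq> D"
    proof
      fix \<alpha> assume "\<alpha> \<in> root_set A"
      then have \<alpha>: "\<alpha> \<in> roots t n" "A $$ root_pair \<alpha> \<noteq> 0" by (auto simp: root_set_def)
      obtain a b where ab: "root_pair \<alpha> = (a, b)" by force
      have p: "(a, b) \<in> root_pairs" using root_pair_mem[OF \<alpha>(1)] ab by simp
      have "(a, b) \<in> P \<or> (b, a) \<in> P" using A0 root_pairsD(3,4)[OF p] \<alpha>(2) ab by simp
      then have "(a, b) \<in> P" using PR root_pairsD(1)[OF p] root_pairsD(1)[of b a] by (cases "a = b") auto
      then obtain \<beta> where "\<beta> \<in> D" "root_pair \<beta> = root_pair \<alpha>" using ab unfolding P_def by force
      then show "\<alpha> \<in> D" using inj_onD[OF root_pair_inj, of \<beta> \<alpha>] \<alpha>(1) D by auto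
    qed
  qed
  moreover have "root_coeff A \<alpha> = \<phi> \<alpha>" if \<alpha>: "\<alpha> \<in> D" for \<alpha>
  proof -
    obtain a b where ab: "root_pair \<alpha> = (a, b)" by force
    have P: "(a, b) \<in> P" using \<alpha> ab unfolding P_def by force
    then have "(a, b) \<in> root_pairs" using PR by blast
    then have "A $$ (a, b) = w (a, b)" using idx[of a b] P root_pairsD(3,4) by simp
    then have "root_coeff A \<alpha> = \<phi> \<alpha> * (s (m - 1 - b) * s (m - 1 - b))"
      using w\<phi>[OF \<alpha>] two unfolding root_coeff_def coef_def ab by (simp add: field_simps)
    then show ?thesis by (simp add: s2)
  qed
  ultimately show ?thesis using that A by blast
qed

text \<open>The \<open>(a, b)\<close> entry of a congruent form involves only the rows
  \<open>a\<close> and \<open>b\<close> of \<open>g\<close>. For a monomial \<open>A\<close> the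
  pairs of rows belonging to different roots are disjoint, so \<open>prod_sum_independent\<close>
  merges the sums over \<open>T\<close>, and the arguments of \<open>\<theta>\<close> add up to the
  pairing with \<open>A\<close>.\<close>

lemma supercharacter_orbit_sum:
  assumes A: "A \<in> forms" and mono: "monomial A"
  obtains K where "K \<noteq> 0"
    "\<And>u. u \<in> U \<Longrightarrow> supercharacter \<theta> t n (root_set A) (root_coeff A) u = K * orbit_sum A u"
proof -
  let ?D = "root_set A"
  have D: "?D \<subseteq> roots t n" by (auto simp: root_set_def)
  have "finite (roots t n)" by (rule inj_on_finite[OF root_pair_inj _ finite_root_pairs]) (use root_pair_mem in blast)
  then have fin: "finite ?D" using D finite_subset by blast
  have "\<exists>K. K \<noteq> 0 \<and> (\<forall>u\<in>U. elementary_character \<theta> t n \<alpha> (root_coeff A \<alpha>) u =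
       K * (\<Sum>g\<in>T. \<theta> (coef A (root_pair \<alpha>) * (g * bil u * g\<^sup>T) $$ root_pair \<alpha>)))" if \<alpha>: "\<alpha> \<in> ?D" for \<alpha>
  proof -
    obtain a b where ab: "root_pair \<alpha> = (a, b)" by force
    have c: "root_coeff A \<alpha> * s (m - 1 - b) = coef A (a, b)"
    proof -
      have "root_coeff A \<alpha> * s (m - 1 - b) = coef A (a, b) * (s (m - 1 - b) * s (m - 1 - b))"
        by (simp add: root_coeff_def ab)
      then show ?thesis by (simp add: s2)
    qed
    have nz: "root_coeff A \<alpha> \<noteq> 0" using monomial_basic[OF A mono] \<alpha> by (simp add: basic_pair_def)
    have \<alpha>R: "\<alpha> \<in> roots t n" using \<alpha> D by blast
    obtain K where "K \<noteq> 0" "\<And>u. u \<in> U \<Longrightarrow> elementary_character \<theta> t n \<alpha> (root_coeff A \<alpha>) u =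
       K * (\<Sum>g\<in>T. \<theta> (root_coeff A \<alpha> * s (m - 1 - b) * (g * bil u * g\<^sup>T) $$ (a, b)))"
      using elementary_character_sum[OF \<alpha>R ab nz] by blast
    then show ?thesis unfolding c ab by blast
  qed
  then have "\<exists>K. \<forall>\<alpha>\<in>?D. K \<alpha> \<noteq> 0 \<and> (\<forall>u\<in>U. elementary_character \<theta> t n \<alpha> (root_coeff A \<alpha>) u =
       K \<alpha> * (\<Sum>g\<in>T. \<theta> (coef A (root_pair \<alpha>) * (g * bil u * g\<^sup>T) $$ root_pair \<alpha>)))"
    by (intro bchoice ballI)
  then obtain K where K: "\<And>\<alpha>. \<alpha> \<in> ?D \<Longrightarrow> K \<alpha> \<noteq> 0"
    "\<And>\<alpha> u. \<alpha> \<in> ?D \<Longrightarrow> u \<in> U \<Longrightarrow> elementary_character \<theta> t n \<alpha> (root_coeff A \<alpha>) u =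
       K \<alpha> * (\<Sum>g\<in>T. \<theta> (coef A (root_pair \<alpha>) * (g * bil u * g\<^sup>T) $$ root_pair \<alpha>))" by blast
  define N where "N = (of_nat (card T) :: complex)"
  have N: "N \<noteq> 0" using card_pos[of T] unitriangular_one unfolding N_def by auto
  define R where "R \<alpha> = {fst (root_pair \<alpha>), snd (root_pair \<alpha>)}" for \<alpha>
  have Rm: "R \<alpha> \<subseteq> {..<m}" if "\<alpha> \<in> ?D" for \<alpha>
  proof -
    have "root_pair \<alpha> \<in> {..<m} \<times> {..<m}" using root_pair_mem root_pairs_subset D that by blast
    then show ?thesis by (auto simp: R_def mem_Times_iff)
  qed
  have partner: "\<exists>q<m. A $$ (c, q) \<noteq> 0 \<and> (root_pair \<alpha> = (c, q) \<or> root_pair \<alpha> = (q, c))" if \<alpha>: "\<alpha> \<in> ?D" and c: "c \<in> R \<alpha>" for \<alpha> c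
  proof -
    obtain a b where ab: "root_pair \<alpha> = (a, b)" by force
    have m': "a < m" "b < m" using Rm[OF \<alpha>] by (auto simp: R_def ab)
    have "A $$ (a, b) \<noteq> 0" using \<alpha> ab by (simp add: root_set_def)
    then show ?thesis using c m' forms_sym_0[OF A m'] by (auto simp: R_def ab)
  qed
  have disj: "R \<alpha> \<inter> R \<beta> = {}" if ab: "\<alpha> \<in> ?D" "\<beta> \<in> ?D" "\<alpha> \<noteq> \<beta>" for \<alpha> \<beta>
  proof (rule ccontr)
    assume "R \<alpha> \<inter> R \<beta> \<noteq> {}"
    then obtain c where c: "c \<in> R \<alpha>" "c \<in> R \<beta>" by blast
    have cm: "c < m" using c(1) Rm[OF ab(1)] by blast
    obtain q where q: "q < m" "A $$ (c, q) \<noteq> 0" "root_pair \<alpha> = (c, q) \<or> root_pair \<alpha> = (q, c)"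
      using partner[OF ab(1) c(1)] by blast
    obtain q' where q': "q' < m" "A $$ (c, q') \<noteq> 0" "root_pair \<beta> = (c, q') \<or> root_pair \<beta> = (q', c)"
      using partner[OF ab(2) c(2)] by blast
    have "q = q'" using mono cm q(1,2) q'(1,2) unfolding monomial_def by blast
    moreover have "root_pair \<alpha> \<in> root_pairs" "root_pair \<beta> \<in> root_pairs" using ab D root_pair_mem by blast+
    ultimately have "root_pair \<alpha> = root_pair \<beta>"
      using q(3) q'(3) root_pairsD(1)[of c q] root_pairsD(1)[of q c] by auto
    then show False using ab D root_pair_inj by (auto dest: inj_onD)
  qed
  have eq: "supercharacter \<theta> t n ?D (root_coeff A) u = (\<Prod>\<alpha>\<in>?D. K \<alpha>) * (N ^ card ?D / N) * orbit_sum A u" if u: "u \<in> U" for u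
  proof -
    define \<psi> where "\<psi> \<alpha> g = \<theta> (coef A (root_pair \<alpha>) * (g * bil u * g\<^sup>T) $$ root_pair \<alpha>)" for \<alpha> g
    have Bf: "bil u \<in> forms" using bil_forms U_T[OF u] by blast
    have dep: "depends_on_rows (R \<alpha>) (\<psi> \<alpha>)" if \<alpha>: "\<alpha> \<in> ?D" for \<alpha>
      unfolding depends_on_rows_def
    proof (intro ballI impI)
      fix g h assume g: "g \<in> T" and h: "h \<in> T" and e: "\<forall>i\<in>R \<alpha>. \<forall>j<m. g $$ (i, j) = h $$ (i, j)"
      obtain a b where ab: "root_pair \<alpha> = (a, b)" by force
      have m': "a < m" "b < m" using Rm[OF \<alpha>] by (auto simp: R_def ab)
      have "(g * bil u * g\<^sup>T) $$ (a, b) = (h * bil u * h\<^sup>T) $$ (a, b)"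
        unfolding congruence_index[OF unitriangularD(1)[OF g] formsD(1)[OF Bf] m']
          congruence_index[OF unitriangularD(1)[OF h] formsD(1)[OF Bf] m']
        using e by (intro sum.cong refl) (auto simp: R_def ab)
      then show "\<psi> \<alpha> g = \<psi> \<alpha> h" by (simp add: \<psi>_def ab)
    qed
    have "supercharacter \<theta> t n ?D (root_coeff A) u = (\<Prod>\<alpha>\<in>?D. K \<alpha> * (\<Sum>g\<in>T. \<psi> \<alpha> g))"
      using u K(2) by (simp add: supercharacter_def \<psi>_def)
    also have "\<dots> = (\<Prod>\<alpha>\<in>?D. K \<alpha>) * (\<Prod>\<alpha>\<in>?D. \<Sum>g\<in>T. \<psi> \<alpha> g)" by (rule prod.distrib)
    also have "(\<Prod>\<alpha>\<in>?D. \<Sum>g\<in>T. \<psi> \<alpha> g) = N ^ card ?D / N * (\<Sum>g\<in>T. \<Prod>\<alpha>\<in>?D. \<psi> \<alpha> g)"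
    proof -
      have "N * (\<Prod>\<alpha>\<in>?D. \<Sum>g\<in>T. \<psi> \<alpha> g) = N ^ card ?D * (\<Sum>g\<in>T. \<Prod>\<alpha>\<in>?D. \<psi> \<alpha> g)"
        unfolding N_def by (rule prod_sum_independent[OF fin dep Rm disj])
      then show ?thesis using N by (simp add: field_simps)
    qed
    also have "(\<Sum>g\<in>T. \<Prod>\<alpha>\<in>?D. \<psi> \<alpha> g) = orbit_sum A u"
      unfolding orbit_sum_def
    proof (intro sum.cong refl)
      fix g assume g: "g \<in> T"
      define C where "C = g * bil u * g\<^sup>T"
      have C: "C \<in> forms" unfolding C_def by (rule congruence_forms[OF g Bf])
      have "pairing A C = (\<Sum>p\<in>root_pairs. coef A p * C $$ p)" by (rule pairing_root_pairs[OF A C])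
      also have "\<dots> = (\<Sum>p\<in>root_pair ` ?D. coef A p * C $$ p)"
      proof (rule sum.mono_neutral_right[OF finite_root_pairs])
        show "root_pair ` ?D \<subseteq> root_pairs" using D root_pair_mem by blast
        show "\<forall>p\<in>root_pairs - root_pair ` ?D. coef A p * C $$ p = 0"
        proof
          fix p assume p: "p \<in> root_pairs - root_pair ` ?D"
          obtain \<alpha> where \<alpha>: "\<alpha> \<in> roots t n" "root_pair \<alpha> = p"
            using p root_pair_surj[of "fst p" "snd p"] by auto
          then have "A $$ p = 0" using p by (auto simp: root_set_def)
          then show "coef A p * C $$ p = 0" by (simp add: coef_def)
        qed
      qed
      also have "\<dots> = (\<Sum>\<alpha>\<in>?D. coef A (root_pair \<alpha>) * C $$ root_pair \<alpha>)"
        by (rule sum.reindex[OF inj_on_subset[OF root_pair_inj D], unfolded o_def])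
      finally have "\<theta> (pairing A C) = (\<Prod>\<alpha>\<in>?D. \<psi> \<alpha> g)"
        by (simp add: \<theta>_sum[OF fin] \<psi>_def C_def)
      then show "(\<Prod>\<alpha>\<in>?D. \<psi> \<alpha> g) = \<theta> (pairing A (g * bil u * g\<^sup>T))" unfolding C_def by simp
    qed
    finally show ?thesis by (simp add: mult.assoc)
  qed
  have "(\<Prod>\<alpha>\<in>?D. K \<alpha>) * (N ^ card ?D / N) \<noteq> 0" using K(1) N fin by simp
  then show ?thesis using that eq by blast
qed

section \<open>Orbits of forms\<close>

text \<open>Adjoint to congruence by \<open>g\<close> with respect to \<open>pairing\<close>.
  Nothing is cut off here, so that the elimination can work with full matrices.\<close>

definition cotrans :: "'a mat \<Rightarrow> 'a mat \<Rightarrow> 'a mat" where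
  "cotrans g A = g\<^sup>T * A * g"

text \<open>As in \<open>forms\<close>, but without the zero region, which \<open>cotrans\<close>
  destroys: it moves entries down and to the right.\<close>

definition symm :: "'a mat \<Rightarrow> bool" where
  "symm A \<longleftrightarrow> A \<in> carrier_mat m m \<and> (\<forall>k<m. \<forall>l<m. A $$ (l, k) = - \<sigma> * A $$ (k, l))"

lemma symmD:
  assumes "symm A"
  shows "A \<in> carrier_mat m m" "\<And>k l. k < m \<Longrightarrow> l < m \<Longrightarrow> A $$ (l, k) = - \<sigma> * A $$ (k, l)"
    "\<And>k l. k < m \<Longrightarrow> l < m \<Longrightarrow> A $$ (k, l) = 0 \<Longrightarrow> A $$ (l, k) = 0"
proof -
  show 1: "A \<in> carrier_mat m m" using assms unfolding symm_def by blast
  show 2: "A $$ (l, k) = - \<sigma> * A $$ (k, l)" if "k < m" "l < m" for k l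
    using assms that unfolding symm_def by blast
  show "A $$ (l, k) = 0" if "k < m" "l < m" "A $$ (k, l) = 0" for k l
    using 2[OF that(1,2)] that(3) by simp
qed

lemma cotrans_index:
  assumes g: "g \<in> carrier_mat m m" and A: "A \<in> carrier_mat m m" and "i < m" "j < m"
  shows "cotrans g A $$ (i, j) = (\<Sum>c<m. \<Sum>d<m. g $$ (c, i) * A $$ (c, d) * g $$ (d, j))"
proof -
  have "g\<^sup>T \<in> carrier_mat m m" using g by simp
  from sandwich_index[OF this A g assms(3,4)] show ?thesis
    unfolding cotrans_def using assms by (auto intro!: sum.cong)
qed

lemma cotrans_mult:
  assumes "g \<in> carrier_mat m m" "h \<in> carrier_mat m m" "A \<in> carrier_mat m m"
  shows "cotrans h (cotrans g A) = cotrans (g * h) A"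
  using assms unfolding cotrans_def
  by (simp add: transpose_mult[OF assms(1,2)] assoc mult_carrier_mat[of _ m m _ m])

lemma cotrans_symm:
  assumes g: "g \<in> carrier_mat m m" and A: "symm A"
  shows "symm (cotrans g A)"
proof -
  note Ad = symmD[OF A]
  have "cotrans g A $$ (l, k) = - \<sigma> * cotrans g A $$ (k, l)" if "k < m" "l < m" for k l
  proof -
    have "cotrans g A $$ (l, k) = (\<Sum>c<m. \<Sum>d<m. g $$ (c, l) * A $$ (c, d) * g $$ (d, k))"
      by (rule cotrans_index[OF g Ad(1) that(2,1)])
    also have "\<dots> = (\<Sum>d<m. \<Sum>c<m. g $$ (c, l) * A $$ (c, d) * g $$ (d, k))" by (rule sum.swap)
    also have "\<dots> = (\<Sum>d<m. \<Sum>c<m. - \<sigma> * (g $$ (d, k) * A $$ (d, c) * g $$ (c, l)))"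
    proof (intro sum.cong refl)
      fix d c assume "d \<in> {..<m}" "c \<in> {..<m}"
      then have "A $$ (c, d) = - \<sigma> * A $$ (d, c)" using Ad(2)[of d c] by simp
      then show "g $$ (c, l) * A $$ (c, d) * g $$ (d, k) = - \<sigma> * (g $$ (d, k) * A $$ (d, c) * g $$ (c, l))"
        by (simp only: ac_simps mult_minus_left mult_minus_right)
    qed
    also have "\<dots> = - \<sigma> * cotrans g A $$ (k, l)"
      unfolding cotrans_index[OF g Ad(1) that] by (simp only: sum_distrib_left)
    finally show ?thesis .
  qed
  moreover have "cotrans g A \<in> carrier_mat m m"
    using g Ad(1) unfolding cotrans_def by (intro mult_carrier_mat[of _ m m]) auto
  ultimately show ?thesis unfolding symm_def by blast
qed

section \<open>Symmetric Gaussian elimination\<close>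

definition row_op :: "nat \<Rightarrow> (nat \<Rightarrow> 'a) \<Rightarrow> 'a mat" where
  "row_op k f = mat m m (\<lambda>(i, j). if i = j then 1 else if i = k \<and> k < j then f j else 0)"

lemma row_op_T: "row_op k f \<in> T"
  by (rule unitriangularI) (auto simp: row_op_def)

lemma row_op_cotrans:
  assumes k: "k < m" and A: "A \<in> carrier_mat m m" and ij: "i < m" "j < m" and f: "\<And>j. j \<le> k \<Longrightarrow> f j = 0"
  shows "cotrans (row_op k f) A $$ (i, j) =
    A $$ (i, j) + f j * A $$ (i, k) + f i * (A $$ (k, j) + f j * A $$ (k, k))"
proof -
  let ?g = "row_op k f"
  have g: "?g \<in> carrier_mat m m" by (simp add: row_op_def)
  have e: "?g $$ (c, i) = (if c = i then 1 else 0) + (if c = k then f i else 0)" if "c < m" "i < m" for c i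
    using that f by (auto simp: row_op_def not_less)
  have inner: "(\<Sum>d<m. A $$ (c, d) * ?g $$ (d, j)) = A $$ (c, j) + f j * A $$ (c, k)" for c
  proof -
    have "(\<Sum>d<m. A $$ (c, d) * ?g $$ (d, j)) = (\<Sum>d<m. (if d = j then A $$ (c, j) else 0) + (if d = k then f j * A $$ (c, k) else 0))"
      by (intro sum.cong refl) (simp add: e ij distrib_left mult.commute)
    then show ?thesis using ij k by (simp add: sum.distrib)
  qed
  have "cotrans ?g A $$ (i, j) = (\<Sum>c<m. ?g $$ (c, i) * (\<Sum>d<m. A $$ (c, d) * ?g $$ (d, j)))"
    unfolding cotrans_index[OF g A ij] by (simp add: sum_distrib_left mult.assoc)
  also have "\<dots> = (\<Sum>c<m. (if c = i then A $$ (i, j) + f j * A $$ (i, k) else 0) + (if c = k then f i * (A $$ (k, j) + f j * A $$ (k, k)) else 0))"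
    unfolding inner by (intro sum.cong refl) (simp add: e ij distrib_right)
  finally show ?thesis using ij k by (simp add: sum.distrib)
qed

text \<open>The invariant of the symmetric Gaussian elimination.\<close>

definition reduced :: "nat \<Rightarrow> 'a mat \<Rightarrow> bool" where
  "reduced k A \<longleftrightarrow> (\<forall>c<k. \<forall>d<m. A $$ (c, d) \<noteq> 0 \<longrightarrow>
     (\<forall>e<m. A $$ (c, e) \<noteq> 0 \<longrightarrow> e = d) \<and> (\<forall>e<m. A $$ (e, d) \<noteq> 0 \<longrightarrow> e = c))"

lemma reducedD:
  assumes "reduced k A" "c < k" "d < m" "A $$ (c, d) \<noteq> 0" "e < m"
  shows "e \<noteq> d \<Longrightarrow> A $$ (c, e) = 0" "e \<noteq> c \<Longrightarrow> A $$ (e, d) = 0"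
  using assms unfolding reduced_def by blast+

text \<open>Earlier rows survive an operation with index \<open>k0\<close>: their entries in column
  \<open>k0\<close> vanish, and the operation leaves the columns of their pivots alone.\<close>

lemma reduced_row_op:
  assumes A: "symm A" and red: "reduced k A" and k0: "k \<le> k0" "k0 < m" and f: "\<And>j. j \<le> k0 \<Longrightarrow> f j = 0"
    and z: "\<And>c. c < k \<Longrightarrow> A $$ (c, k0) = 0"
    and p: "\<And>c d. c < k \<Longrightarrow> d < m \<Longrightarrow> A $$ (c, d) \<noteq> 0 \<Longrightarrow> f d = 0 \<and> A $$ (k0, d) = 0"
  shows "reduced k (cotrans (row_op k0 f) A)" "\<And>c d. c < k \<Longrightarrow> d < m \<Longrightarrow> cotrans (row_op k0 f) A $$ (c, d) = A $$ (c, d)"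
proof -
  note idx = row_op_cotrans[where f = f, OF k0(2) symmD(1)[OF A] _ _ f]
  show row: "cotrans (row_op k0 f) A $$ (c, d) = A $$ (c, d)" if "c < k" "d < m" for c d
    using idx[of c d] that k0 z[of c] f[of c] by simp
  have col: "cotrans (row_op k0 f) A $$ (e, d) = A $$ (e, d)" if "c < k" "d < m" "A $$ (c, d) \<noteq> 0" "e < m" for c d e
    using idx[of e d] that p[OF that(1-3)] by simp
  show "reduced k (cotrans (row_op k0 f) A)"
    unfolding reduced_def
  proof (intro allI impI conjI)
    fix c d e assume c: "c < k" and d: "d < m" and e: "e < m" and nz: "cotrans (row_op k0 f) A $$ (c, d) \<noteq> 0"
    have nz': "A $$ (c, d) \<noteq> 0" using nz row[OF c d] by simp
    show "e = d" if "cotrans (row_op k0 f) A $$ (c, e) \<noteq> 0"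
      using reducedD(1)[OF red c d nz' e] that row[OF c e] by auto
    show "e = c" if "cotrans (row_op k0 f) A $$ (e, d) \<noteq> 0"
      using reducedD(2)[OF red c d nz' e] that col[OF c d nz' e] by auto
  qed
qed

lemma reduced_Suc:
  assumes "reduced k A" and "\<And>d. d < m \<Longrightarrow> A $$ (k, d) \<noteq> 0 \<Longrightarrow>
     (\<forall>e<m. A $$ (k, e) \<noteq> 0 \<longrightarrow> e = d) \<and> (\<forall>e<m. A $$ (e, d) \<noteq> 0 \<longrightarrow> e = k)"
  shows "reduced (Suc k) A"
  using assms unfolding reduced_def less_Suc_eq by blast

text \<open>Row \<open>k\<close> is empty, or it meets an earlier pivot in a column
  \<open>d < k\<close> and is settled together with row \<open>d\<close> by symmetry, or its
  leftmost entry becomes a pivot in column \<open>d \<ge> k\<close>. The operations only add to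
  later rows and columns, which is why the leftmost entry is taken. For \<open>k < d\<close>, column
  \<open>d\<close> first clears row \<open>k\<close>, and then row \<open>k\<close> clears column
  \<open>d\<close>; symmetry takes care of the mirror images.\<close>

lemma reduce_step:
  assumes A: "symm A" and red: "reduced k A" and k: "k < m"
  obtains g where "g \<in> T" "reduced (Suc k) (cotrans g A)"
proof -
  note Ad = symmD[OF A]
  have one: "cotrans (1\<^sub>m m) A = A"
    unfolding cotrans_def using left_mult_one_mat[OF Ad(1)] right_mult_one_mat[OF Ad(1)] by simp
  consider (zero) "\<forall>d<m. A $$ (k, d) = 0" | (old) d where "d < k" "A $$ (k, d) \<noteq> 0"
    | (new) d where "d < m" "A $$ (k, d) \<noteq> 0" "\<forall>d<k. A $$ (k, d) = 0" by blast
  then show ?thesis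
  proof cases
    case zero
    then have "reduced (Suc k) A" by (intro reduced_Suc[OF red]) auto
    then show ?thesis using that[OF unitriangular_one] one by simp
  next
    case (old d)
    have dm: "d < m" using old k by simp
    have dk: "A $$ (d, k) \<noteq> 0" using old Ad(3)[OF dm k] by blast
    have row: "e = d" if "e < m" "A $$ (k, e) \<noteq> 0" for e
      using reducedD(2)[OF red old(1) k dk that(1)] Ad(3)[OF that(1) k] that(2) by blast
    have col: "e = k" if "e < m" "A $$ (e, d) \<noteq> 0" for e
      using reducedD(1)[OF red old(1) k dk that(1)] Ad(3)[OF dm that(1)] that(2) by blast
    have "reduced (Suc k) A" by (intro reduced_Suc[OF red]) (use row col in blast)
    then show ?thesis using that[OF unitriangular_one] one by simp
  next
    case (new d0)
    define d where "d = (LEAST d. d < m \<and> A $$ (k, d) \<noteq> 0)"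
    have d: "d < m" "A $$ (k, d) \<noteq> 0"
      using LeastI[of "\<lambda>d. d < m \<and> A $$ (k, d) \<noteq> 0" d0] new unfolding d_def by auto
    have dmin: "A $$ (k, e) = 0" if "e < d" for e
      using not_less_Least[of e "\<lambda>d. d < m \<and> A $$ (k, d) \<noteq> 0"] that d(1) unfolding d_def[symmetric] by auto
    have kd: "k \<le> d" using new(3) d(2) by (meson not_le)
    have ck: "A $$ (c, k) = 0" if "c < k" for c using Ad(3)[OF k, of c] new(3) that k by auto
    have cd: "A $$ (c, d) = 0" if "c < k" for c
      using reducedD(2)[OF red that d(1) _ k] d(2) that by blast
    have piv: "A $$ (e, d') = 0" if "c < k" "d' < m" "A $$ (c, d') \<noteq> 0" "k \<le> e" "e < m" for c d' e
      using reducedD(2)[OF red that(1-3,5)] that by simp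
    show ?thesis
    proof (cases "k = d")
      case True
      define f where "f j = (if k < j then - A $$ (k, j) / A $$ (k, k) else 0)" for j
      have f0: "f j = 0" if "j \<le> k" for j using that by (simp add: f_def)
      let ?B = "cotrans (row_op k f) A"
      note idx = row_op_cotrans[where f = f, OF k Ad(1) _ _ f0]
      have B: "symm ?B" by (rule cotrans_symm[OF unitriangularD(1)[OF row_op_T] A])
      have red': "reduced k ?B"
        by (rule reduced_row_op(1)[where f = f, OF A red order_refl k f0 ck]) (use piv k in \<open>auto simp: f_def\<close>)
      have row: "?B $$ (k, e) = 0" if "e < m" "e \<noteq> k" for e
        using idx[OF k that(1)] f0[of k] dmin[of e] d(2) that True by (cases "k < e") (auto simp: f_def)
      have col: "?B $$ (e, k) = 0" if "e < m" "e \<noteq> k" for e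
        using symmD(3)[OF B k that(1)] row[OF that] by blast
      have "reduced (Suc k) ?B" by (intro reduced_Suc[OF red']) (use row col in blast)
      then show ?thesis using that row_op_T by blast
    next
      case False
      then have lt: "k < d" using kd by simp
      define f where "f j = (if d < j then - A $$ (k, j) / A $$ (k, d) else 0)" for j
      have f0: "f j = 0" if "j \<le> d" for j using that by (simp add: f_def)
      define B where "B = cotrans (row_op d f) A"
      note idx = row_op_cotrans[where f = f, OF d(1) Ad(1) _ _ f0, folded B_def]
      have B: "symm B" unfolding B_def by (rule cotrans_symm[OF unitriangularD(1)[OF row_op_T] A])
      note Bd = symmD[OF B]
      have pf: "f d' = 0 \<and> A $$ (d, d') = 0" if "c < k" "d' < m" "A $$ (c, d') \<noteq> 0" for c d'
        using piv[OF that order_refl k] piv[OF that kd d(1)] by (simp add: f_def)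
      have redB: "reduced k B"
        unfolding B_def by (rule reduced_row_op(1)[where f = f, OF A red kd d(1)]) (use f0 cd pf in blast)+
      have rowB: "B $$ (c, e) = A $$ (c, e)" if "c < k" "e < m" for c e
        unfolding B_def by (rule reduced_row_op(2)[where f = f, OF A red kd d(1) _ _ _ that]) (use f0 cd pf in blast)+
      have Bk: "B $$ (k, e) = 0" if "e < m" "e \<noteq> d" for e
        using idx[OF k that(1)] f0[of k] dmin[of e] d(2) that lt by (cases "d < e") (auto simp: f_def)
      have Bkd: "B $$ (k, d) \<noteq> 0"
        using idx[OF k d(1)] f0[of k] f0[of d] d(2) lt by simp
      \<comment> \<open>The entry \<open>(d, d)\<close> is altered both as part of row
        \<open>d\<close> and of column \<open>d\<close>, hence half the usual multiple. This
        concerns the symplectic case; otherwise \<open>B\<close> is skew-symmetric and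
        \<open>B $$ (d, d)\<close> is already zero.\<close>
      define h where "h j = (if k < j then if j = d then - B $$ (d, d) / (2 * B $$ (k, d)) else - B $$ (j, d) / B $$ (k, d) else 0)" for j
      have h0: "h j = 0" if "j \<le> k" for j using that by (simp add: h_def)
      define C where "C = cotrans (row_op k h) B"
      note idxC = row_op_cotrans[where f = h, OF k Bd(1) _ _ h0, folded C_def]
      have Bck: "B $$ (c, k) = 0" if "c < k" for c using rowB[OF that k] ck[OF that] by simp
      have ph: "h d' = 0 \<and> B $$ (k, d') = 0" if "c < k" "d' < m" "B $$ (c, d') \<noteq> 0" for c d'
      proof -
        have col: "B $$ (e, d') = 0" if "e < m" "k \<le> e" for e
          using reducedD(2)[OF redB \<open>c < k\<close> \<open>d' < m\<close> \<open>B $$ (c, d') \<noteq> 0\<close> that(1)] that(2) \<open>c < k\<close> by simp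
        have "d' \<noteq> d" using rowB[OF that(1) d(1)] cd[OF that(1)] that(3) by auto
        moreover have "B $$ (d', d) = 0" using Bd(3)[OF d(1) that(2) col[OF d(1) kd]] .
        ultimately show ?thesis using col[OF k order_refl] by (simp add: h_def)
      qed
      have redC: "reduced k C"
        unfolding C_def by (rule reduced_row_op(1)[where f = h, OF B redB order_refl k]) (use h0 Bck ph in blast)+
      have Bkk: "B $$ (k, k) = 0" using Bk[OF k] lt by simp
      have rowC: "C $$ (k, e) = B $$ (k, e)" if "e < m" for e
        using idxC[OF k that] h0[of k] Bkk by simp
      have colC: "C $$ (e, d) = 0" if e: "e < m" "e \<noteq> k" for e
      proof -
        have ix: "C $$ (e, d) = B $$ (e, d) + h d * B $$ (e, k) + h e * B $$ (k, d)"
          using idxC[OF e(1) d(1)] Bkk by simp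
        show ?thesis
        proof (cases "e = d")
          case True
          have dk: "B $$ (d, k) = - \<sigma> * B $$ (k, d)" by (rule Bd(2)[OF k d(1)])
          show ?thesis
          proof (cases "t = Sp_even")
            case True
            then have "\<sigma> = -1" by (rule \<sigma>_cases)
            then have "C $$ (d, d) = B $$ (d, d) + 2 * h d * B $$ (k, d)"
              using ix \<open>e = d\<close> dk by (simp add: algebra_simps)
            then show ?thesis using \<open>e = d\<close> lt two Bkd by (simp add: h_def)
          next
            case False
            then have "\<sigma> = 1" by (rule \<sigma>_cases)
            then have "2 * B $$ (d, d) = 0" using Bd(2)[OF d(1) d(1)] by (simp add: eq_neg_iff_add_eq_0)
            then have "B $$ (d, d) = 0" using two by simp
            then show ?thesis using ix \<open>e = d\<close> by (simp add: h_def)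
          qed
        next
          case ne: False
          have ek: "B $$ (e, k) = 0" using Bd(3)[OF k e(1) Bk[OF e(1) ne]] .
          show ?thesis
          proof (cases "e < k")
            case True
            then show ?thesis using ix ek h0[of e] rowB[OF True d(1)] cd[OF True] by simp
          next
            case False
            then show ?thesis using ix ek ne e Bkd by (simp add: h_def)
          qed
        qed
      qed
      have "reduced (Suc k) C"
      proof (intro reduced_Suc[OF redC])
        fix d' assume d': "d' < m" "C $$ (k, d') \<noteq> 0"
        then have "d' = d" using rowC Bk by auto
        then show "(\<forall>e<m. C $$ (k, e) \<noteq> 0 \<longrightarrow> e = d') \<and> (\<forall>e<m. C $$ (e, d') \<noteq> 0 \<longrightarrow> e = k)"
          using rowC Bk colC by auto
      qed
      moreover have "C = cotrans (row_op d f * row_op k h) A"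
        unfolding C_def B_def
        by (rule cotrans_mult[OF unitriangularD(1)[OF row_op_T] unitriangularD(1)[OF row_op_T] Ad(1)])
      moreover have "row_op d f * row_op k h \<in> T" by (intro unitriangular_mult row_op_T)
      ultimately show ?thesis using that by simp
    qed
  qed
qed

lemma reduce:
  assumes A: "symm A" and "k \<le> m"
  shows "\<exists>g\<in>T. reduced k (cotrans g A)"
  using assms(2)
proof (induction k)
  case 0
  have "1\<^sub>m m \<in> T" by (rule unitriangular_one)
  then show ?case by (auto simp: reduced_def)
next
  case (Suc k)
  then obtain g where g: "g \<in> T" "reduced k (cotrans g A)" by auto
  have s: "symm (cotrans g A)" by (rule cotrans_symm[OF unitriangularD(1)[OF g(1)] A])
  obtain h where h: "h \<in> T" "reduced (Suc k) (cotrans h (cotrans g A))"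
    using reduce_step[OF s g(2)] Suc.prems by auto
  have "cotrans h (cotrans g A) = cotrans (g * h) A"
    by (rule cotrans_mult[OF unitriangularD(1)[OF g(1)] unitriangularD(1)[OF h(1)] symmD(1)[OF A]])
  then show ?case using h unitriangular_mult[OF g(1) h(1)] by auto
qed

text \<open>The coadjoint action. Entries outside the triangle \<open>k + l + 1 < m\<close> are
  invisible to the pairing with forms, and setting them to zero leads back to
  \<open>forms\<close>.\<close>

definition act :: "'a mat \<Rightarrow> 'a mat \<Rightarrow> 'a mat" where
  "act g A = mat m m (\<lambda>(k, l). if k + l + 1 < m then cotrans g A $$ (k, l) else 0)"

lemma forms_symm: "A \<in> forms \<Longrightarrow> symm A"
  unfolding forms_def symm_def by blast

lemma act_forms:
  assumes g: "g \<in> T" and A: "A \<in> forms"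
  shows "act g A \<in> forms"
proof -
  have s: "symm (cotrans g A)" by (rule cotrans_symm[OF unitriangularD(1)[OF g] forms_symm[OF A]])
  have "act g A $$ (l, k) = - \<sigma> * act g A $$ (k, l)" if "k < m" "l < m" for k l
    using that symmD(2)[OF s that] by (simp add: act_def add.commute)
  moreover have "act g A \<in> carrier_mat m m" "\<forall>k<m. \<forall>l<m. m \<le> k + l + 1 \<longrightarrow> act g A $$ (k, l) = 0"
    by (auto simp: act_def)
  ultimately show ?thesis unfolding forms_def by blast
qed

text \<open>Both sides are the sum of
  \<open>A $$ (k, l) * g $$ (k, c) * B $$ (c, d) * g $$ (l, d)\<close> over all four indices. The
  truncation in \<open>act\<close> is harmless because \<open>B\<close> vanishes there.\<close>

lemma pairing_act:
  assumes g: "g \<in> T" and A: "A \<in> forms" and B: "B \<in> forms"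
  shows "pairing A (g * B * g\<^sup>T) = pairing (act g A) B"
proof -
  note gc = unitriangularD(1)[OF g] and Ac = formsD(1)[OF A] and Bc = formsD(1)[OF B]
  let ?f = "\<lambda>k l c d. A $$ (k, l) * (g $$ (k, c) * B $$ (c, d) * g $$ (l, d))"
  have "pairing A (g * B * g\<^sup>T) = (\<Sum>k<m. \<Sum>l<m. \<Sum>c<m. \<Sum>d<m. ?f k l c d)"
    unfolding pairing_def by (intro sum.cong refl) (simp add: congruence_index[OF gc Bc] sum_distrib_left)
  also have "\<dots> = (\<Sum>k<m. \<Sum>c<m. \<Sum>l<m. \<Sum>d<m. ?f k l c d)" by (rule sum.cong[OF refl], rule sum.swap)
  also have "\<dots> = (\<Sum>k<m. \<Sum>c<m. \<Sum>d<m. \<Sum>l<m. ?f k l c d)"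
    by (rule sum.cong[OF refl], rule sum.cong[OF refl], rule sum.swap)
  also have "\<dots> = (\<Sum>c<m. \<Sum>k<m. \<Sum>d<m. \<Sum>l<m. ?f k l c d)" by (rule sum.swap)
  also have "\<dots> = (\<Sum>c<m. \<Sum>d<m. \<Sum>k<m. \<Sum>l<m. ?f k l c d)" by (rule sum.cong[OF refl], rule sum.swap)
  also have "\<dots> = (\<Sum>c<m. \<Sum>d<m. act g A $$ (c, d) * B $$ (c, d))"
  proof (rule sum.cong[OF refl], rule sum.cong[OF refl])
    fix c d assume cd: "c \<in> {..<m}" "d \<in> {..<m}"
    have "(\<Sum>k<m. \<Sum>l<m. ?f k l c d) = cotrans g A $$ (c, d) * B $$ (c, d)"
      using cd by (simp add: cotrans_index[OF gc Ac] sum_distrib_left sum_distrib_right mult_ac)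
    also have "\<dots> = act g A $$ (c, d) * B $$ (c, d)"
      using cd formsD(3)[OF B, of c d] by (cases "c + d + 1 < m") (auto simp: act_def)
    finally show "(\<Sum>k<m. \<Sum>l<m. ?f k l c d) = act g A $$ (c, d) * B $$ (c, d)" .
  qed
  finally show ?thesis unfolding pairing_def .
qed

lemma orbit_sum_eq:
  assumes "A \<in> forms" "u \<in> T"
  shows "orbit_sum A u = (\<Sum>g\<in>T. \<theta> (pairing (act g A) (bil u)))"
  unfolding orbit_sum_def using pairing_act[OF _ assms(1) bil_forms[OF assms(2)]] by simp

lemma orbit_sum_act:
  assumes A: "A \<in> forms" and g: "g \<in> T" and u: "u \<in> T"
  shows "orbit_sum (act g A) u = orbit_sum A u"
proof -
  have "orbit_sum (act g A) u = (\<Sum>h\<in>T. \<theta> (pairing A (g * h * bil u * (g * h)\<^sup>T)))"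
    unfolding orbit_sum_def
  proof (intro sum.cong refl)
    fix h assume h: "h \<in> T"
    have "pairing (act g A) (h * bil u * h\<^sup>T) = pairing A (g * (h * bil u * h\<^sup>T) * g\<^sup>T)"
      by (rule pairing_act[OF g A congruence_forms[OF h bil_forms[OF u]], symmetric])
    also have "g * (h * bil u * h\<^sup>T) * g\<^sup>T = g * h * bil u * (g * h)\<^sup>T"
      by (rule congruence_mult[symmetric]) (use g h u unitriangularD(1) bil_forms formsD(1) in blast)+
    finally show "\<theta> (pairing (act g A) (h * bil u * h\<^sup>T)) = \<theta> (pairing A (g * h * bil u * (g * h)\<^sup>T))" by simp
  qed
  also have "\<dots> = orbit_sum A u"
    unfolding orbit_sum_def
    by (rule translate_sum[of T g "\<lambda>h. \<theta> (pairing A (h * bil u * h\<^sup>T))"]) (use g unitriangular_mult in auto)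
  finally show ?thesis .
qed

text \<open>Truncation only deletes entries, so it cannot spoil the result of the complete
  elimination.\<close>

lemma monomial_representative:
  assumes A: "A \<in> forms"
  obtains g where "g \<in> T" "monomial (act g A)"
proof -
  obtain g where g: "g \<in> T" "reduced m (cotrans g A)" using reduce[OF forms_symm[OF A] order_refl] by blast
  have "monomial (act g A)"
    unfolding monomial_def
  proof (intro allI impI)
    fix k l l' assume "k < m" "l < m" "l' < m" "act g A $$ (k, l) \<noteq> 0" "act g A $$ (k, l') \<noteq> 0"
    moreover from this have "cotrans g A $$ (k, l) \<noteq> 0" "cotrans g A $$ (k, l') \<noteq> 0"
      by (auto simp: act_def split: if_splits)
    ultimately show "l = l'" using g(2) unfolding reduced_def by blast
  qed
  then show ?thesis using that g(1) by blast
qed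

definition unit_form :: "nat \<times> nat \<Rightarrow> 'a \<Rightarrow> 'a mat" where
  "unit_form p x = mat m m (\<lambda>(k, l). if (k, l) = p then x else if (l, k) = p then - \<sigma> * x else 0)"

lemma unit_form:
  assumes p: "p \<in> root_pairs"
  shows "unit_form p x \<in> forms" "A \<in> forms \<Longrightarrow> pairing A (unit_form p x) = coef A p * x"
proof -
  obtain a b where ab: "p = (a, b)" by force
  note d = root_pairsD[OF p[unfolded ab]]
  have idx: "unit_form p x $$ (i, j) = (if (i, j) = (a, b) then x else if (j, i) = (a, b) then - \<sigma> * x else 0)"
    if "i < m" "j < m" for i j using that by (simp add: unit_form_def ab)
  show F: "unit_form p x \<in> forms"
    unfolding forms_def
  proof (intro CollectI conjI allI impI)
    show "unit_form p x \<in> carrier_mat m m" by (simp add: unit_form_def)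
    fix k l assume kl: "k < m" "l < m"
    have x2: "- \<sigma> * (- \<sigma> * x) = x" using \<sigma>2 by (simp flip: mult.assoc)
    show "unit_form p x $$ (l, k) = - \<sigma> * unit_form p x $$ (k, l)"
    proof (cases "(k, l) = (a, b)")
      case True
      show ?thesis
      proof (cases "(l, k) = (a, b)")
        case both: True
        have "k = a" "k = b" using True both by blast+
        then have "a = b" by (rule trans[OF sym])
        then have "\<sigma> = -1" using d(6) by blast
        then show ?thesis unfolding idx[OF kl] idx[OF kl(2,1)] if_P[OF True] if_P[OF both] by simp
      next
        case ne: False
        show ?thesis unfolding idx[OF kl] idx[OF kl(2,1)] if_P[OF True] if_not_P[OF ne] ..
      qed
    next
      case ne: False
      show ?thesis unfolding idx[OF kl] idx[OF kl(2,1)] if_not_P[OF ne]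
        by (simp only: x2 mult_zero_right split: if_split) blast
    qed
    show "unit_form p x $$ (k, l) = 0" if ge: "m \<le> k + l + 1"
    proof -
      have ne: "(k, l) \<noteq> (a, b)" "(l, k) \<noteq> (a, b)" using ge d(5) by auto
      show ?thesis unfolding idx[OF kl] if_not_P[OF ne(1)] if_not_P[OF ne(2)] ..
    qed
  qed
  show "pairing A (unit_form p x) = coef A p * x" if A: "A \<in> forms"
  proof -
    have "pairing A (unit_form p x) = (\<Sum>q\<in>root_pairs. coef A q * unit_form p x $$ q)"
      by (rule pairing_root_pairs[OF A F])
    also have "\<dots> = (\<Sum>q\<in>root_pairs. if q = p then coef A p * x else 0)"
    proof (intro sum.cong refl)
      fix q assume q: "q \<in> root_pairs"
      obtain k l where kl: "q = (k, l)" by force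
      note d' = root_pairsD[OF q[unfolded kl]]
      show "coef A q * unit_form p x $$ q = (if q = p then coef A p * x else 0)"
      proof (cases "q = p")
        case True
        then show ?thesis using idx[OF d(3,4)] by (simp add: ab)
      next
        case False
        then have ne: "(k, l) \<noteq> (a, b)" "(l, k) \<noteq> (a, b)" using d(1) d'(1) by (auto simp: ab kl)
        have "unit_form p x $$ q = 0" unfolding kl idx[OF d'(3,4)] if_not_P[OF ne(1)] if_not_P[OF ne(2)] ..
        then show ?thesis using False by simp
      qed
    qed
    also have "\<dots> = coef A p * x" using p finite_root_pairs by simp
    finally show ?thesis .
  qed
qed

section \<open>Orthogonality of orbit sums\<close>

lemma pairing_add:
  assumes "A \<in> carrier_mat m m" "B \<in> carrier_mat m m" "C \<in> carrier_mat m m"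
  shows "pairing A (B + C) = pairing A B + pairing A C"
  unfolding pairing_def sum.distrib[symmetric] using assms by (intro sum.cong refl) (simp add: distrib_left)

lemma forms_add: "B \<in> forms \<Longrightarrow> C \<in> forms \<Longrightarrow> B + C \<in> forms"
proof -
  assume B: "B \<in> forms" and C: "C \<in> forms"
  have c: "B \<in> carrier_mat m m" "C \<in> carrier_mat m m" using B C formsD(1) by blast+
  have "(B + C) $$ (l, k) = - \<sigma> * (B + C) $$ (k, l)" if "k < m" "l < m" for k l
    using formsD(2)[OF B that] formsD(2)[OF C that] c that by (simp add: algebra_simps)
  moreover have "(B + C) $$ (k, l) = 0" if "k < m" "l < m" "m \<le> k + l + 1" for k l
    using formsD(3)[OF B that] formsD(3)[OF C that] c that by simp
  ultimately show "B + C \<in> forms" using add_carrier_mat[OF c(2), of B] unfolding forms_def by blast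
qed

text \<open>\<open>C\<close> and \<open>C'\<close> define distinct characters of the additive group
  \<open>forms\<close>: a suitable multiple of the unit form at a position where they differ tells
  them apart, and translation by it gives the twist.\<close>

lemma orthogonality:
  assumes C: "C \<in> forms" and C': "C' \<in> forms" and ne: "C \<noteq> C'"
  shows "(\<Sum>B\<in>forms. \<theta> (pairing C B - pairing C' B)) = 0"
proof -
  obtain p where p: "p \<in> root_pairs" "C $$ p \<noteq> C' $$ p" using forms_eqI[OF C C'] ne by blast
  have "coef C p - coef C' p \<noteq> 0" using p(2) two by (simp add: coef_def)
  then obtain x where x: "\<theta> ((coef C p - coef C' p) * x) \<noteq> 1" using \<theta>_nontrivial by blast
  let ?E = "unit_form p x"
  note E = unit_form[OF p(1), where x = x]
  have Ec: "?E \<in> carrier_mat m m" using E(1) formsD(1) by blast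
  have inj: "inj_on (\<lambda>B. ?E + B) forms"
  proof (rule inj_onI)
    fix B B' assume B: "B \<in> forms" "B' \<in> forms" and e: "?E + B = ?E + B'"
    have c: "B \<in> carrier_mat m m" "B' \<in> carrier_mat m m" using B formsD(1) by blast+
    show "B = B'"
    proof (rule eq_matI)
      fix i j assume "i < dim_row B'" "j < dim_col B'"
      then have ij: "i < m" "j < m" using c by auto
      have "(?E + B) $$ (i, j) = (?E + B') $$ (i, j)" unfolding e ..
      then show "B $$ (i, j) = B' $$ (i, j)" using ij c Ec by simp
    qed (use c in auto)
  qed
  have im: "(\<lambda>B. ?E + B) ` forms = forms"
    by (rule endo_inj_surj[OF finite_forms _ inj]) (use forms_add[OF E(1)] in blast)
  show ?thesis
  proof (rule sum_zero_of_twist[where h = "\<lambda>B. ?E + B" and z = "\<theta> ((coef C p - coef C' p) * x)"])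
    show "(\<Sum>B\<in>forms. \<theta> (pairing C (?E + B) - pairing C' (?E + B))) = (\<Sum>B\<in>forms. \<theta> (pairing C B - pairing C' B))"
      using sum.reindex[OF inj, of "\<lambda>B. \<theta> (pairing C B - pairing C' B)"] im by simp
    fix B assume B: "B \<in> forms"
    have "pairing C (?E + B) - pairing C' (?E + B) = (coef C p - coef C' p) * x + (pairing C B - pairing C' B)"
      using pairing_add[OF formsD(1)[OF C] Ec formsD(1)[OF B]] pairing_add[OF formsD(1)[OF C'] Ec formsD(1)[OF B]]
        E(2)[OF C] E(2)[OF C'] by (simp add: algebra_simps)
    then show "\<theta> (pairing C (?E + B) - pairing C' (?E + B)) =
      \<theta> ((coef C p - coef C' p) * x) * \<theta> (pairing C B - pairing C' B)" by (simp only: \<theta>_add)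
  qed (rule x)
qed

text \<open>Inversion in \<open>U\<close> negates \<open>bil\<close>, so the bijection
  \<open>bil\<close> turns the sum into a double sum of inner products of additive characters of
  \<open>forms\<close>. Only equal characters contribute, hence the two orbits share a
  point.\<close>

lemma orbit_sums_orthogonal:
  assumes A: "A \<in> forms" and A': "A' \<in> forms"
    and nz: "(\<Sum>u\<in>U. orbit_sum A u * orbit_sum A' (inv\<^bsub>G\<^esub> u)) \<noteq> 0"
  obtains g g' where "g \<in> T" "g' \<in> T" "act g A = act g' A'"
proof -
  have neg: "pairing C (- B) = - pairing C B" if "B \<in> forms" for C B
    unfolding pairing_def sum_negf[symmetric] using formsD(1)[OF that] by (intro sum.cong refl) auto
  have "(\<Sum>u\<in>U. orbit_sum A u * orbit_sum A' (inv\<^bsub>G\<^esub> u)) =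
    (\<Sum>u\<in>U. \<Sum>g\<in>T. \<Sum>g'\<in>T. \<theta> (pairing (act g A) (bil u) - pairing (act g' A') (bil u)))"
  proof (rule sum.cong[OF refl])
    fix u assume u: "u \<in> U"
    have Bf: "bil u \<in> forms" using bil_forms U_T[OF u] by blast
    have "orbit_sum A' (inv\<^bsub>G\<^esub> u) = (\<Sum>g'\<in>T. \<theta> (- pairing (act g' A') (bil u)))"
      using orbit_sum_eq[OF A' U_T[OF inv_G(1)[OF u]]] by (simp add: bil_inverse[OF u] neg[OF Bf])
    then show "orbit_sum A u * orbit_sum A' (inv\<^bsub>G\<^esub> u) =
      (\<Sum>g\<in>T. \<Sum>g'\<in>T. \<theta> (pairing (act g A) (bil u) - pairing (act g' A') (bil u)))"
      unfolding orbit_sum_eq[OF A U_T[OF u]] by (simp add: sum_product \<theta>_add[symmetric])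
  qed
  also have "\<dots> = (\<Sum>g\<in>T. \<Sum>u\<in>U. \<Sum>g'\<in>T. \<theta> (pairing (act g A) (bil u) - pairing (act g' A') (bil u)))" by (rule sum.swap)
  also have "\<dots> = (\<Sum>g\<in>T. \<Sum>g'\<in>T. \<Sum>u\<in>U. \<theta> (pairing (act g A) (bil u) - pairing (act g' A') (bil u)))"
    by (rule sum.cong[OF refl], rule sum.swap)
  also have "\<dots> = (\<Sum>g\<in>T. \<Sum>g'\<in>T. \<Sum>B\<in>forms. \<theta> (pairing (act g A) B - pairing (act g' A') B))"
    by (rule sum.cong[OF refl], rule sum.cong[OF refl], rule sum.reindex_bij_betw[OF bil_bij])
  finally have "\<exists>g\<in>T. \<exists>g'\<in>T. (\<Sum>B\<in>forms. \<theta> (pairing (act g A) B - pairing (act g' A') B)) \<noteq> 0"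
    using nz by (metis (no_types, lifting) sum.neutral)
  then show ?thesis using that orthogonality act_forms A A' by meson
qed

text \<open>
  If \<open>A'\<close> is the truncation of \<open>h\<^sup>T A h\<close> then \<open>A h\<close> and \<open>h\<^sup>-\<^sup>T A'\<close> agree above the antidiagonal;
  comparing entries from the upper left corner on gives \<open>A = A'\<close> when both are monomial.
\<close>

lemma monomial_unique_aux:
  assumes A: "A \<in> forms" "monomial A" and A': "A' \<in> forms" "monomial A'" and h: "h \<in> T" and e: "act h A = A'"
  shows "A = A'"
proof -
  note hd = unitriangularD[OF h]
  obtain y where y: "y \<in> T" "h * y = 1\<^sub>m m" "y * h = 1\<^sub>m m" using unitriangular_inverse[OF h] by blast
  note yd = unitriangularD[OF y(1)]
  note Ac = formsD(1)[OF A(1)] and A'c = formsD(1)[OF A'(1)]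
  have hT: "h\<^sup>T \<in> carrier_mat m m" and yT: "y\<^sup>T \<in> carrier_mat m m" using hd(1) yd(1) by auto
  have Ah: "A * h \<in> carrier_mat m m" using Ac hd(1) by simp
  have yh: "y\<^sup>T * h\<^sup>T = 1\<^sub>m m" using transpose_mult[OF hd(1) yd(1)] y(2) by simp
  have AhE: "A * h = y\<^sup>T * cotrans h A"
  proof -
    have "y\<^sup>T * cotrans h A = y\<^sup>T * (h\<^sup>T * (A * h))"
      unfolding cotrans_def using assoc[OF hT Ac hd(1)] by simp
    also have "\<dots> = A * h" using assoc[OF yT hT Ah] left_mult_one_mat[OF Ah] unfolding yh by simp
    finally show ?thesis by simp
  qed
  have cc: "cotrans h A \<in> carrier_mat m m" unfolding cotrans_def using hT Ac hd(1) by (intro mult_carrier_mat[of _ m m])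
  \<comment> \<open>\<open>A'\<close> agrees with \<open>cotrans h A\<close> only inside the
    triangle. But row \<open>k\<close> of the lower triangular \<open>y\<^sup>T\<close> only calls
    on rows \<open>c \<le> k\<close>, for which \<open>c + l + 1 < m\<close> still holds.\<close>
  have key: "(\<Sum>d<m. A $$ (k, d) * h $$ (d, l)) = (\<Sum>c<m. y $$ (c, k) * A' $$ (c, l))" if kl: "k + l + 1 < m" for k l
  proof -
    have km: "k < m" "l < m" using kl by auto
    have "(\<Sum>d<m. A $$ (k, d) * h $$ (d, l)) = (A * h) $$ (k, l)"
      using mult_mat_index[OF Ac hd(1) km] by simp
    also have "\<dots> = (\<Sum>c<m. y\<^sup>T $$ (k, c) * cotrans h A $$ (c, l))"
      unfolding AhE by (rule mult_mat_index[OF yT cc km])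
    also have "\<dots> = (\<Sum>c<m. y $$ (c, k) * A' $$ (c, l))"
    proof (intro sum.cong refl)
      fix c assume c: "c \<in> {..<m}"
      show "y\<^sup>T $$ (k, c) * cotrans h A $$ (c, l) = y $$ (c, k) * A' $$ (c, l)"
      proof (cases "c \<le> k")
        case True
        then have "A' $$ (c, l) = cotrans h A $$ (c, l)" using kl c km by (simp add: e[symmetric] act_def)
        then show ?thesis using c km yd(1) by simp
      next
        case False
        then show ?thesis using c km yd(1) yd(2)[of k c] by simp
      qed
    qed
    finally show ?thesis .
  qed
  have main: "A $$ (k, l) = A' $$ (k, l)" if "k + l + 1 < m" for k l
    using that
  proof (induction "k + l" arbitrary: k l rule: less_induct)
    case less
    have km: "k < m" "l < m" using less.prems by auto
    have IH: "A $$ (c, d) = A' $$ (c, d)" if "c \<le> k" "d \<le> l" "c < k \<or> d < l" for c d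
    proof -
      have "c + d < k + l" using that by linarith
      then show ?thesis using less.hyps[of c d] less.prems by linarith
    qed
    have L: "(\<Sum>d<m. A $$ (k, d) * h $$ (d, l)) = A $$ (k, l)" if z: "\<And>d. d < l \<Longrightarrow> A $$ (k, d) = 0"
    proof -
      have "(\<Sum>d<m. A $$ (k, d) * h $$ (d, l)) = (\<Sum>d<m. if d = l then A $$ (k, l) else 0)"
      proof (intro sum.cong refl)
        fix d assume "d \<in> {..<m}"
        then show "A $$ (k, d) * h $$ (d, l) = (if d = l then A $$ (k, l) else 0)"
          using z[of d] hd(2)[of l d] hd(3)[of l] km by (cases d l rule: linorder_cases) auto
      qed
      then show ?thesis using km by simp
    qed
    have R: "(\<Sum>c<m. y $$ (c, k) * A' $$ (c, l)) = A' $$ (k, l)" if z: "\<And>c. c < k \<Longrightarrow> A' $$ (c, l) = 0"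
    proof -
      have "(\<Sum>c<m. y $$ (c, k) * A' $$ (c, l)) = (\<Sum>c<m. if c = k then A' $$ (k, l) else 0)"
      proof (intro sum.cong refl)
        fix c assume "c \<in> {..<m}"
        then show "y $$ (c, k) * A' $$ (c, l) = (if c = k then A' $$ (k, l) else 0)"
          using z[of c] yd(2)[of k c] yd(3)[of k] km by (cases c k rule: linorder_cases) auto
      qed
      then show ?thesis using km by simp
    qed
    show ?case
    proof (cases "A $$ (k, l) = 0 \<and> A' $$ (k, l) = 0")
      case True then show ?thesis by simp
    next
      case False
      \<comment> \<open>If one of the two matrices has a nonzero entry at \<open>(k, l)\<close>, it
        has no other in that row and column, and by the induction hypothesis its zeros to the left
        and above are shared by the other matrix. Then both sides of \<open>key\<close> reduce to a
        single entry.\<close>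
      have "(\<forall>d<l. A $$ (k, d) = 0) \<and> (\<forall>c<k. A' $$ (c, l) = 0)"
      proof (cases "A $$ (k, l) \<noteq> 0")
        case True
        have "A $$ (k, d) = 0" if "d < l" for d
          using A(2) True km that unfolding monomial_def by (metis less_trans nat_neq_iff)
        moreover have "A' $$ (c, l) = 0" if "c < k" for c
        proof -
          have "A $$ (c, l) = 0" using monomial_column[OF A _ _ km(2) _ True, of c] km that by force
          then show ?thesis using IH[of c l] that by simp
        qed
        ultimately show ?thesis by blast
      next
        case False
        with \<open>\<not> (A $$ (k, l) = 0 \<and> A' $$ (k, l) = 0)\<close> have nz: "A' $$ (k, l) \<noteq> 0" by blast
        have "A $$ (k, d) = 0" if "d < l" for d
        proof -
          have "A' $$ (k, d) = 0" using A'(2) nz km that unfolding monomial_def by (metis less_trans nat_neq_iff)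
          then show ?thesis using IH[of k d] that by simp
        qed
        moreover have "A' $$ (c, l) = 0" if "c < k" for c
          using monomial_column[OF A' _ _ km(2) _ nz, of c] km that by force
        ultimately show ?thesis by blast
      qed
      then show ?thesis using L R key[OF less.prems] by simp
    qed
  qed
  show ?thesis
  proof (rule forms_eqI[OF A(1) A'(1)])
    fix p assume "p \<in> root_pairs"
    then show "A $$ p = A' $$ p" using main root_pairsD(5) by (cases p) blast
  qed
qed

text \<open>\<open>act\<close> truncates after each step, which blocks a direct computation. Testing
  against \<open>unit_form\<close> moves the question to congruence, where multiplicativity is
  plain.\<close>

lemma act_act:
  assumes g: "g \<in> T" and h: "h \<in> T" and A: "A \<in> forms"
  shows "act h (act g A) = act (g * h) A"
proof (rule forms_eqI)
  have gA: "act g A \<in> forms" by (rule act_forms[OF g A])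
  have gh: "g * h \<in> T" by (rule unitriangular_mult[OF g h])
  show F: "act h (act g A) \<in> forms" "act (g * h) A \<in> forms" using act_forms[OF h gA] act_forms[OF gh A] by auto
  fix p assume p: "p \<in> root_pairs"
  note E = unit_form[OF p, where x = 1]
  have "coef (act h (act g A)) p = pairing (act h (act g A)) (unit_form p 1)" using E(2)[OF F(1)] by simp
  also have "\<dots> = pairing (act g A) (h * unit_form p 1 * h\<^sup>T)" by (rule pairing_act[OF h gA E(1), symmetric])
  also have "\<dots> = pairing A (g * (h * unit_form p 1 * h\<^sup>T) * g\<^sup>T)"
    by (rule pairing_act[OF g A congruence_forms[OF h E(1)], symmetric])
  also have "g * (h * unit_form p 1 * h\<^sup>T) * g\<^sup>T = g * h * unit_form p 1 * (g * h)\<^sup>T"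
    by (rule congruence_mult[OF unitriangularD(1)[OF g] unitriangularD(1)[OF h] formsD(1)[OF E(1)], symmetric])
  also have "pairing A \<dots> = pairing (act (g * h) A) (unit_form p 1)" by (rule pairing_act[OF gh A E(1)])
  also have "\<dots> = coef (act (g * h) A) p" using E(2)[OF F(2)] by simp
  finally show "act h (act g A) $$ p = act (g * h) A $$ p" using two by (simp add: coef_def split: if_splits)
qed

lemma act_one:
  assumes A: "A \<in> forms"
  shows "act (1\<^sub>m m) A = A"
proof -
  have "cotrans (1\<^sub>m m) A = A" unfolding cotrans_def
    using left_mult_one_mat[OF formsD(1)[OF A]] right_mult_one_mat[OF formsD(1)[OF A]] by simp
  then show ?thesis using formsD(1)[OF A] formsD(3)[OF A] by (intro eq_matI) (auto simp: act_def)
qed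

lemma monomial_unique:
  assumes A: "A \<in> forms" "monomial A" and A': "A' \<in> forms" "monomial A'"
    and g: "g \<in> T" "g' \<in> T" and e: "act g A = act g' A'"
  shows "A = A'"
proof -
  obtain y where y: "y \<in> T" "g' * y = 1\<^sub>m m" using unitriangular_inverse[OF g(2)] by blast
  have "act (g * y) A = act y (act g A)" by (rule act_act[OF g(1) y(1) A(1), symmetric])
  also have "\<dots> = A'" unfolding e act_act[OF g(2) y(1) A'(1)] y(2) by (rule act_one[OF A'(1)])
  finally show ?thesis by (rule monomial_unique_aux[OF A A' unitriangular_mult[OF g(1) y(1)]])
qed

section \<open>The regular character as a sum of orbit sums\<close>

lemma zero_forms: "0\<^sub>m m m \<in> forms"
  by (auto simp: forms_def)

text \<open>Orthogonality of the characters of \<open>forms\<close> leaves only the case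
  \<open>g * bil u * g\<^sup>T = 0\<close>, that is \<open>u = 1\<close>. As \<open>forms\<close>
  and \<open>U\<close> have equal size, the sum is the regular character times the order of
  \<open>T\<close>.\<close>

lemma sum_orbit_sums:
  assumes u: "u \<in> U"
  shows "(\<Sum>A\<in>forms. orbit_sum A u) = (if u = 1\<^sub>m m then of_nat (card T) * of_nat (card forms) else 0)"
proof -
  have Bf: "bil u \<in> forms" using bil_forms U_T[OF u] by blast
  have p0: "pairing A (0\<^sub>m m m) = 0" "pairing (0\<^sub>m m m) A = 0" for A by (simp_all add: pairing_def)
  have "(\<Sum>A\<in>forms. orbit_sum A u) = (\<Sum>g\<in>T. \<Sum>A\<in>forms. \<theta> (pairing A (g * bil u * g\<^sup>T)))"
    unfolding orbit_sum_def by (rule sum.swap)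
  also have "\<dots> = (\<Sum>g\<in>T. if u = 1\<^sub>m m then of_nat (card forms) else 0)"
  proof (intro sum.cong refl)
    fix g assume g: "g \<in> T"
    note gc = unitriangularD(1)[OF g]
    have U1: "1\<^sub>m m \<in> U" using isometries_one U_isometries by simp
    have b1: "bil (1\<^sub>m m) = 0\<^sub>m m m"
    proof (rule forms_eqI[OF bil_forms[OF unitriangular_one] zero_forms])
      fix p assume p: "p \<in> root_pairs"
      obtain a b where ab: "p = (a, b)" by force
      note d = root_pairsD[OF p[unfolded ab]]
      show "bil (1\<^sub>m m) $$ p = 0\<^sub>m m m $$ p"
      proof -
        have "a \<noteq> m - 1 - b" "b \<noteq> m - 1 - a" using d(5) by auto
        then show ?thesis unfolding ab using bil_index[of "1\<^sub>m m" a b] d(3,4) by simp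
      qed
    qed
    show "(\<Sum>A\<in>forms. \<theta> (pairing A (g * bil u * g\<^sup>T))) = (if u = 1\<^sub>m m then of_nat (card forms) else 0)"
    proof (cases "u = 1\<^sub>m m")
      case True
      have "g * 0\<^sub>m m m * g\<^sup>T = 0\<^sub>m m m" using gc by simp
      then show ?thesis using True b1 p0 \<theta>_0 by simp
    next
      case False
      obtain y where y: "y \<in> T" "y * g = 1\<^sub>m m" using unitriangular_inverse[OF g] by blast
      note yc = unitriangularD(1)[OF y(1)]
      have ne: "g * bil u * g\<^sup>T \<noteq> 0\<^sub>m m m"
      proof
        assume z: "g * bil u * g\<^sup>T = 0\<^sub>m m m"
        have "bil u = (y * g) * bil u * (y * g)\<^sup>T"
          unfolding y(2) using left_mult_one_mat[OF formsD(1)[OF Bf]] right_mult_one_mat[OF formsD(1)[OF Bf]] by simp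
        also have "\<dots> = y * (g * bil u * g\<^sup>T) * y\<^sup>T" by (rule congruence_mult[OF yc gc formsD(1)[OF Bf]])
        also have "\<dots> = 0\<^sub>m m m" unfolding z using yc by simp
        finally have "bil u = bil (1\<^sub>m m)" using b1 by simp
        then show False using False inj_onD[OF bij_betw_imp_inj_on[OF bil_bij]] u U1 by blast
      qed
      have "(\<Sum>A\<in>forms. \<theta> (pairing (g * bil u * g\<^sup>T) A - pairing (0\<^sub>m m m) A)) = 0"
        by (rule orthogonality[OF congruence_forms[OF g Bf] zero_forms ne])
      then show ?thesis using False by (simp add: p0 pairing_commute[of "g * bil u * g\<^sup>T"])
    qed
  qed
  finally show ?thesis by simp
qed

section \<open>The supercharacters partition the irreducible characters\<close>

lemma elementary_character_character:
  assumes \<alpha>: "\<alpha> \<in> roots t n"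
  shows "elementary_character \<theta> t n \<alpha> c \<in> characters G"
proof -
  obtain a b where ab: "root_pair \<alpha> = (a, b)" by force
  have p: "(a, b) \<in> root_pairs" using root_pair_mem[OF \<alpha>] ab by simp
  have fin: "finite (carrier G)" using finite_U by (simp add: G_simps)
  show ?thesis
    unfolding elementary_character_eq[OF \<alpha> ab]
  proof (rule induced_character_character[OF group_G fin H_subgroup[OF p]])
    have "a \<noteq> m - 1 - b" "m - 1 - b < m" using root_pairsD(5)[OF p] by auto
    then have "(1\<^sub>m m :: 'a mat) $$ (a, m - 1 - b) = 0" using root_pairsD(3)[OF p] by simp
    then show "\<theta> (c * \<one>\<^bsub>G\<^esub> $$ (a, m - 1 - b)) = 1" by (simp add: G_simps \<theta>_0)
    fix x y assume "x \<in> H a b" "y \<in> H a b"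
    then show "\<theta> (c * (x \<otimes>\<^bsub>G\<^esub> y) $$ (a, m - 1 - b)) = \<theta> (c * x $$ (a, m - 1 - b)) * \<theta> (c * y $$ (a, m - 1 - b))"
      using H_mult(2)[OF _ _ p] by (simp add: G_simps distrib_left \<theta>_add)
  qed
qed

lemma supercharacter_character:
  assumes "D \<subseteq> roots t n"
  shows "supercharacter \<theta> t n D \<phi> \<in> characters G"
proof -
  have "finite (roots t n)"
    by (rule inj_on_finite[OF root_pair_inj _ finite_root_pairs]) (use root_pair_mem in blast)
  then have "finite D" using assms finite_subset by blast
  then show ?thesis using assms
  proof (induction D rule: finite_induct)
    case empty
    then show ?case
      unfolding supercharacter_def prod.empty using trivial_character[OF group_G, unfolded G_simps] by blast
  next
    case (insert \<alpha> D)
    have "supercharacter \<theta> t n (insert \<alpha> D) \<phi> =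
      (\<lambda>x\<in>carrier G. elementary_character \<theta> t n \<alpha> (\<phi> \<alpha>) x * supercharacter \<theta> t n D \<phi> x)"
      unfolding supercharacter_def G_simps using insert.hyps by (intro restrict_ext) simp
    also have "\<dots> \<in> characters G"
      by (rule character_mult[OF group_G elementary_character_character]) (use insert in blast)+
    finally show ?case .
  qed
qed

lemma unique_supercharacter:
  assumes \<chi>: "\<chi> \<in> irreducible_characters G"
  shows "\<exists>!\<xi>. \<xi> \<in> supercharacters \<theta> t n \<and> constituent G \<chi> \<xi>"
proof (rule ex_ex1I)
  have fin: "finite (carrier G)" using finite_U by (simp add: G_simps)
  have "\<chi> \<in> characters G"
    using \<chi> charactersI unfolding irreducible_characters_def irreducible_representation_def by blast
  then obtain d where d: "d \<ge> 1" "\<chi> (1\<^sub>m m) = of_nat d"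
    using character_one[OF group_G] unfolding G_simps by blast
  have inv_one: "inv\<^bsub>G\<^esub> (1\<^sub>m m) = 1\<^sub>m m"
    using monoid.inv_one[OF group.is_monoid[OF group_G]] by (simp add: G_simps)
  have U1: "1\<^sub>m m \<in> U" using isometries_one U_isometries by simp
  \<comment> \<open>The regular character pairs with \<open>\<chi>\<close> to a nonzero multiple of
    the degree. So some orbit sum pairs with \<open>\<chi>\<close> to a nonzero value, and its
    matrix may be replaced by the monomial one in its orbit.\<close>
  have "(\<Sum>A\<in>forms. \<Sum>u\<in>U. orbit_sum A u * \<chi> (inv\<^bsub>G\<^esub> u)) = (\<Sum>u\<in>U. (\<Sum>A\<in>forms. orbit_sum A u) * \<chi> (inv\<^bsub>G\<^esub> u))"
    unfolding sum_distrib_right by (rule sum.swap)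
  also have "\<dots> = (\<Sum>u\<in>U. if u = 1\<^sub>m m then of_nat (card T) * of_nat (card forms) * of_nat d else 0)"
  proof (intro sum.cong refl)
    fix u assume "u \<in> U"
    then show "(\<Sum>A\<in>forms. orbit_sum A u) * \<chi> (inv\<^bsub>G\<^esub> u) =
      (if u = 1\<^sub>m m then of_nat (card T) * of_nat (card forms) * of_nat d else 0)"
      using sum_orbit_sums d(2) inv_one by (cases "u = 1\<^sub>m m") simp_all
  qed
  also have "\<dots> = of_nat (card T) * of_nat (card forms) * of_nat d" using U1 finite_U by simp
  also have "\<dots> \<noteq> 0"
  proof -
    have "card T > 0" using card_pos[of T] unitriangular_one by blast
    moreover have "card forms > 0" using finite_forms zero_forms card_gt_0_iff by blast
    ultimately show ?thesis using d(1) by simp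
  qed
  finally obtain A where A: "A \<in> forms" "(\<Sum>u\<in>U. orbit_sum A u * \<chi> (inv\<^bsub>G\<^esub> u)) \<noteq> 0"
    using sum.not_neutral_contains_not_neutral by blast
  obtain g where g: "g \<in> T" "monomial (act g A)" using monomial_representative[OF A(1)] by blast
  define B where "B = act g A"
  have B: "B \<in> forms" "monomial B" using act_forms[OF g(1) A(1)] g(2) by (auto simp: B_def)
  obtain K where K: "K \<noteq> 0"
    "\<And>u. u \<in> U \<Longrightarrow> supercharacter \<theta> t n (root_set B) (root_coeff B) u = K * orbit_sum B u"
    using supercharacter_orbit_sum[OF B] by blast
  let ?\<xi> = "supercharacter \<theta> t n (root_set B) (root_coeff B)"
  have "char_form G ?\<xi> \<chi> = (\<Sum>u\<in>U. K * (orbit_sum A u * \<chi> (inv\<^bsub>G\<^esub> u)))"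
    unfolding char_form_def G_simps
    using K(2) orbit_sum_act[OF A(1) g(1) U_T] by (intro sum.cong refl) (simp add: B_def)
  also have "\<dots> = K * (\<Sum>u\<in>U. orbit_sum A u * \<chi> (inv\<^bsub>G\<^esub> u))" by (simp only: sum_distrib_left)
  finally have "char_form G ?\<xi> \<chi> \<noteq> 0" using K(1) A(2) by simp
  moreover have "?\<xi> \<in> characters G" by (rule supercharacter_character) (auto simp: root_set_def)
  ultimately have "constituent G \<chi> ?\<xi>" by (intro constituentI[OF group_G fin \<chi>])
  moreover have "?\<xi> \<in> supercharacters \<theta> t n"
    using monomial_basic[OF B] unfolding supercharacters_def by blast
  ultimately show "\<exists>\<xi>. \<xi> \<in> supercharacters \<theta> t n \<and> constituent G \<chi> \<xi>" by blast
next
  have fin: "finite (carrier G)" using finite_U by (simp add: G_simps)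
  \<comment> \<open>\<open>\<phi>\<close> is arbitrary outside \<open>D\<close>, so a supercharacter
    is first rewritten in terms of a monomial form, which then determines it.\<close>
  have form: "\<exists>A\<in>forms. monomial A \<and> \<xi> = supercharacter \<theta> t n (root_set A) (root_coeff A)"
    if \<xi>: "\<xi> \<in> supercharacters \<theta> t n" for \<xi>
  proof -
    obtain D \<phi> where D: "basic_pair t n D \<phi>" "\<xi> = supercharacter \<theta> t n D \<phi>"
      using \<xi> unfolding supercharacters_def by blast
    obtain A where A: "A \<in> forms" "monomial A" "root_set A = D" "\<And>\<alpha>. \<alpha> \<in> D \<Longrightarrow> root_coeff A \<alpha> = \<phi> \<alpha>"
      using basic_monomial[OF D(1)] by blast
    have "\<xi> = supercharacter \<theta> t n (root_set A) (root_coeff A)"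
      unfolding D(2) A(3) supercharacter_def using A(4) by (intro restrict_ext prod.cong refl) simp
    then show ?thesis using A(1,2) by blast
  qed
  fix \<xi> \<xi>' assume x: "\<xi> \<in> supercharacters \<theta> t n \<and> constituent G \<chi> \<xi>"
    and x': "\<xi>' \<in> supercharacters \<theta> t n \<and> constituent G \<chi> \<xi>'"
  obtain A where A: "A \<in> forms" "monomial A" "\<xi> = supercharacter \<theta> t n (root_set A) (root_coeff A)"
    using form x by blast
  obtain A' where A': "A' \<in> forms" "monomial A'" "\<xi>' = supercharacter \<theta> t n (root_set A') (root_coeff A')"
    using form x' by blast
  obtain K where K: "\<And>u. u \<in> U \<Longrightarrow> \<xi> u = K * orbit_sum A u"
    using supercharacter_orbit_sum[OF A(1,2)] unfolding A(3) by blast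
  obtain K' where K': "\<And>u. u \<in> U \<Longrightarrow> \<xi>' u = K' * orbit_sum A' u"
    using supercharacter_orbit_sum[OF A'(1,2)] unfolding A'(3) by blast
  have "char_form G \<xi> \<xi>' = (\<Sum>u\<in>U. K * K' * (orbit_sum A u * orbit_sum A' (inv\<^bsub>G\<^esub> u)))"
    unfolding char_form_def G_simps using K K' inv_G(1) by (intro sum.cong refl) simp
  also have "\<dots> = K * K' * (\<Sum>u\<in>U. orbit_sum A u * orbit_sum A' (inv\<^bsub>G\<^esub> u))" by (simp only: sum_distrib_left)
  finally have "(\<Sum>u\<in>U. orbit_sum A u * orbit_sum A' (inv\<^bsub>G\<^esub> u)) \<noteq> 0"
    using char_form_common_constituent[OF group_G fin conjunct2[OF x] conjunct2[OF x']] by auto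
  then obtain g g' where "g \<in> T" "g' \<in> T" "act g A = act g' A'"
    using orbit_sums_orthogonal[OF A(1) A'(1)] by blast
  then have "A = A'" by (intro monomial_unique[OF A(1,2) A'(1,2)])
  then show "\<xi> = \<xi>'" using A(3) A'(3) by simp
qed

end

text \<open>Translation by \<open>1\<close> permutes the field and preserves the sum of its
  elements, so the number of elements is zero in it; if that number is odd and \<open>2 = 0\<close>,
  then \<open>1 = 0\<close>.\<close>

lemma two_neq_0_of_odd_card:
  assumes "odd (card (UNIV :: 'a::{field,finite} set))"
  shows "(2 :: 'a) \<noteq> 0"
proof
  assume two: "(2 :: 'a) = 0"
  have "(\<Sum>x\<in>UNIV. x) = (\<Sum>x\<in>UNIV. x + (1 :: 'a))"
    by (rule sum.reindex_bij_witness[of _ "\<lambda>x. x + 1" "\<lambda>x. x - 1"]) auto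
  then have "of_nat (card (UNIV :: 'a set)) = (0 :: 'a)" by (simp add: sum.distrib)
  moreover obtain k where "card (UNIV :: 'a set) = 2 * k + 1" using assms by (elim oddE)
  ultimately show False using two by simp
qed

theorem theorem4p7:
  fixes \<theta> :: "'a::{field,finite} \<Rightarrow> complex"
    and \<chi> :: "'a mat \<Rightarrow> complex"
    and t :: classical_type
    and n p e :: nat
  assumes "prime p" and "odd p" and "e \<ge> 1" and "card (UNIV :: 'a set) = p ^ e"
    and "n \<ge> 1"
    and "nontrivial_additive_character \<theta>"
    and "\<chi> \<in> irreducible_characters (unipotent_group t n)"
  shows "\<exists>!\<xi>. \<xi> \<in> supercharacters \<theta> t n \<and> constituent (unipotent_group t n) \<chi> \<xi>"
proof -
  have "(2 :: 'a) \<noteq> 0" using assms(2,4) by (intro two_neq_0_of_odd_card) simp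
  then interpret unipotent t n \<theta> using assms(5,6) by unfold_locales
  show ?thesis by (rule unique_supercharacter[OF assms(7)])
qed

end
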